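(* In $\mathcal F_R(M(n))$ the determinant element $\det=\xi^{\{1,\dots,n\}}_{\{1,\dots,n\}}$ commutes with all dynamical quantum minor determinants $\xi^I_J$, for $I,J$ subsets of $\{1,\dots,n\}$. In particular $\det$ commutes with all generators $t_{ij}$. Moreover $\Delta(\det)=\det\otimes\det$ and $\varepsilon(\det)=T_{-\underline1}$, where $\underline1=(1,\dots,1)\in\mathfrak h^*$.
   Context: Setting. Fix $n\ge 1$ and $q\in\mathbb C^\times$ not a root of unity, with a fixed choice of $\log q$ and $q^z=\exp(z\log q)$. Identify $\mathfrak h^*\cong\mathbb C^n$ with unit vectors $e_i$, put $\omega(i)=e_i$, $\omega(I)=\sum_{i\in I}e_i$. $M_{\mathfrak h^*}$ is the field of meromorphic functions on $\mathfrak h^*$ (in $\underline\lambda=(\lambda_1,\dots,\lambda_n)$), $(T_\alpha f)(\lambda)=f(\lambda+\alpha)$. Put $h_0(z)=\frac{q^{-1}-q}{q^{-2z}-1}$, $g(z)=\frac{(q^{-2z}-q^{-2})(q^{-2z}-q^2)}{(q^{-2z}-1)^2}$, $h(z)=q-h_0(z)=q\frac{q^{-2z}-q^{-2}}{q^{-2z}-1}$. The $\mathfrak h$-bialgebroid $\mathcal F_R(M(n))$. It is the unital associative $\mathbb C$-algebra generated by $t_{ij}$ ($1\le i,j\le n$) and two commuting copies of $M_{\mathfrak h^*}$, written $f(\underline\lambda)=\mu_l(f)$ and $f(\underline\mu)=\mu_r(f)$, with relations $f(\underline\lambda)t_{ij}=t_{ij}f(\underline\lambda+\omega(i))$, $f(\underline\mu)t_{ij}=t_{ij}f(\underline\mu+\omega(j))$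 and, for all $a,b,c,d$, the RLL-relations $\sum_{x,y}R^{xy}_{ac}(\underline\lambda)t_{xb}t_{yd}=\sum_{x,y}R^{bd}_{xy}(\underline\mu)t_{cy}t_{ax}$. The nonzero $R$-entries are $R^{aa}_{aa}=q$; $R^{ab}_{ab}(\underline\lambda)=1$ if $a<b$ and $g(\lambda_a-\lambda_b)$ if $a>b$; $R^{ab}_{ba}(\underline\lambda)=h_0(\lambda_a-\lambda_b)$ if $a\ne b$. It is bigraded by $\mathfrak h^*$: $t_{ij}$ has bidegree $(\omega(i),\omega(j))$, and $f(\underline\lambda),f(\underline\mu)$ have bidegree $(0,0)$. For bigraded algebras $\mathcal A,\mathcal B$ with maps $\mu_l,\mu_r$ from $M_{\mathfrak h^*}$, $(\mathcal A\widetilde\otimes\mathcal B)_{\alpha\beta}=\bigoplus_\gamma\mathcal A_{\alpha\gamma}\otimes\mathcal B_{\gamma\beta}$ modulo $\mu_r(f)a\otimes b=a\otimes\mu_l(f)b$, with product $(a\otimes b)(c\otimes d)=ac\otimes bd$. $D_{\mathfrak h^*}$ is the algebra of difference operators $\sum_i f_iT_{\beta_i}$ on $M_{\mathfrak h^*}$. The comultiplication $\Delta\colon\mathcal F_R(M(n))\to\mathcal F_R(M(n))\widetilde\otimes\mathcal F_R(M(n))$ and counit $\varepsilon\colon\mathcal F_R(M(n))\to D_{\mathfrak h^*}$ are the algebra homomorphisms with $\Delta(t_{ij})=\sum_kt_{ik}\otimes t_{kj}$, $\Delta(f(\underline\lambda))=f(\underline\lambda)\otimes1$, $\Delta(f(\underline\mu))=1\otimes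 f(\underline\mu)$, $\varepsilon(t_{ij})=\delta_{ij}T_{-\omega(i)}$, $\varepsilon(f(\underline\lambda))=\varepsilon(f(\underline\mu))=f$. Dynamical quantum minor determinants $\xi^I_J$. $W$ is the unital associative algebra generated by $w_1,\dots,w_n$ and a copy of $M_{\mathfrak h^*}$ (elements $f(\underline\lambda)=\mu_W(f)$), with relations $w_i^2=0$, $w_jw_i=-h(\lambda_j-\lambda_i)w_iw_j$ for $i<j$, $f(\underline\lambda)w_i=w_if(\underline\lambda+\omega(i))$. For $I=\{i_1<\dots<i_r\}$ put $w_I=w_{i_1}\cdots w_{i_r}$ ($w_\emptyset=1$), of degree $\omega(I)$; the $w_I$ form an $M_{\mathfrak h^*}$-basis of $W$. $W\widetilde\otimes\mathcal F_R(M(n))=\bigoplus_{\alpha,\beta}W_\alpha\otimes\mathcal F_R(M(n))_{\alpha\beta}$ modulo $w\otimes\mu_l(f)a=\mu_W(f)w\otimes a$, with product $(v\otimes a)(w\otimes b)=vw\otimes ab$. There is a unique unital algebra homomorphism $R\colon W\to W\widetilde\otimes\mathcal F_R(M(n))$ with $R(w_i)=\sum_jw_j\otimes t_{ji}$ and $R(\mu_W(f)w)=(1\otimes\mu_r(f))R(w)$. For $\#I=\#J$, $\xi^I_J$ is defined by $R(w_J)=\sum_{\#I=\#J}w_I\otimes\xi^I_J$; explicitly, for $J=\{j_1<\dots<j_r\}$, $\xi^I_J=\sum_{\sigma\in S_r}\mu_l(S(\sigma,I))\,t_{i_{\sigma(1)}j_1}\cdots t_{i_{\sigma(r)}j_r}$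 with $S(\sigma,I)(\underline\lambda)=\prod_{k<l,\,\sigma(k)>\sigma(l)}\big(-h(\lambda_{i_{\sigma(k)}}-\lambda_{i_{\sigma(l)}})\big)$. For $\#I\ne\#J$, $\xi^I_J=0$. *)

theory Defs
  imports "HOL-Complex_Analysis.Complex_Analysis" "HOL-Algebra.QuotRing" "HOL-Library.Poly_Mapping"
begin

definition holomorphic_several :: "(complex ^ 'n \<Rightarrow> complex) \<Rightarrow> (complex ^ 'n) set \<Rightarrow> bool" where
  "holomorphic_several f U \<longleftrightarrow>
     (\<forall>x\<in>U. \<exists>D. (f has_derivative D) (at x) \<and> (\<forall>c v. D (c *s v) = c * D v))"

text \<open>
  A meromorphic function is represented by a total function that is locally a quotient \<open>g / h\<close> of
  holomorphic functions, where \<open>h\<close> vanishes identically on no nonempty open set; its values where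
  \<open>h\<close> vanishes are irrelevant, since representatives are identified when they agree on a dense
  open set.
\<close>

definition meromorphic_several :: "(complex ^ 'n \<Rightarrow> complex) \<Rightarrow> bool" where
  "meromorphic_several f \<longleftrightarrow>
     (\<forall>p. \<exists>V g h. open V \<and> p \<in> V \<and> holomorphic_several g V \<and> holomorphic_several h V \<and>
        (\<forall>U. open U \<and> U \<noteq> {} \<and> U \<subseteq> V \<longrightarrow> (\<exists>z\<in>U. h z \<noteq> 0)) \<and>
        (\<forall>z\<in>V. h z \<noteq> 0 \<longrightarrow> f z = g z / h z))"

definition mero_eq :: "(complex ^ 'n \<Rightarrow> complex) \<Rightarrow> (complex ^ 'n \<Rightarrow> complex) \<Rightarrow> bool" where
  "mero_eq f g \<longleftrightarrow> meromorphic_several f \<and> meromorphic_several g \<and>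
     (\<exists>U. open U \<and> closure U = UNIV \<and> (\<forall>x\<in>U. f x = g x))"

lemma hol_subset: "holomorphic_several f V \<Longrightarrow> U \<subseteq> V \<Longrightarrow> holomorphic_several f U"
  unfolding holomorphic_several_def by blast

lemma hol_const: "holomorphic_several (\<lambda>x. c) V"
  unfolding holomorphic_several_def by (intro ballI exI[of _ "\<lambda>x. 0"]) auto

lemma hol_component: "holomorphic_several (\<lambda>x. x $ i) V"
  unfolding holomorphic_several_def
  by (intro ballI exI[of _ "\<lambda>x. x $ i"])
     (auto intro!: bounded_linear_imp_has_derivative bounded_linear_vec_nth)

lemma hol_add: 
  assumes "holomorphic_several f V" "holomorphic_several g V"
  shows "holomorphic_several (\<lambda>x. f x + g x) V"
  unfolding holomorphic_several_def
proof
  fix x assume x: "x \<in> V"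
  from assms x obtain D E where 
    D: "(f has_derivative D) (at x)" "\<And>c v. D (c *s v) = c * D v" and
    E: "(g has_derivative E) (at x)" "\<And>c v. E (c *s v) = c * E v"
    unfolding holomorphic_several_def by meson
  show "\<exists>D. ((\<lambda>x. f x + g x) has_derivative D) (at x) \<and> (\<forall>c v. D (c *s v) = c * D v)"
    by (intro exI[of _ "\<lambda>v. D v + E v"]) (auto intro!: has_derivative_add D E simp: D E algebra_simps)
qed

lemma hol_mult: 
  assumes "holomorphic_several f V" "holomorphic_several g V"
  shows "holomorphic_several (\<lambda>x. f x * g x) V"
  unfolding holomorphic_several_def
proof
  fix x assume x: "x \<in> V"
  from assms x obtain D E where 
    D: "(f has_derivative D) (at x)" "\<And>c v. D (c *s v) = c * D v" and
    E: "(g has_derivative E) (at x)" "\<And>c v. E (c *s v) = c * E v"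
    unfolding holomorphic_several_def by meson
  show "\<exists>D. ((\<lambda>x. f x * g x) has_derivative D) (at x) \<and> (\<forall>c v. D (c *s v) = c * D v)"
    by (intro exI[of _ "\<lambda>v. f x * E v + D v * g x"]) 
       (simp add: has_derivative_mult[OF D(1) E(1)] D(2) E(2), simp add: algebra_simps)
qed

lemma hol_compose: 
  assumes "holomorphic_several f V" "g holomorphic_on W" "open W" "\<And>x. x \<in> V \<Longrightarrow> f x \<in> W"
  shows "holomorphic_several (\<lambda>x. g (f x)) V"
  unfolding holomorphic_several_def
proof
  fix x assume x: "x \<in> V"
  from assms x obtain D where 
    D: "(f has_derivative D) (at x)" "\<And>c v. D (c *s v) = c * D v" 
    unfolding holomorphic_several_def by meson
  have "(g has_field_derivative deriv g (f x)) (at (f x))"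
    using assms x by (intro holomorphic_derivI[of g W]) auto
  hence "(g has_derivative (\<lambda>z. deriv g (f x) * z)) (at (f x))"
    by (simp add: has_field_derivative_def)
  from has_derivative_compose[OF D(1) this]
  show "\<exists>D. ((\<lambda>x. g (f x)) has_derivative D) (at x) \<and> (\<forall>c v. D (c *s v) = c * D v)"
    by (intro exI[of _ "\<lambda>v. deriv g (f x) * D v"]) (auto simp: D algebra_simps)
qed

lemma hol_shift:
  assumes "holomorphic_several f V"
  shows "holomorphic_several (\<lambda>x. f (x + a)) ((\<lambda>x. x + a) -` V)"
  unfolding holomorphic_several_def
proof
  fix x assume x: "x \<in> (\<lambda>x. x + a) -` V"
  from assms x obtain D where 
    D: "(f has_derivative D) (at (x + a))" "\<And>c v. D (c *s v) = c * D v" 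
    unfolding holomorphic_several_def by auto
  have "((\<lambda>x. x + a) has_derivative (\<lambda>x. x)) (at x)"
    by (auto intro!: derivative_eq_intros)
  from has_derivative_compose[OF this D(1)]
  show "\<exists>D. ((\<lambda>x. f (x + a)) has_derivative D) (at x) \<and> (\<forall>c v. D (c *s v) = c * D v)"
    using D by auto
qed

lemma hol_continuous: "holomorphic_several f V \<Longrightarrow> continuous_on V f"
  unfolding holomorphic_several_def
  by (meson continuous_at_imp_continuous_on has_derivative_continuous)

lemma hol_nonzero_open:
  assumes "holomorphic_several f V" "open U" "U \<subseteq> V"
  shows "open {z\<in>U. f z \<noteq> 0}"
proof -
  have "continuous_on U f" using assms hol_continuous continuous_on_subset by blast
  then have "open (U \<inter> f -` (- {0}))"
    by (intro continuous_open_preimage assms) auto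
  then show ?thesis by (simp add: vimage_def Int_def)
qed

text \<open>Identity theorem on convex open sets, by restriction to complex lines.\<close>

lemma hol_identity:
  fixes g :: "complex ^ 'n \<Rightarrow> complex"
  assumes g: "holomorphic_several g V" and V: "open V" "convex V"
    and U: "open U" "U \<noteq> {}" "U \<subseteq> V" and 0: "\<And>z. z \<in> U \<Longrightarrow> g z = 0" and x: "x \<in> V"
  shows "g x = 0"
proof -
  obtain u where u: "u \<in> U" using U by auto
  define l where "l = (\<lambda>t::complex. u + t *s (x - u))"
  have bl: "bounded_linear (\<lambda>t::complex. t *s (x - u))"
    by (intro linear_conv_bounded_linear[THEN iffD1] linearI) (auto simp: vec_eq_iff algebra_simps)
  have dl: "(l has_derivative (\<lambda>t. t *s (x - u))) (at t)" for t
    unfolding l_def 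
    using has_derivative_add[OF has_derivative_const[of u] bounded_linear_imp_has_derivative[OF bl]] by simp
  have contl: "continuous_on S l" for S
    using dl by (meson continuous_at_imp_continuous_on has_derivative_continuous)
  have open1: "open (l -` V)" "open (l -` U)"
    using contl V U by (auto intro!: open_vimage)
  have conv: "convex (l -` V)"
  proof (rule convexI)
    fix s t and a b :: real assume st: "s \<in> l -` V" "t \<in> l -` V" "0 \<le> a" "0 \<le> b" "a + b = 1"
    have eq: "l (a *\<^sub>R s + b *\<^sub>R t) = a *\<^sub>R l s + b *\<^sub>R l t"
    proof -
      have u: "u = a *\<^sub>R u + b *\<^sub>R u" using st by (metis scaleR_add_left scaleR_one)
      have "l (a *\<^sub>R s + b *\<^sub>R t) = u + (a *\<^sub>R (s *s (x - u)) + b *\<^sub>R (t *s (x - u)))"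
        unfolding l_def linear_simps(1)[OF bl] linear_simps(5)[OF bl] ..
      also have "\<dots> = (a *\<^sub>R u + b *\<^sub>R u) + (a *\<^sub>R (s *s (x - u)) + b *\<^sub>R (t *s (x - u)))"
        using u by simp
      also have "\<dots> = a *\<^sub>R l s + b *\<^sub>R l t"
        unfolding l_def scaleR_add_right by (simp only: add.assoc add.left_commute)
      finally show ?thesis .
    qed
    have "a *\<^sub>R l s + b *\<^sub>R l t \<in> V" using convexD[OF V(2)] st by auto
    then show "a *\<^sub>R s + b *\<^sub>R t \<in> l -` V" using eq by simp
  qed
  have hol: "(\<lambda>t. g (l t)) holomorphic_on (l -` V)"
  proof (rule holomorphic_onI)
    fix t assume "t \<in> l -` V"
    then obtain D where D: "(g has_derivative D) (at (l t))" "\<And>c v. D (c *s v) = c * D v" 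
      using g unfolding holomorphic_several_def by auto
    from has_derivative_compose[OF dl D(1)]
    have "((\<lambda>t. g (l t)) has_derivative (\<lambda>s. D (x - u) * s)) (at t)"
      by (simp only: D(2) mult.commute)
    then have "((\<lambda>t. g (l t)) has_field_derivative D (x - u)) (at t)"
      by (simp add: has_field_derivative_def)
    then show "(\<lambda>t. g (l t)) field_differentiable at t within l -` V"
      using field_differentiable_at_within field_differentiable_def by blast
  qed
  have l0: "l 0 = u" and l1: "l 1 = x" by (auto simp: l_def vec_eq_iff)
  have "g (l 1) = 0"
    by (rule analytic_continuation_open[of "l -` U" "l -` V" "\<lambda>t. g (l t)" "\<lambda>_. 0" 1])
       (use open1 conv hol U 0 x u l0 l1 in \<open>auto intro: convex_connected\<close>)
  then show ?thesis by (simp add: l1)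
qed

definition nvd :: "(complex ^ 'n \<Rightarrow> complex) \<Rightarrow> (complex ^ 'n) set \<Rightarrow> bool" where
  "nvd h V \<longleftrightarrow> (\<forall>U. open U \<and> U \<noteq> {} \<and> U \<subseteq> V \<longrightarrow> (\<exists>z\<in>U. h z \<noteq> 0))"

lemma nvd_mult:
  assumes "nvd g V" "nvd h V" "holomorphic_several g V"
  shows "nvd (\<lambda>z. g z * h z) V"
  unfolding nvd_def
proof (intro allI impI)
  fix U assume U: "open U \<and> U \<noteq> {} \<and> U \<subseteq> V"
  have "open {z\<in>U. g z \<noteq> 0}" using hol_nonzero_open assms U by blast
  moreover have "{z\<in>U. g z \<noteq> 0} \<noteq> {}" using assms U unfolding nvd_def by blast
  moreover have "{z\<in>U. g z \<noteq> 0} \<subseteq> V" using U by auto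
  ultimately obtain z where "z \<in> {z\<in>U. g z \<noteq> 0}" "h z \<noteq> 0" using assms unfolding nvd_def by metis
  then show "\<exists>z\<in>U. g z * h z \<noteq> 0" by auto
qed

lemma mero_iff: "meromorphic_several f \<longleftrightarrow>
     (\<forall>p. \<exists>V g h. open V \<and> p \<in> V \<and> holomorphic_several g V \<and> holomorphic_several h V \<and>
        nvd h V \<and> (\<forall>z\<in>V. h z \<noteq> 0 \<longrightarrow> f z = g z / h z))"
  unfolding meromorphic_several_def nvd_def ..

lemma meroI_quot:
  assumes "holomorphic_several g UNIV" "holomorphic_several h UNIV" "nvd h UNIV" 
    "\<And>z. h z \<noteq> 0 \<Longrightarrow> f z = g z / h z"
  shows "meromorphic_several f"
  unfolding mero_iff using assms by blast

lemma mero_const: "meromorphic_several (\<lambda>x. c)"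
  by (rule meroI_quot[of "\<lambda>x. c" "\<lambda>x. 1"]) (auto simp: hol_const nvd_def)

lemma mero_combine:
  assumes "meromorphic_several f1" "meromorphic_several f2"
  obtains V g1 h1 g2 h2 where "open V" "p \<in> V" "holomorphic_several g1 V" "holomorphic_several h1 V"
     "holomorphic_several g2 V" "holomorphic_several h2 V" "nvd h1 V" "nvd h2 V"
     "\<And>z. z \<in> V \<Longrightarrow> h1 z \<noteq> 0 \<Longrightarrow> f1 z = g1 z / h1 z" "\<And>z. z \<in> V \<Longrightarrow> h2 z \<noteq> 0 \<Longrightarrow> f2 z = g2 z / h2 z"
proof -
  obtain V1 g1 h1 where 1: "open V1" "p \<in> V1" "holomorphic_several g1 V1" "holomorphic_several h1 V1"
    "nvd h1 V1" "\<forall>z\<in>V1. h1 z \<noteq> 0 \<longrightarrow> f1 z = g1 z / h1 z"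
    using assms(1) unfolding mero_iff by metis
  obtain V2 g2 h2 where 2: "open V2" "p \<in> V2" "holomorphic_several g2 V2" "holomorphic_several h2 V2"
    "nvd h2 V2" "\<forall>z\<in>V2. h2 z \<noteq> 0 \<longrightarrow> f2 z = g2 z / h2 z"
    using assms(2) unfolding mero_iff by metis
  show thesis
    by (rule that[of "V1 \<inter> V2" g1 h1 g2 h2]) (use 1 2 in \<open>auto intro: hol_subset simp: nvd_def\<close>)
qed

lemma mero_add:
  assumes "meromorphic_several f1" "meromorphic_several f2"
  shows "meromorphic_several (\<lambda>x. f1 x + f2 x)"
  unfolding mero_iff
proof
  fix p
  obtain V g1 h1 g2 h2 where *: "open V" "p \<in> V" "holomorphic_several g1 V" "holomorphic_several h1 V"
     "holomorphic_several g2 V" "holomorphic_several h2 V" "nvd h1 V" "nvd h2 V"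
     "\<And>z. z \<in> V \<Longrightarrow> h1 z \<noteq> 0 \<Longrightarrow> f1 z = g1 z / h1 z" "\<And>z. z \<in> V \<Longrightarrow> h2 z \<noteq> 0 \<Longrightarrow> f2 z = g2 z / h2 z"
    using mero_combine[OF assms] by blast
  show "\<exists>V g h. open V \<and> p \<in> V \<and> holomorphic_several g V \<and> holomorphic_several h V \<and>
        nvd h V \<and> (\<forall>z\<in>V. h z \<noteq> 0 \<longrightarrow> f1 z + f2 z = g z / h z)"
    by (intro exI[of _ V] exI[of _ "\<lambda>z. g1 z * h2 z + g2 z * h1 z"] exI[of _ "\<lambda>z. h1 z * h2 z"] conjI)
       (use * in \<open>auto intro!: hol_add hol_mult nvd_mult simp: field_simps\<close>)
qed

lemma mero_mult:
  assumes "meromorphic_several f1" "meromorphic_several f2"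
  shows "meromorphic_several (\<lambda>x. f1 x * f2 x)"
  unfolding mero_iff
proof
  fix p
  obtain V g1 h1 g2 h2 where *: "open V" "p \<in> V" "holomorphic_several g1 V" "holomorphic_several h1 V"
     "holomorphic_several g2 V" "holomorphic_several h2 V" "nvd h1 V" "nvd h2 V"
     "\<And>z. z \<in> V \<Longrightarrow> h1 z \<noteq> 0 \<Longrightarrow> f1 z = g1 z / h1 z" "\<And>z. z \<in> V \<Longrightarrow> h2 z \<noteq> 0 \<Longrightarrow> f2 z = g2 z / h2 z"
    using mero_combine[OF assms] by blast
  show "\<exists>V g h. open V \<and> p \<in> V \<and> holomorphic_several g V \<and> holomorphic_several h V \<and>
        nvd h V \<and> (\<forall>z\<in>V. h z \<noteq> 0 \<longrightarrow> f1 z * f2 z = g z / h z)"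
    by (intro exI[of _ V] exI[of _ "\<lambda>z. g1 z * g2 z"] exI[of _ "\<lambda>z. h1 z * h2 z"] conjI)
       (use * in \<open>auto intro!: hol_add hol_mult nvd_mult simp: field_simps\<close>)
qed

lemma mero_uminus: "meromorphic_several f \<Longrightarrow> meromorphic_several (\<lambda>x. - f x)"
  using mero_mult[OF mero_const[of "-1"], of f] by simp

lemma mero_shift:
  fixes f :: "complex ^ 'n \<Rightarrow> complex"
  assumes "meromorphic_several f"
  shows "meromorphic_several (\<lambda>x. f (x + a))"
  unfolding mero_iff
proof
  fix p
  obtain V g h where 1: "open V" "p + a \<in> V" "holomorphic_several g V" "holomorphic_several h V"
    "nvd h V" "\<forall>z\<in>V. h z \<noteq> 0 \<longrightarrow> f z = g z / h z"
    using assms(1) unfolding mero_iff by metis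
  have nv: "nvd (\<lambda>x. h (x + a)) ((\<lambda>x. x + a) -` V)"
    unfolding nvd_def
  proof (intro allI impI)
    fix U assume U: "open U \<and> U \<noteq> {} \<and> U \<subseteq> (\<lambda>x. x + a) -` V"
    have "open ((\<lambda>x. a + x) ` U)" using U open_translation by blast
    moreover have "(\<lambda>x. a + x) ` U \<noteq> {}" "(\<lambda>x. a + x) ` U \<subseteq> V" using U by (auto simp: add.commute)
    ultimately obtain z where "z \<in> (\<lambda>x. a + x) ` U" "h z \<noteq> 0" using 1 unfolding nvd_def by metis
    then show "\<exists>z\<in>U. h (z + a) \<noteq> 0" by (auto simp: add.commute)
  qed
  show "\<exists>V g h. open V \<and> p \<in> V \<and> holomorphic_several g V \<and> holomorphic_several h V \<and>
        nvd h V \<and> (\<forall>z\<in>V. h z \<noteq> 0 \<longrightarrow> f (z + a) = g z / h z)"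
    by (intro exI[of _ "(\<lambda>x. x + a) -` V"] exI[of _ "\<lambda>z. g (z + a)"] exI[of _ "\<lambda>z. h (z + a)"] conjI hol_shift nv)
       (use 1 in \<open>auto intro!: open_vimage continuous_intros\<close>)
qed

lemma dense_open_Int:
  fixes U :: "'a::topological_space set"
  assumes "open U" "closure U = UNIV" "open V" "closure V = UNIV"
  shows "closure (U \<inter> V) = UNIV"
  using open_Int_closure_subset[OF assms(1), of V] assms closure_mono[of U "closure (U \<inter> V)"] by auto

lemma dense_open_meets:
  fixes U :: "'a::topological_space set"
  assumes "closure U = UNIV" "open V" "V \<noteq> {}"
  shows "V \<inter> U \<noteq> {}"
  using assms open_Int_closure_eq_empty by fastforce

lemma mero_zero_dichotomy:
  fixes f :: "complex ^ 'n \<Rightarrow> complex"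
  assumes f: "meromorphic_several f"
  shows "mero_eq f (\<lambda>x. 0) \<or> (\<forall>U. open U \<longrightarrow> U \<noteq> {} \<longrightarrow> (\<exists>z\<in>U. f z \<noteq> 0))"
proof -
  define Z where "Z = {p. \<exists>N U. open N \<and> p \<in> N \<and> open U \<and> U \<subseteq> N \<and> N \<subseteq> closure U \<and> (\<forall>z\<in>U. f z = 0)}"
  have oZ: "open Z"
  proof (subst open_subopen, intro ballI)
    fix p assume "p \<in> Z"
    then obtain N U where N: "open N" "p \<in> N" "open U" "U \<subseteq> N" "N \<subseteq> closure U" "\<forall>z\<in>U. f z = 0"
      unfolding Z_def by blast
    then have "N \<subseteq> Z" unfolding Z_def by blast
    then show "\<exists>T. open T \<and> p \<in> T \<and> T \<subseteq> Z" using N by blast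
  qed
  have key: "p \<in> Z" if U: "open U" "U \<noteq> {}" "\<And>z. z \<in> U \<Longrightarrow> f z = 0"
      and V: "open V" "convex V" "p \<in> V" "U \<subseteq> V" "holomorphic_several g V" "holomorphic_several h V"
    "nvd h V" "\<forall>z\<in>V. h z \<noteq> 0 \<longrightarrow> f z = g z / h z" for p V U g h
  proof -
    define U' where "U' = {z\<in>U. h z \<noteq> 0}"
    have U': "open U'" "U' \<noteq> {}" "U' \<subseteq> V"
      using V U hol_nonzero_open[of h V U] by (auto simp: U'_def nvd_def)
    have "g z = 0" if "z \<in> U'" for z
      using that V U by (auto simp: U'_def)
    then have g0: "g z = 0" if "z \<in> V" for z
      using hol_identity[OF V(5,1,2) U'] that by blast
    define W where "W = {z\<in>V. h z \<noteq> 0}"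
    have "open W" using hol_nonzero_open[of h V V] V by (auto simp: W_def)
    moreover have "V \<subseteq> closure W"
    proof
      fix x assume "x \<in> V"
      show "x \<in> closure W"
      proof (rule ccontr)
        assume "x \<notin> closure W"
        then have "open (V - closure W)" "V - closure W \<noteq> {}" using V \<open>x \<in> V\<close> by auto
        then obtain z where "z \<in> V - closure W" "h z \<noteq> 0" using V(7) unfolding nvd_def by (metis Diff_subset)
        then show False using closure_subset[of W] unfolding W_def by blast
      qed
    qed
    moreover have "\<forall>z\<in>W. f z = 0" using V g0 by (auto simp: W_def)
    moreover have "W \<subseteq> V" by (auto simp: W_def)
    ultimately show ?thesis unfolding Z_def using V(1,3) by blast
  qed
  have rep: "\<exists>V g h. open V \<and> convex V \<and> p \<in> V \<and> holomorphic_several g V \<and> holomorphic_several h V \<and>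
    nvd h V \<and> (\<forall>z\<in>V. h z \<noteq> 0 \<longrightarrow> f z = g z / h z)" for p
  proof -
    obtain V g h where 1: "open V" "p \<in> V" "holomorphic_several g V" "holomorphic_several h V"
      "nvd h V" "\<forall>z\<in>V. h z \<noteq> 0 \<longrightarrow> f z = g z / h z"
      using f unfolding mero_iff by metis
    obtain e where "e > 0" "ball p e \<subseteq> V" using 1 open_contains_ball by blast
    then show ?thesis using 1
      by (rule_tac exI[of _ "ball p e"], rule_tac exI[of _ g], rule_tac exI[of _ h])
         (auto intro: hol_subset simp: nvd_def)
  qed
  have cZ: "closed Z"
    unfolding closure_subset_eq[symmetric]
  proof
    fix p assume p: "p \<in> closure Z"
    obtain V g h where V: "open V" "convex V" "p \<in> V" "holomorphic_several g V" "holomorphic_several h V"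
    "nvd h V" "\<forall>z\<in>V. h z \<noteq> 0 \<longrightarrow> f z = g z / h z" using rep[of p] by blast
    then obtain y where y: "y \<in> Z" "y \<in> V" using p by (meson closure_iff_nhds_not_empty disjoint_iff order_refl)
    then obtain N U where NU: "open N" "y \<in> N" "open U" "U \<subseteq> N" "N \<subseteq> closure U" "\<forall>z\<in>U. f z = 0"
      unfolding Z_def by blast
    then have "y \<in> closure U" by auto
    then have "U \<inter> V \<noteq> {}" using y V by (metis IntI empty_iff inf.commute open_Int_closure_eq_empty)
    then show "p \<in> Z"
      using key[of "U \<inter> V" V p g h] NU V by auto
  qed
  have "Z = {} \<or> Z = UNIV" using oZ cZ clopen by blast
  then show ?thesis
  proof
    assume Z: "Z = {}"
    have "\<exists>z\<in>U. f z \<noteq> 0" if U: "open U" "U \<noteq> {}" for U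
    proof (rule ccontr)
      assume "\<not> ?thesis"
      then have "\<forall>z\<in>U. f z = 0" by blast
      moreover have "U \<subseteq> closure U" by (rule closure_subset)
      ultimately have "U \<subseteq> Z" unfolding Z_def using U(1) by blast
      then show False using Z U by auto
    qed
    then show ?thesis by blast
  next
    assume Z: "Z = UNIV"
    define W where "W = \<Union>{U. open U \<and> (\<forall>z\<in>U. f z = 0)}"
    have "open W" "\<forall>z\<in>W. f z = 0" unfolding W_def by auto
    moreover have "closure W = UNIV"
    proof -
      have "p \<in> closure W" for p
      proof -
        have "p \<in> Z" using Z by simp
        then obtain N U where NU: "open N" "p \<in> N" "open U" "U \<subseteq> N" "N \<subseteq> closure U" "\<forall>z\<in>U. f z = 0"
          unfolding Z_def by blast
        then have "U \<subseteq> W" unfolding W_def by auto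
        then show ?thesis using NU closure_mono by blast
      qed
      then show ?thesis by auto
    qed
    ultimately show ?thesis using f mero_const unfolding mero_eq_def by blast
  qed
qed

lemma mero_inverse:
  fixes f :: "complex ^ 'n \<Rightarrow> complex"
  assumes f: "meromorphic_several f"
  shows "meromorphic_several (\<lambda>x. inverse (f x))"
  using mero_zero_dichotomy[OF f]
proof
  assume "mero_eq f (\<lambda>x. 0)"
  then obtain U where U: "open U" "closure U = UNIV" "\<And>x. x \<in> U \<Longrightarrow> f x = 0" unfolding mero_eq_def by blast
  show ?thesis unfolding mero_iff
  proof
    fix p
    obtain V g h where 1: "open V" "p \<in> V" "holomorphic_several g V" "holomorphic_several h V"
      "nvd h V" "\<forall>z\<in>V. h z \<noteq> 0 \<longrightarrow> f z = g z / h z"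
      using f unfolding mero_iff by metis
    have g0: "g z = 0" if "z \<in> V" "h z \<noteq> 0" for z
    proof (rule ccontr)
      assume "g z \<noteq> 0"
      define B where "B = {z \<in> {z \<in> V. g z \<noteq> 0}. h z \<noteq> 0}"
      have "open B" unfolding B_def using 1 hol_nonzero_open[of g V V]
        by (intro hol_nonzero_open[of h V]) auto
      moreover have "z \<in> B" using that \<open>g z \<noteq> 0\<close> by (auto simp: B_def)
      ultimately have "B \<inter> U \<noteq> {}" using dense_open_meets[OF U(2)] by blast
      then show False using U 1 by (auto simp: B_def)
    qed
    show "\<exists>V g h. open V \<and> p \<in> V \<and> holomorphic_several g V \<and> holomorphic_several h V \<and>
        nvd h V \<and> (\<forall>z\<in>V. h z \<noteq> 0 \<longrightarrow> inverse (f z) = g z / h z)"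
      by (rule exI[of _ V], rule exI[of _ g], rule exI[of _ h]) (use 1 g0 in auto)
  qed
next
  assume nz: "\<forall>U. open U \<longrightarrow> U \<noteq> {} \<longrightarrow> (\<exists>z\<in>U. f z \<noteq> 0)"
  show ?thesis unfolding mero_iff
  proof
    fix p
    obtain V g h where 1: "open V" "p \<in> V" "holomorphic_several g V" "holomorphic_several h V"
      "nvd h V" "\<forall>z\<in>V. h z \<noteq> 0 \<longrightarrow> f z = g z / h z"
      using f unfolding mero_iff by metis
    have "nvd g V" unfolding nvd_def
    proof (intro allI impI)
      fix U assume U: "open U \<and> U \<noteq> {} \<and> U \<subseteq> V"
      have "open {z\<in>U. h z \<noteq> 0}" using hol_nonzero_open 1 U by blast
      moreover have "{z\<in>U. h z \<noteq> 0} \<noteq> {}" using 1 U unfolding nvd_def by blast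
      ultimately obtain z where "z \<in> {z\<in>U. h z \<noteq> 0}" "f z \<noteq> 0" using nz by metis
      then show "\<exists>z\<in>U. g z \<noteq> 0" using 1 U by auto
    qed
    then show "\<exists>V g h. open V \<and> p \<in> V \<and> holomorphic_several g V \<and> holomorphic_several h V \<and>
        nvd h V \<and> (\<forall>z\<in>V. h z \<noteq> 0 \<longrightarrow> inverse (f z) = g z / h z)"
      by (intro exI[of _ V] exI[of _ "\<lambda>z. h z * h z"] exI[of _ "\<lambda>z. g z * h z"] conjI hol_mult nvd_mult)
         (use 1 in auto)
  qed
qed

lemma mero_eq_refl: "meromorphic_several f \<Longrightarrow> mero_eq f f"
  unfolding mero_eq_def using open_UNIV by fastforce

quotient_type (overloaded) 'n mero = "complex ^ ('n::finite) \<Rightarrow> complex" / partial: mero_eq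
proof (rule part_equivpI)
  show "\<exists>x::complex ^ 'n \<Rightarrow> complex. mero_eq x x"
    by (rule exI[of _ "\<lambda>_. 0"]) (rule mero_eq_refl[OF mero_const])
  show "symp (mero_eq :: (complex ^ 'n \<Rightarrow> complex) \<Rightarrow> _)"
    unfolding symp_def mero_eq_def by metis
  show "transp (mero_eq :: (complex ^ 'n \<Rightarrow> complex) \<Rightarrow> _)"
    unfolding transp_def
  proof (intro allI impI)
    fix f g h :: "complex ^ 'n \<Rightarrow> complex"
    assume fg: "mero_eq f g" and gh: "mero_eq g h"
    obtain U where U: "open U" "closure U = UNIV" "\<forall>x\<in>U. f x = g x" using fg unfolding mero_eq_def by blast
    obtain V where V: "open V" "closure V = UNIV" "\<forall>x\<in>V. g x = h x" using gh unfolding mero_eq_def by blast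
    have "open (U \<inter> V) \<and> closure (U \<inter> V) = UNIV \<and> (\<forall>x\<in>U \<inter> V. f x = h x)"
      using U V dense_open_Int[OF U(1,2) V(1,2)] by auto
    then show "mero_eq f h" using fg gh unfolding mero_eq_def by blast
  qed
qed

lemma mero_eq_op2:
  assumes "mero_eq f1 g1" "mero_eq f2 g2" "meromorphic_several (\<lambda>x. F (f1 x) (f2 x))" "meromorphic_several (\<lambda>x. F (g1 x) (g2 x))"
  shows "mero_eq (\<lambda>x. F (f1 x) (f2 x)) (\<lambda>x. F (g1 x) (g2 x))"
proof -
  obtain U where U: "open U" "closure U = UNIV" "\<forall>x\<in>U. f1 x = g1 x" using assms unfolding mero_eq_def by blast
  obtain V where V: "open V" "closure V = UNIV" "\<forall>x\<in>V. f2 x = g2 x" using assms unfolding mero_eq_def by blast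
  have "open (U \<inter> V) \<and> closure (U \<inter> V) = UNIV \<and> (\<forall>x\<in>U \<inter> V. F (f1 x) (f2 x) = F (g1 x) (g2 x))"
    using U V dense_open_Int[OF U(1,2) V(1,2)] by auto
  then show ?thesis using assms unfolding mero_eq_def by blast
qed

instantiation mero :: (finite) field
begin

lift_definition zero_mero :: "'a mero" is "\<lambda>_. 0" by (intro mero_eq_refl mero_const)
lift_definition one_mero :: "'a mero" is "\<lambda>_. 1" by (intro mero_eq_refl mero_const)
lift_definition plus_mero :: "'a mero \<Rightarrow> 'a mero \<Rightarrow> 'a mero" is "\<lambda>f g x. f x + g x"
  by (rule mero_eq_op2[where F = "(+)"]) (auto simp: mero_eq_def intro: mero_add)
lift_definition times_mero :: "'a mero \<Rightarrow> 'a mero \<Rightarrow> 'a mero" is "\<lambda>f g x. f x * g x"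
  by (rule mero_eq_op2[where F = "(*)"]) (auto simp: mero_eq_def intro: mero_mult)
lift_definition uminus_mero :: "'a mero \<Rightarrow> 'a mero" is "\<lambda>f x. - f x"
  by (rule mero_eq_op2[where F = "\<lambda>a b. - a"]) (auto simp: mero_eq_def intro: mero_uminus)
lift_definition inverse_mero :: "'a mero \<Rightarrow> 'a mero" is "\<lambda>f x. inverse (f x)"
  by (rule mero_eq_op2[where F = "\<lambda>a b. inverse a"]) (auto simp: mero_eq_def intro: mero_inverse)
definition minus_mero :: "'a mero \<Rightarrow> 'a mero \<Rightarrow> 'a mero" where "minus_mero f g = f + - g"
definition divide_mero :: "'a mero \<Rightarrow> 'a mero \<Rightarrow> 'a mero" where "divide_mero f g = f * inverse g"

lemma mero_rel_eqI: "meromorphic_several f \<Longrightarrow> f = g \<Longrightarrow> mero_eq f g"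
  using mero_eq_refl by blast

instance
proof
  fix a b c :: "'a mero"
  show "a + b + c = a + (b + c)" by transfer (rule mero_rel_eqI, auto simp: mero_eq_def intro!: mero_add)
  show "a + b = b + a" by transfer (rule mero_rel_eqI, auto simp: mero_eq_def intro!: mero_add)
  show "0 + a = a" by transfer (rule mero_rel_eqI, auto simp: mero_eq_def)
  show "- a + a = 0" by transfer (rule mero_rel_eqI, auto intro: mero_const)
  show "a - b = a + - b" by (rule minus_mero_def)
  show "a * b * c = a * (b * c)" by transfer (rule mero_rel_eqI, auto simp: mero_eq_def intro!: mero_mult)
  show "a * b = b * a" by transfer (rule mero_rel_eqI, auto simp: mero_eq_def intro!: mero_mult)
  show "1 * a = a" by transfer (rule mero_rel_eqI, auto simp: mero_eq_def)
  show "(a + b) * c = a * c + b * c" 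
    by transfer (rule mero_rel_eqI, auto simp: mero_eq_def algebra_simps intro!: mero_add mero_mult)
  show "(0::'a mero) \<noteq> 1" by transfer (auto simp: mero_eq_def)
  show "a div b = a * inverse b" by (rule divide_mero_def)
  show "inverse (0::'a mero) = 0" by transfer (rule mero_rel_eqI, auto intro: mero_const)
  show "a \<noteq> 0 \<Longrightarrow> inverse a * a = 1"
  proof transfer
    fix f :: "complex ^ 'a \<Rightarrow> complex" assume f: "mero_eq f f" and "\<not> mero_eq f (\<lambda>_. 0)"
    then have nz: "\<forall>U. open U \<longrightarrow> U \<noteq> {} \<longrightarrow> (\<exists>z\<in>U. f z \<noteq> 0)"
      using mero_zero_dichotomy unfolding mero_eq_def by blast
    have m: "meromorphic_several f" using f by (simp add: mero_eq_def)
    define W where "W = \<Union>{U. open U \<and> (\<forall>z\<in>U. f z \<noteq> 0)}"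
    have "open W" "\<forall>z\<in>W. f z \<noteq> 0" unfolding W_def by auto
    moreover have "closure W = UNIV"
    proof -
      have "\<exists>y\<in>W. y \<in> N" if N: "open N" "p \<in> N" for N p
      proof -
        obtain V g h where 1: "open V" "p \<in> V" "holomorphic_several g V" "holomorphic_several h V"
          "nvd h V" "\<forall>z\<in>V. h z \<noteq> 0 \<longrightarrow> f z = g z / h z"
          using m unfolding mero_iff by metis
        have o: "open {z\<in>V \<inter> N. h z \<noteq> 0}" using 1 N hol_nonzero_open[of h V "V \<inter> N"] by auto
        moreover have "{z\<in>V \<inter> N. h z \<noteq> 0} \<noteq> {}" using 1 N unfolding nvd_def by blast
        ultimately obtain z where z: "z \<in> {z\<in>V \<inter> N. h z \<noteq> 0}" "f z \<noteq> 0" using nz by metis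
        define B where "B = {z \<in> {z\<in>V \<inter> N. h z \<noteq> 0}. g z \<noteq> 0}"
        have "open B" unfolding B_def using 1 o hol_nonzero_open[of g V "{z\<in>V \<inter> N. h z \<noteq> 0}"] by auto
        moreover have "\<forall>z\<in>B. f z \<noteq> 0" using 1 by (auto simp: B_def)
        ultimately have "B \<subseteq> W" unfolding W_def by auto
        moreover have "z \<in> B" "z \<in> N" using z 1 by (auto simp: B_def)
        ultimately show ?thesis by blast
      qed
      then have "p \<in> closure W" for p unfolding closure_iff_nhds_not_empty by blast
      then show ?thesis by auto
    qed
    ultimately show "mero_eq (\<lambda>x. inverse (f x) * f x) (\<lambda>_. 1)"
      unfolding mero_eq_def using m mero_const mero_mult[OF mero_inverse[OF m] m]
      by (auto intro!: exI[of _ W])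
  qed
qed

end



lemma nvd_exp:
  fixes a b :: "'n::finite"
  assumes "c \<noteq> 0" "a \<noteq> b"
  shows "nvd (\<lambda>l::complex^'n. exp (c * (l $ a - l $ b)) - 1) UNIV"
  unfolding nvd_def
proof (intro allI impI)
  fix U :: "(complex^'n) set" assume U: "open U \<and> U \<noteq> {} \<and> U \<subseteq> UNIV"
  then obtain u where u: "u \<in> U" by blast
  define l where "l = (\<lambda>s::real. u + s *\<^sub>R axis a (1 / c))"
  have "continuous_on UNIV l" unfolding l_def by (intro continuous_intros)
  then have "open (l -` U)" using U by (auto intro: open_vimage)
  moreover have "0 \<in> l -` U" using u by (simp add: l_def)
  ultimately obtain e where e: "e > 0" "ball 0 e \<subseteq> l -` U" using open_contains_ball by blast
  define s where "s = e / 2"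
  have s: "s \<noteq> 0" "l s \<in> U" using e subsetD[OF e(2), of s] by (auto simp: s_def)
  show "\<exists>z\<in>U. exp (c * (z $ a - z $ b)) - 1 \<noteq> 0"
  proof (cases "exp (c * (u $ a - u $ b)) = 1")
    case False
    then show ?thesis using u by auto
  next
    case True
    have "c * (l s $ a - l s $ b) = c * (u $ a - u $ b) + of_real s"
      using assms by (simp add: l_def axis_def field_simps scaleR_conv_of_real[where 'a=complex])
    then have "exp (c * (l s $ a - l s $ b)) = exp (of_real s)" using True by (simp add: exp_add)
    moreover have "exp (of_real s :: complex) \<noteq> 1"
      using s by (metis exp_of_real exp_zero of_real_1 of_real_eq_iff exp_inj_iff)
    ultimately show ?thesis using s by (intro bexI[of _ "l s"]) auto
  qed
qed

lemma hol_exp_diff: "holomorphic_several (\<lambda>l::complex^'n. exp (c * (l $ a - l $ b)) - d) V"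
proof -
  have "holomorphic_several (\<lambda>l::complex^'n. l $ a + (-1) * l $ b) V"
    by (intro hol_add hol_mult hol_const hol_component)
  from hol_compose[OF this, of "\<lambda>z. exp (c * z) - d" UNIV]
  show ?thesis by (simp add: holomorphic_intros)
qed

text \<open>The translation \<open>(T\<^sub>\<alpha> f)(\<lambda>) = f(\<lambda> + \<alpha>)\<close>.\<close>

lift_definition shift :: "complex ^ 'n \<Rightarrow> 'n::finite mero \<Rightarrow> 'n mero" is
  "\<lambda>\<alpha> f x. f (x + \<alpha>)"
proof -
  fix \<alpha> :: "complex ^ 'n" and f g :: "complex ^ 'n \<Rightarrow> complex" assume fg: "mero_eq f g"
  then obtain U where U: "open U" "closure U = UNIV" "\<forall>x\<in>U. f x = g x" unfolding mero_eq_def by blast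
  have translation_UNIV: "(\<lambda>x. - \<alpha> + x) ` UNIV = UNIV"
    by (rule surjI[of _ "(+) \<alpha>"]) simp
  have "(\<lambda>x. x + \<alpha>) -` U = (\<lambda>x. -\<alpha> + x) ` U" by (force simp: image_iff)
  then have "open ((\<lambda>x. x + \<alpha>) -` U) \<and> closure ((\<lambda>x. x + \<alpha>) -` U) = UNIV"
    using open_translation[OF U(1), of "- \<alpha>"] closure_translation[of "- \<alpha>" U] U(2)
    by (simp only: translation_UNIV simp_thms)
  then show "mero_eq (\<lambda>x. f (x + \<alpha>)) (\<lambda>x. g (x + \<alpha>))"
    using fg U unfolding mero_eq_def by (auto intro: mero_shift intro!: exI[of _ "(\<lambda>x. x + \<alpha>) -` U"])
qed

lift_definition const_mero :: "complex \<Rightarrow> 'n::finite mero" is "\<lambda>c _. c"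
  by (intro mero_eq_refl mero_const)

text \<open>
  The parameter \<open>lq\<close> is the chosen logarithm of \<open>q\<close>. The functions below are literal pointwise
  formulas; values at poles are those of division by zero and do not matter.
\<close>

definition qpow :: "complex \<Rightarrow> complex \<Rightarrow> complex" where
  "qpow lq z = exp (z * lq)"

definition h0_fun :: "complex \<Rightarrow> complex \<Rightarrow> complex" where
  "h0_fun lq z = (qpow lq (-1) - qpow lq 1) / (qpow lq (-2 * z) - 1)"

definition g_fun :: "complex \<Rightarrow> complex \<Rightarrow> complex" where
  "g_fun lq z = (qpow lq (-2 * z) - qpow lq (-2)) * (qpow lq (-2 * z) - qpow lq 2)
     / (qpow lq (-2 * z) - 1)\<^sup>2"

definition h_fun :: "complex \<Rightarrow> complex \<Rightarrow> complex" where
  "h_fun lq z = qpow lq 1 - h0_fun lq z"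

text \<open>The meromorphic function \<open>\<phi>(\<lambda>\<^sub>a - \<lambda>\<^sub>b)\<close>; see \<open>mero_struct_funs\<close> for the cases used.\<close>

definition of_diff :: "(complex \<Rightarrow> complex) \<Rightarrow> 'n \<Rightarrow> 'n \<Rightarrow> 'n::finite mero" where
  "of_diff \<phi> a b = abs_mero (\<lambda>l. \<phi> (l $ a - l $ b))"

lemma mero_struct_funs:
  fixes a b :: "'n::finite"
  shows "meromorphic_several (\<lambda>l::complex^'n. h0_fun lq (l $ a - l $ b))" (is ?H)
    and "meromorphic_several (\<lambda>l::complex^'n. g_fun lq (l $ a - l $ b))" (is ?g)
    and "meromorphic_several (\<lambda>l::complex^'n. h_fun lq (l $ a - l $ b))" (is ?K)
proof -
  let ?E = "\<lambda>d (l::complex^'n). exp (- 2 * lq * (l $ a - l $ b)) - d"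
  have E: "qpow lq (- 2 * (l $ a - l $ b)) - d = ?E d l" for d l
    by (simp add: qpow_def algebra_simps)
  have "?H \<and> ?g"
  proof (cases "lq = 0 \<or> a = b")
    case True
    then have "(\<lambda>l::complex^'n. h0_fun lq (l $ a - l $ b)) = (\<lambda>_. h0_fun lq 0)"
      "(\<lambda>l::complex^'n. g_fun lq (l $ a - l $ b)) = (\<lambda>_. g_fun lq 0)"
      by (auto simp: h0_fun_def g_fun_def qpow_def)
    then show "?H \<and> ?g" by (simp only: mero_const simp_thms)
  next
    case False
    then have nv: "nvd (?E 1) UNIV" using nvd_exp[of "-2 * lq" a b] by simp
    have h: "holomorphic_several (?E d) UNIV" for d by (rule hol_exp_diff)
    have "?H"
      by (rule meroI_quot[OF hol_const[of "qpow lq (-1) - qpow lq 1"] h nv]) (simp only: h0_fun_def E)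
    moreover have "?g"
      by (rule meroI_quot[OF hol_mult[OF h[of "qpow lq (-2)"] h[of "qpow lq 2"]] hol_mult[OF h h] nvd_mult[OF nv nv h]])
         (simp only: g_fun_def E power2_eq_square)
    ultimately show "?H \<and> ?g" ..
  qed
  then show ?H ?g by auto
  then show ?K unfolding h_fun_def using mero_add[OF mero_const mero_uminus] by fastforce
qed

text \<open>\<open>R_entry lq a b c d\<close> has upper indices \<open>a b\<close> and lower indices \<open>c d\<close>.\<close>

definition R_entry :: "complex \<Rightarrow> 'n \<Rightarrow> 'n \<Rightarrow> 'n \<Rightarrow> 'n \<Rightarrow> 'n::{finite,linorder} mero" where
  "R_entry lq a b c d =
     (if a = b \<and> c = a \<and> d = a then const_mero (qpow lq 1)
      else if a \<noteq> b \<and> c = a \<and> d = b then (if a < b then 1 else of_diff (g_fun lq) a b)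
      else if a \<noteq> b \<and> c = b \<and> d = a then of_diff (h0_fun lq) a b
      else 0)"

definition free_monoid :: "'g list monoid" where
  "free_monoid = \<lparr>carrier = UNIV, mult = (@), one = []\<rparr>"

text \<open>The complex vector space with basis \<open>carrier M\<close> and the bilinear extension of the product of \<open>M\<close>.\<close>

definition monoid_algebra :: "('m, 'b) monoid_scheme \<Rightarrow> ('m \<Rightarrow>\<^sub>0 complex) ring" where
  "monoid_algebra M =
     \<lparr>carrier = {x. Poly_Mapping.keys x \<subseteq> carrier M},
      monoid.mult = (\<lambda>x y. \<Sum>p\<in>Poly_Mapping.keys x. \<Sum>r\<in>Poly_Mapping.keys y.
                Poly_Mapping.single (p \<otimes>\<^bsub>M\<^esub> r) (Poly_Mapping.lookup x p * Poly_Mapping.lookup y r)),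
      monoid.one = Poly_Mapping.single \<one>\<^bsub>M\<^esub> 1,
      ring.zero = 0,
      ring.add = (+)\<rparr>"

lemma poly_mapping_carrier_induct:
  assumes "Poly_Mapping.keys x \<subseteq> C" "P 0" "\<And>k v. k \<in> C \<Longrightarrow> P (Poly_Mapping.single k v)"
    "\<And>a b. P a \<Longrightarrow> P b \<Longrightarrow> P (a + b)"
  shows "P (x :: 'm \<Rightarrow>\<^sub>0 complex)"
proof -
  have "P (\<Sum>k\<in>K. Poly_Mapping.single k (Poly_Mapping.lookup x k))" if "finite K" "K \<subseteq> C" for K
    using that by (induction K rule: finite_induct) (auto intro: assms)
  moreover have "(\<Sum>k\<in>Poly_Mapping.keys x. Poly_Mapping.single k (Poly_Mapping.lookup x k)) = x"
    by (rule poly_mapping_eqI) (auto simp: lookup_sum lookup_single when_def in_keys_iff)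
  ultimately show ?thesis using assms(1) by (metis finite_keys)
qed

lemma free_monoid_monoid: "Group.monoid free_monoid"
  by unfold_locales (auto simp: free_monoid_def)

lemma monoid_algebra_ring:
  assumes "Group.monoid M"
  shows "Ring.ring (monoid_algebra M)"
proof -
  interpret M: Group.monoid M by fact
  let ?s = "Poly_Mapping.single"
  define m where "m = mult (monoid_algebra M)"
  have m: "m x y = (\<Sum>p\<in>Poly_Mapping.keys x. \<Sum>r\<in>Poly_Mapping.keys y. ?s (p \<otimes>\<^bsub>M\<^esub> r) (Poly_Mapping.lookup x p * Poly_Mapping.lookup y r))" for x y
    by (simp add: m_def monoid_algebra_def)
  have m_single: "m (?s a u) (?s b v) = ?s (a \<otimes>\<^bsub>M\<^esub> b) (u * v)" for a b u v
    by (simp add: m)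
  have m0: "m 0 y = 0" "m x 0 = 0" for x y by (auto simp: m)
  have dl: "m (x + y) z = m x z + m y z" for x y z
    unfolding m
    by (rule setsum_keys_plus_distrib[where f = "\<lambda>p v. \<Sum>r\<in>Poly_Mapping.keys z. ?s (p \<otimes>\<^bsub>M\<^esub> r) (v * Poly_Mapping.lookup z r)"])
       (auto simp: distrib_right single_add sum.distrib)
  have dr: "m z (x + y) = m z x + m z y" for x y z
    unfolding m sum.distrib[symmetric]
    by (rule sum.cong[OF refl],
        rule setsum_keys_plus_distrib[where f = "\<lambda>p v. ?s (r \<otimes>\<^bsub>M\<^esub> p) (Poly_Mapping.lookup z r * v)" for r])
       (auto simp: distrib_left single_add)
  have keys_m: "Poly_Mapping.keys (m x y) \<subseteq> carrier M" if "Poly_Mapping.keys x \<subseteq> carrier M" "Poly_Mapping.keys y \<subseteq> carrier M" for x y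
    unfolding m
    by (rule order_trans[OF keys_sum] UN_least)+ (use that in \<open>auto split: if_splits\<close>)
  have assoc: "m (m x y) z = m x (m y z)"
    if x: "Poly_Mapping.keys x \<subseteq> carrier M" and y: "Poly_Mapping.keys y \<subseteq> carrier M" and z: "Poly_Mapping.keys z \<subseteq> carrier M" for x y z
  proof (rule poly_mapping_carrier_induct[OF x])
    fix a u assume a: "a \<in> carrier M"
    show "m (m (?s a u) y) z = m (?s a u) (m y z)"
    proof (rule poly_mapping_carrier_induct[OF y])
      fix b v assume b: "b \<in> carrier M"
      show "m (m (?s a u) (?s b v)) z = m (?s a u) (m (?s b v) z)"
        by (rule poly_mapping_carrier_induct[OF z]) (auto simp: m0 dl dr m_single M.m_assoc a b mult.assoc)
    qed (auto simp: m0 dl dr)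
  qed (auto simp: m0 dl dr)
  have one: "m (?s \<one>\<^bsub>M\<^esub> 1) x = x \<and> m x (?s \<one>\<^bsub>M\<^esub> 1) = x" if x: "Poly_Mapping.keys x \<subseteq> carrier M" for x
    by (rule poly_mapping_carrier_induct[OF x]) (auto simp: m0 dl dr m_single)
  have "abelian_group (monoid_algebra M)"
  proof (rule abelian_groupI)
    fix x y assume "x \<in> carrier (monoid_algebra M)" "y \<in> carrier (monoid_algebra M)"
    then show "x \<oplus>\<^bsub>monoid_algebra M\<^esub> y \<in> carrier (monoid_algebra M)"
      using Poly_Mapping.keys_add[of x y] by (auto simp: monoid_algebra_def)
  next
    fix x assume "x \<in> carrier (monoid_algebra M)"
    then show "\<exists>y\<in>carrier (monoid_algebra M). y \<oplus>\<^bsub>monoid_algebra M\<^esub> x = \<zero>\<^bsub>monoid_algebra M\<^esub>"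
      by (intro bexI[of _ "- x"]) (auto simp: monoid_algebra_def in_keys_iff subset_iff)
  qed (auto simp: monoid_algebra_def algebra_simps)
  moreover have "Group.monoid (monoid_algebra M)"
    by (rule Group.monoidI) 
       (use assoc one keys_m in \<open>auto simp: m_def[symmetric], auto simp: monoid_algebra_def\<close>)
  moreover have "ring_axioms (monoid_algebra M)"
    by unfold_locales (auto simp: m_def[symmetric], auto simp: monoid_algebra_def dl dr)
  ultimately show ?thesis unfolding Ring.ring_def by blast
qed

datatype (plugins only: ) ('n::finite) gen = Lam "'n mero" | Mu "'n mero" | Tgen 'n 'n

type_synonym 'n free_alg = "'n gen list \<Rightarrow>\<^sub>0 complex"
type_synonym 'n fr = "'n free_alg set"

definition word :: "'n::finite gen list \<Rightarrow> 'n free_alg" where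
  "word w = Poly_Mapping.single w 1"

definition omega :: "'n \<Rightarrow> complex ^ 'n" where
  "omega i = axis i 1"

text \<open>
  The first six families make \<open>Lam\<close> and \<open>Mu\<close> unital complex algebra homomorphisms on the field of
  meromorphic functions; then come commutation of the two copies, the dynamical shifts and the RLL-relations.
\<close>

definition FR_rels :: "complex \<Rightarrow> ('n::{finite,linorder}) free_alg set" where
  "FR_rels lq =
     {word [Lam (f + g)] - word [Lam f] - word [Lam g] | f g. True}
   \<union> {word [Lam (f * g)] - word [Lam f, Lam g] | f g. True}
   \<union> {word [Lam (const_mero c)] - Poly_Mapping.single [] c | c. True}
   \<union> {word [Mu (f + g)] - word [Mu f] - word [Mu g] | f g. True}
   \<union> {word [Mu (f * g)] - word [Mu f, Mu g] | f g. True}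
   \<union> {word [Mu (const_mero c)] - Poly_Mapping.single [] c | c. True}
   \<union> {word [Lam f, Mu g] - word [Mu g, Lam f] | f g. True}
   \<union> {word [Lam f, Tgen i j] - word [Tgen i j, Lam (shift (omega i) f)] | f i j. True}
   \<union> {word [Mu f, Tgen i j] - word [Tgen i j, Mu (shift (omega j) f)] | f i j. True}
   \<union> {(\<Sum>x\<in>UNIV. \<Sum>y\<in>UNIV. word [Lam (R_entry lq x y a c), Tgen x b, Tgen y d])
       - (\<Sum>x\<in>UNIV. \<Sum>y\<in>UNIV. word [Mu (R_entry lq b d x y), Tgen c y, Tgen a x]) | a b c d. True}"

abbreviation free_ring :: "('n::finite) free_alg ring" where
  "free_ring \<equiv> monoid_algebra free_monoid"

definition FR_ideal :: "complex \<Rightarrow> ('n::{finite,linorder}) free_alg set" where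
  "FR_ideal lq = Idl\<^bsub>free_ring\<^esub> (FR_rels lq)"

definition FR :: "complex \<Rightarrow> ('n::{finite,linorder}) fr ring" where
  "FR lq = free_ring Quot (FR_ideal lq)"

definition FR_proj :: "complex \<Rightarrow> 'n free_alg \<Rightarrow> ('n::{finite,linorder}) fr" where
  "FR_proj lq x = FR_ideal lq +>\<^bsub>free_ring\<^esub> x"

definition mu_l :: "complex \<Rightarrow> 'n mero \<Rightarrow> ('n::{finite,linorder}) fr" where
  "mu_l lq f = FR_proj lq (word [Lam f])"

definition mu_r :: "complex \<Rightarrow> 'n mero \<Rightarrow> ('n::{finite,linorder}) fr" where
  "mu_r lq f = FR_proj lq (word [Mu f])"

definition t_gen :: "complex \<Rightarrow> 'n \<Rightarrow> 'n \<Rightarrow> ('n::{finite,linorder}) fr" where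
  "t_gen lq i j = FR_proj lq (word [Tgen i j])"

definition FR_scalar :: "complex \<Rightarrow> complex \<Rightarrow> ('n::{finite,linorder}) fr" where
  "FR_scalar lq c = FR_proj lq (Poly_Mapping.single [] c)"

fun gen_deg :: "('n::finite) gen \<Rightarrow> (complex ^ 'n) \<times> (complex ^ 'n)" where
  "gen_deg (Lam f) = (0, 0)"
| "gen_deg (Mu f) = (0, 0)"
| "gen_deg (Tgen i j) = (omega i, omega j)"

definition word_deg :: "('n::finite) gen list \<Rightarrow> (complex ^ 'n) \<times> (complex ^ 'n)" where
  "word_deg w = (\<Sum>x\<leftarrow>w. gen_deg x)"

definition FR_comp :: 
  "complex \<Rightarrow> (complex, 'n::{finite,linorder}) vec \<Rightarrow> (complex, 'n) vec \<Rightarrow> 'n fr set" where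
  "FR_comp lq \<alpha> \<beta> = FR_proj lq ` {x. \<forall>w\<in>Poly_Mapping.keys x. word_deg w = (\<alpha>, \<beta>)}"

text \<open>
  The dynamical tensor product of the algebra with itself. \<open>monoid_algebra (tens_pairs lq)\<close> is the free vector space on pairs
  \<open>(a, b)\<close> of homogeneous elements whose inner degrees match, with \<open>(a, b)(c, d) = (ac, bd)\<close>.
  The quotient by bilinearity within each component and by \<open>\<mu>\<^sub>r(f)a \<otimes> b = a \<otimes> \<mu>\<^sub>l(f)b\<close> is
  the sum over \<open>\<alpha>, \<gamma>, \<beta>\<close> of the tensor products of the \<open>(\<alpha>, \<gamma>)\<close> and \<open>(\<gamma>, \<beta>)\<close> components,
  with the balancing relation imposed. Homogeneous elements commute with functions up to a shift
  by their degree, so the linear span of these relations is already an ideal.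
\<close>

definition tens_pairs :: "complex \<Rightarrow> (('n::{finite,linorder}) fr \<times> 'n fr) monoid" where
  "tens_pairs lq =
     (FR lq \<times>\<times> FR lq)\<lparr>carrier := {(a, b). \<exists>\<alpha> \<gamma> \<beta>. a \<in> FR_comp lq \<alpha> \<gamma> \<and> b \<in> FR_comp lq \<gamma> \<beta>}\<rparr>"

abbreviation pair_elem :: "complex \<Rightarrow> ('n::finite) fr \<Rightarrow> 'n fr \<Rightarrow> ('n fr \<times> 'n fr) \<Rightarrow>\<^sub>0 complex" where
  "pair_elem c a b \<equiv> Poly_Mapping.single (a, b) c"

definition tens_rels :: "complex \<Rightarrow> ((('n::{finite,linorder}) fr \<times> 'n fr) \<Rightarrow>\<^sub>0 complex) set" where
  "tens_rels lq =
     {pair_elem 1 (a \<oplus>\<^bsub>FR lq\<^esub> a') b - pair_elem 1 a b - pair_elem 1 a' b | a a' b \<alpha> \<beta> \<gamma>.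
        a \<in> FR_comp lq \<alpha> \<gamma> \<and> a' \<in> FR_comp lq \<alpha> \<gamma> \<and> b \<in> FR_comp lq \<gamma> \<beta>}
   \<union> {pair_elem 1 a (b \<oplus>\<^bsub>FR lq\<^esub> b') - pair_elem 1 a b - pair_elem 1 a b' | a b b' \<alpha> \<beta> \<gamma>.
        a \<in> FR_comp lq \<alpha> \<gamma> \<and> b \<in> FR_comp lq \<gamma> \<beta> \<and> b' \<in> FR_comp lq \<gamma> \<beta>}
   \<union> {pair_elem 1 (FR_scalar lq c \<otimes>\<^bsub>FR lq\<^esub> a) b - pair_elem c a b | c a b \<alpha> \<beta> \<gamma>.
        a \<in> FR_comp lq \<alpha> \<gamma> \<and> b \<in> FR_comp lq \<gamma> \<beta>}
   \<union> {pair_elem 1 a (FR_scalar lq c \<otimes>\<^bsub>FR lq\<^esub> b) - pair_elem c a b | c a b \<alpha> \<beta> \<gamma>.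
        a \<in> FR_comp lq \<alpha> \<gamma> \<and> b \<in> FR_comp lq \<gamma> \<beta>}
   \<union> {pair_elem 1 (mu_r lq f \<otimes>\<^bsub>FR lq\<^esub> a) b - pair_elem 1 a (mu_l lq f \<otimes>\<^bsub>FR lq\<^esub> b) | f a b \<alpha> \<beta> \<gamma>.
        a \<in> FR_comp lq \<alpha> \<gamma> \<and> b \<in> FR_comp lq \<gamma> \<beta>}"

definition tens_ideal where
  "tens_ideal lq = Idl\<^bsub>monoid_algebra (tens_pairs lq)\<^esub> (tens_rels lq)"

definition FR_tensor ::
  "complex \<Rightarrow> ((('n::{finite,linorder}) fr \<times> 'n fr) \<Rightarrow>\<^sub>0 complex) set ring" where
  "FR_tensor lq = monoid_algebra (tens_pairs lq) Quot (tens_ideal lq)"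

text \<open>The pure tensor \<open>a \<otimes> b\<close>, meaningful for homogeneous \<open>a\<close>, \<open>b\<close> of matching inner degree.\<close>

definition tens ::
  "complex \<Rightarrow> 'n fr \<Rightarrow> 'n fr \<Rightarrow> ((('n::{finite,linorder}) fr \<times> 'n fr) \<Rightarrow>\<^sub>0 complex) set" where
  "tens lq a b = tens_ideal lq +>\<^bsub>monoid_algebra (tens_pairs lq)\<^esub> pair_elem 1 a b"

lemma FR_rels_carrier: "FR_rels lq \<subseteq> carrier free_ring"
  by (simp add: monoid_algebra_def free_monoid_def)

lemma FR_ideal_ideal: "ideal (FR_ideal lq) free_ring"
  unfolding FR_ideal_def
  by (rule ring.genideal_ideal[OF monoid_algebra_ring[OF free_monoid_monoid] FR_rels_carrier])

lemma FR_ring: "Ring.ring (FR lq)"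
  unfolding FR_def by (rule ideal.quotient_is_ring[OF FR_ideal_ideal])

lemma FR_proj_hom: "FR_proj lq \<in> ring_hom free_ring (FR lq)"
  unfolding FR_def using ideal.rcos_ring_hom[OF FR_ideal_ideal, of lq] by (simp add: FR_proj_def[abs_def])

lemma free_carrier [simp]: "carrier free_ring = UNIV" 
  by (simp add: monoid_algebra_def free_monoid_def)

lemma FR_comp_carrier: "FR_comp lq \<alpha> \<beta> \<subseteq> carrier (FR lq)"
  using ring_hom_closed[OF FR_proj_hom] by (auto simp: FR_comp_def)

lemma FR_comp_one: "\<one>\<^bsub>FR lq\<^esub> \<in> FR_comp lq 0 0"
proof -
  have "\<one>\<^bsub>FR lq\<^esub> = FR_proj lq \<one>\<^bsub>free_ring\<^esub>" using ring_hom_one[OF FR_proj_hom] by metis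
  then show ?thesis unfolding FR_comp_def
    by (auto simp: monoid_algebra_def free_monoid_def word_deg_def zero_prod_def intro!: imageI)
qed

lemma FR_comp_mult:
  assumes "a \<in> FR_comp lq \<alpha> \<beta>" "b \<in> FR_comp lq \<alpha>' \<beta>'"
  shows "a \<otimes>\<^bsub>FR lq\<^esub> b \<in> FR_comp lq (\<alpha> + \<alpha>') (\<beta> + \<beta>')"
proof -
  obtain x y where x: "a = FR_proj lq x" "\<forall>w\<in>Poly_Mapping.keys x. word_deg w = (\<alpha>, \<beta>)"
    and y: "b = FR_proj lq y" "\<forall>w\<in>Poly_Mapping.keys y. word_deg w = (\<alpha>', \<beta>')"
    using assms unfolding FR_comp_def by blast
  have "a \<otimes>\<^bsub>FR lq\<^esub> b = FR_proj lq (x \<otimes>\<^bsub>free_ring\<^esub> y)"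
    using ring_hom_mult[OF FR_proj_hom, of x y] x y by simp
  moreover have "Poly_Mapping.keys (x \<otimes>\<^bsub>free_ring\<^esub> y) \<subseteq> {w @ v | w v. w \<in> Poly_Mapping.keys x \<and> v \<in> Poly_Mapping.keys y}"
    unfolding monoid_algebra_def free_monoid_def
    by simp ((rule order_trans[OF keys_sum] UN_least)+, auto split: if_splits)
  then have "\<forall>w\<in>Poly_Mapping.keys (x \<otimes>\<^bsub>free_ring\<^esub> y). word_deg w = (\<alpha> + \<alpha>', \<beta> + \<beta>')"
    using x y by (fastforce simp: word_deg_def)
  ultimately show ?thesis unfolding FR_comp_def by blast
qed

lemma FR_comp_add:
  assumes "a \<in> FR_comp lq \<alpha> \<beta>" "b \<in> FR_comp lq \<alpha> \<beta>"
  shows "a \<oplus>\<^bsub>FR lq\<^esub> b \<in> FR_comp lq \<alpha> \<beta>"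
proof -
  obtain x y where x: "a = FR_proj lq x" "\<forall>w\<in>Poly_Mapping.keys x. word_deg w = (\<alpha>, \<beta>)"
    and y: "b = FR_proj lq y" "\<forall>w\<in>Poly_Mapping.keys y. word_deg w = (\<alpha>, \<beta>)"
    using assms unfolding FR_comp_def by blast
  have "a \<oplus>\<^bsub>FR lq\<^esub> b = FR_proj lq (x + y)"
    using ring_hom_add[OF FR_proj_hom, of x y lq] x y by (simp del: free_carrier) (simp add: monoid_algebra_def free_monoid_def)
  moreover have "\<forall>w\<in>Poly_Mapping.keys (x + y). word_deg w = (\<alpha>, \<beta>)"
    using x y Poly_Mapping.keys_add[of x y] by blast
  ultimately show ?thesis unfolding FR_comp_def by blast
qed

lemma FR_comp_degree_zero:
  "mu_l lq f \<in> FR_comp lq 0 0" "mu_r lq f \<in> FR_comp lq 0 0" "FR_scalar lq c \<in> FR_comp lq 0 0"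
  unfolding FR_comp_def mu_l_def mu_r_def FR_scalar_def
  by (auto intro!: imageI simp: word_def word_deg_def zero_prod_def split: if_splits)

lemma tens_pairs_monoid: "Group.monoid (tens_pairs (lq :: complex) :: ('n::{finite,linorder} fr \<times> 'n fr) monoid)"
proof -
  interpret F: Ring.ring "FR lq :: 'n fr ring" by (rule FR_ring)
  have sub: "a \<in> carrier (FR lq)" if "a \<in> FR_comp lq \<alpha> \<beta>" for a :: "'n fr" and \<alpha> \<beta>
    using FR_comp_carrier that by blast
  show ?thesis
  proof (rule Group.monoidI)
    fix x y :: "'n fr \<times> 'n fr"
    assume "x \<in> carrier (tens_pairs lq)" "y \<in> carrier (tens_pairs lq)"
    then obtain a b c d \<alpha> \<beta> \<gamma> \<alpha>' \<beta>' \<gamma>' where "x = (a, b)" "y = (c, d)"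
      "a \<in> FR_comp lq \<alpha> \<gamma>" "b \<in> FR_comp lq \<gamma> \<beta>" "c \<in> FR_comp lq \<alpha>' \<gamma>'" "d \<in> FR_comp lq \<gamma>' \<beta>'"
      unfolding tens_pairs_def by auto
    then show "x \<otimes>\<^bsub>tens_pairs lq\<^esub> y \<in> carrier (tens_pairs lq)"
      using FR_comp_mult by (simp add: tens_pairs_def DirProd_def) blast
  next
    show "\<one>\<^bsub>tens_pairs lq\<^esub> \<in> carrier (tens_pairs lq :: ('n fr \<times> 'n fr) monoid)"
      using FR_comp_one by (auto simp: tens_pairs_def DirProd_def)
  qed (auto simp: tens_pairs_def DirProd_def F.m_assoc dest!: sub)
qed

lemma tens_rels_carrier: "tens_rels lq \<subseteq> carrier (monoid_algebra (tens_pairs lq))"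
proof -
  let ?C = "carrier (monoid_algebra (tens_pairs lq))"
  have s: "pair_elem c a b \<in> ?C" if "a \<in> FR_comp lq \<alpha> \<gamma>" "b \<in> FR_comp lq \<gamma> \<beta>" for a b c \<alpha> \<beta> \<gamma>
    using that by (auto simp: monoid_algebra_def tens_pairs_def split: if_splits)
  have d: "x - y \<in> ?C" if "x \<in> ?C" "y \<in> ?C" for x y
  proof -
    have "Poly_Mapping.keys (x - y) \<subseteq> Poly_Mapping.keys x \<union> Poly_Mapping.keys y"
      by (auto simp: in_keys_iff lookup_minus)
    then show ?thesis using that by (auto simp: monoid_algebra_def)
  qed
  have z: "u \<otimes>\<^bsub>FR lq\<^esub> a \<in> FR_comp lq \<alpha> \<beta>" if "u \<in> FR_comp lq 0 0" "a \<in> FR_comp lq \<alpha> \<beta>" for u a \<alpha> \<beta>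
    using FR_comp_mult[OF that] by simp
  note z' = z[OF FR_comp_degree_zero(1)] z[OF FR_comp_degree_zero(2)] z[OF FR_comp_degree_zero(3)]
  show ?thesis unfolding tens_rels_def
    by (intro Un_least subsetI; clarify; intro d; (rule s, (intro z' FR_comp_add; assumption), (intro z' FR_comp_add; assumption) | rule s, (intro z' FR_comp_add; assumption), assumption | rule s, assumption, (intro z' FR_comp_add; assumption) | rule s; assumption))
qed

lemma FR_tensor_ring: "Ring.ring (FR_tensor lq)"
  unfolding FR_tensor_def tens_ideal_def
  by (intro ideal.quotient_is_ring ring.genideal_ideal monoid_algebra_ring tens_pairs_monoid tens_rels_carrier)

definition diff_ops :: "('n::finite mero \<Rightarrow> 'n mero) ring" where
  "diff_ops =
     \<lparr>carrier = {D. \<exists>B f. finite B \<and> D = (\<lambda>\<phi>. \<Sum>\<beta>\<in>B. f \<beta> * shift \<beta> \<phi>)},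
      monoid.mult = (\<circ>), monoid.one = id, ring.zero = (\<lambda>_. 0), ring.add = (\<lambda>D E \<phi>. D \<phi> + E \<phi>)\<rparr>"

text \<open>
  Ring homomorphisms with these values on \<open>mu_l\<close> are complex linear, because the scalar \<open>c\<close> is
  \<open>mu_l\<close> of the constant function \<open>c\<close>. Extensionality only fixes the values
  outside the carrier, so that the description picks out a single HOL function.
\<close>

definition comult ::
  "complex \<Rightarrow> ('n::{finite,linorder}) fr \<Rightarrow> (('n fr \<times> 'n fr) \<Rightarrow>\<^sub>0 complex) set" where
  "comult lq = (THE \<Delta>. \<Delta> \<in> ring_hom (FR lq) (FR_tensor lq) \<and> \<Delta> \<in> extensional (carrier (FR lq)) \<and>
     (\<forall>i j. \<Delta> (t_gen lq i j) = (\<Oplus>\<^bsub>FR_tensor lq\<^esub>k\<in>UNIV. tens lq (t_gen lq i k) (t_gen lq k j))) \<and>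
     (\<forall>f. \<Delta> (mu_l lq f) = tens lq (mu_l lq f) \<one>\<^bsub>FR lq\<^esub>) \<and>
     (\<forall>f. \<Delta> (mu_r lq f) = tens lq \<one>\<^bsub>FR lq\<^esub> (mu_r lq f)))"

definition counit :: "complex \<Rightarrow> ('n::{finite,linorder}) fr \<Rightarrow> ('n mero \<Rightarrow> 'n mero)" where
  "counit lq = (THE \<epsilon>. \<epsilon> \<in> ring_hom (FR lq) diff_ops \<and> \<epsilon> \<in> extensional (carrier (FR lq)) \<and>
     (\<forall>i j. \<epsilon> (t_gen lq i j) = (if i = j then shift (- omega i) else (\<lambda>_. 0))) \<and>
     (\<forall>f. \<epsilon> (mu_l lq f) = (\<lambda>\<phi>. f * \<phi>)) \<and>
     (\<forall>f. \<epsilon> (mu_r lq f) = (\<lambda>\<phi>. f * \<phi>)))"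

text \<open>
  \<open>inv_factor lq \<sigma> I\<close> is \<open>S(\<sigma>, I)\<close>. Positions in the increasing enumerations
  of \<open>I\<close> and \<open>J\<close> are counted from \<open>0\<close>, so \<open>\<sigma>\<close> permutes \<open>{..<r}\<close>.
\<close>

definition inv_factor :: "complex \<Rightarrow> (nat \<Rightarrow> nat) \<Rightarrow> 'n set \<Rightarrow> ('n::{finite,linorder}) mero" where
  "inv_factor lq \<sigma> I =
     (\<Prod>(k, l)\<in>{(k, l). k < l \<and> l < card I \<and> \<sigma> l < \<sigma> k}.
        - of_diff (h_fun lq) (sorted_list_of_set I ! \<sigma> k) (sorted_list_of_set I ! \<sigma> l))"

definition qminor :: "complex \<Rightarrow> 'n set \<Rightarrow> 'n set \<Rightarrow> ('n::{finite,linorder}) fr" where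
  "qminor lq I J =
     (if card I = card J then
        (\<Oplus>\<^bsub>FR lq\<^esub>\<sigma>\<in>{\<sigma>. \<sigma> permutes {..<card J}}.
           mu_l lq (inv_factor lq \<sigma> I) \<otimes>\<^bsub>FR lq\<^esub>
           foldr (\<otimes>\<^bsub>FR lq\<^esub>)
             (map (\<lambda>k. t_gen lq (sorted_list_of_set I ! \<sigma> k) (sorted_list_of_set J ! k)) [0..<card J])
             \<one>\<^bsub>FR lq\<^esub>)
      else \<zero>\<^bsub>FR lq\<^esub>)"

definition qdet :: "complex \<Rightarrow> ('n::{finite,linorder}) fr" where
  "qdet lq = qminor lq UNIV UNIV"

end

theory Submission
  imports Defs "HOL-Combinatorics.List_Permutation"
begin

text \<open>
  Iterating the RLL-relations moves \<open>t\<^sub>a\<^sub>b\<close> past a word \<open>t\<^sub>c\<^sub>1\<^sub>d\<^sub>1 \<cdots> t\<^sub>c\<^sub>n\<^sub>d\<^sub>n\<close>, at the price of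
  products of \<open>R\<close>-matrix entries in \<open>\<lambda>\<close> on one side and in \<open>\<mu>\<close> on the other. Sum this over all
  arrangements \<open>c\<close> with the weights \<open>S(c)\<close> of the determinant, and take \<open>d\<close> to start with \<open>b\<close>. On the
  \<open>\<mu>\<close> side the determinant with permuted columns \<open>y\<close> is \<open>S(y)(\<mu>) det\<close>, or \<open>0\<close> if a column is
  repeated, and only one \<open>y\<close> survives. On the \<open>\<lambda>\<close> side the sums over \<open>c\<close> are the matrix entries
  of the determinant in the vector representation; the same column rule, applied there, shows
  that it acts by the scalar \<open>q\<close> times a shift. The remaining scalar factors cancel, so \<open>det\<close> commutes with \<open>t\<^sub>a\<^sub>b\<close>.
  It commutes with functions invariant under the shift by \<open>(1,\<dots>,1)\<close>, hence with all minors.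

  The column rule also gives \<open>\<Delta>(det) = \<Sum>\<^sub>y S(y)(\<mu>) det \<otimes> t\<^sub>y\<^sub>1\<^sub>1 \<cdots> t\<^sub>y\<^sub>n\<^sub>n = det \<otimes> det\<close>, by moving
  \<open>S(y)\<close> across the tensor sign.
\<close>

section \<open>Scalar identities in the field of meromorphic functions\<close>

text \<open>With [z] = q^z - q^(-z) one has h(z) = [z-1]/[z], hence g(z) = h(z) h(-z) and h(z)
  h(1-z) = 1. The last identity drives the final cancellation: by \<open>inv_coef_shift\<close>, the
  diagonal R-entries collected by a strand, translated by one unit vector, are the ratio of an
  ordering coefficient and its translate. The algebra W itself is not built. An element of W
  tensored with a module is a function on subsets, and multiplication by R(w_j) is an operator on
  such functions. The column rule has to serve both the algebra, acting on itself by left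
  multiplication, and the vector representation, which is not a ring; it is therefore proved for
  operators on an abelian group. The algebra, the difference operators and the tensor product are
  rings with carriers. Computations are moved to a type of class \<open>ring\<close> in which their
  units are only idempotents, so \<open>l 1\<close> takes the place of 1 throughout, and identities
  such as \<open>l 1 * x = x\<close> are available only for suitable x.\<close>

lemma shift_zero [simp]: "shift \<alpha> 0 = 0"
  by transfer (rule mero_rel_eqI, auto intro: mero_const)

lemma shift_one [simp]: "shift \<alpha> 1 = 1"
  by transfer (rule mero_rel_eqI, auto intro: mero_const)

lemma shift_const [simp]: "shift \<alpha> (const_mero c) = const_mero c"
  by transfer (rule mero_rel_eqI, auto intro: mero_const)

lemma shift_add: "shift \<alpha> (f + g) = shift \<alpha> f + shift \<alpha> g"
  by transfer (rule mero_rel_eqI, auto simp: mero_eq_def intro!: mero_shift[of "\<lambda>x. _ x + _ x"] mero_add)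

lemma shift_mult: "shift \<alpha> (f * g) = shift \<alpha> f * shift \<alpha> g"
  by transfer (rule mero_rel_eqI, auto simp: mero_eq_def intro!: mero_shift[of "\<lambda>x. _ x * _ x"] mero_mult)

lemma shift_uminus: "shift \<alpha> (- f) = - shift \<alpha> f"
  by (metis add_eq_0_iff shift_add shift_zero add.right_inverse)

lemma shift_diff: "shift \<alpha> (f - g) = shift \<alpha> f - shift \<alpha> g"
  by (metis shift_add shift_uminus uminus_add_conv_diff add.commute)

lemma shift_shift [simp]: "shift \<alpha> (shift \<beta> f) = shift (\<alpha> + \<beta>) f"
  by transfer (rule mero_rel_eqI, auto simp: mero_eq_def add.assoc intro: mero_shift[where a = "_ + _"])

lemma shift_0 [simp]: "shift 0 f = f"
  by transfer (rule mero_rel_eqI, auto simp: mero_eq_def)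

lemma shift_eq_0_iff [simp]: "shift \<alpha> f = 0 \<longleftrightarrow> f = 0"
  by (metis add.right_inverse shift_0 shift_shift shift_zero)

lemma shift_inverse: "shift \<alpha> (inverse f) = inverse (shift \<alpha> f)"
proof (cases "f = 0")
  case False
  then have "shift \<alpha> (inverse f) * shift \<alpha> f = 1" by (simp flip: shift_mult)
  then show ?thesis by (metis inverse_unique mult.commute)
qed simp

lemma shift_divide: "shift \<alpha> (f / g) = shift \<alpha> f / shift \<alpha> g"
  by (simp add: divide_inverse shift_mult shift_inverse)

lemma shift_prod: "shift \<alpha> (prod f A) = (\<Prod>x\<in>A. shift \<alpha> (f x))"
  by (induction A rule: infinite_finite_induct) (auto simp: shift_mult)

lemma shift_sum: "shift \<alpha> (sum f A) = (\<Sum>x\<in>A. shift \<alpha> (f x))"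
  by (induction A rule: infinite_finite_induct) (auto simp: shift_add)

lemma const_mero_0 [simp]: "const_mero 0 = 0" and const_mero_1 [simp]: "const_mero 1 = 1"
  by (transfer, rule mero_rel_eqI, auto intro: mero_const)+

lemma const_mero_add: "const_mero (c + d) = const_mero c + const_mero d"
  by transfer (rule mero_rel_eqI, auto intro: mero_const)

lemma const_mero_mult: "const_mero (c * d) = const_mero c * const_mero d"
  by transfer (rule mero_rel_eqI, auto intro: mero_const)

lemma abs_mero_cong:
  fixes f g :: "complex ^ 'n::finite \<Rightarrow> complex"
  assumes "mero_eq f g" shows "abs_mero f = abs_mero g"
  using assms Quotient_rel_abs[OF Quotient_mero] by blast

text \<open>The function \<open>q\<close> to the power \<open>-2\<lambda>\<^sub>a\<close>; all structure functions are rational in these.\<close>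

lift_definition qvar :: "complex \<Rightarrow> 'n \<Rightarrow> 'n::finite mero" is "\<lambda>lq a (l::complex ^ 'n). exp (- 2 * lq * l $ a)"
proof (rule mero_eq_refl)
  fix lq and a :: 'n
  have "holomorphic_several (\<lambda>l::complex^'n. exp (- 2 * lq * l $ a)) UNIV"
    by (rule hol_compose[OF hol_component, of "\<lambda>z. exp (- 2 * lq * z)" UNIV]) (auto intro!: holomorphic_intros)
  then show "meromorphic_several (\<lambda>l::complex^'n. exp (- 2 * lq * l $ a))"
    by (rule meroI_quot[of _ "\<lambda>x. 1"]) (auto simp: hol_const nvd_def)
qed

lemma qvar_nonzero [simp]: "qvar lq (a::'n::finite) \<noteq> 0"
proof
  assume "qvar lq a = 0"
  then have "mero_eq (\<lambda>l::complex^'n. exp (- 2 * lq * l $ a)) (\<lambda>_. 0)" by transfer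
  then obtain U where U: "closure U = (UNIV::(complex^'n) set)" "\<forall>x\<in>U. exp (- 2 * lq * x $ a) = 0"
    unfolding mero_eq_def by blast
  then have "U = {}" by auto
  then show False using U(1) by auto
qed

text \<open>Lowering \<lambda>_c by 1 multiplies q^(-2\<lambda>_c) by q^2. Translations by
  \<open>- omega c\<close> arise when a coefficient is carried from the right of some t_cj to its
  left.\<close>

lemma shift_qvar:
  "shift (- omega c) (qvar lq (a::'a::finite)) = (if a = c then const_mero (qpow lq 1) ^ 2 * qvar lq a else qvar lq a)"
proof -
  have "shift (- omega c) (qvar lq a) = const_mero (if a = c then qpow lq 1 * qpow lq 1 else 1) * qvar lq a"
  proof (transfer, rule mero_rel_eqI)
    fix c a :: 'a and lq :: complex
    show "(\<lambda>x. exp (- 2 * lq * (x + - omega c) $ a)) = (\<lambda>x. (if a = c then qpow lq 1 * qpow lq 1 else 1) * exp (- 2 * lq * x $ a))"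
      by (auto simp: fun_eq_iff omega_def axis_def qpow_def algebra_simps simp flip: exp_add)
    have "meromorphic_several (\<lambda>x::complex^'a. exp (- 2 * lq * x $ a))"
      using qvar.rsp unfolding rel_fun_def mero_eq_def by blast
    from mero_shift[OF this, of "- omega c"]
    show "meromorphic_several (\<lambda>x. exp (- 2 * lq * (x + - omega c) $ a))" .
  qed
  then show ?thesis by (auto simp: const_mero_mult power2_eq_square)
qed

lemma nvd_dense:
  fixes h :: "complex ^ 'n::finite \<Rightarrow> complex"
  assumes "nvd h UNIV" "holomorphic_several h UNIV"
  shows "open {z. h z \<noteq> 0}" "closure {z. h z \<noteq> 0} = UNIV"
proof -
  show "open {z. h z \<noteq> 0}" using hol_nonzero_open[OF assms(2), of UNIV] by simp
  have "\<exists>y\<in>{z. h z \<noteq> 0}. y \<in> N" if "open N" "p \<in> N" for N p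
    using that assms(1) unfolding nvd_def by blast
  then show "closure {z. h z \<noteq> 0} = UNIV" unfolding set_eq_iff closure_iff_nhds_not_empty by blast
qed

text \<open>The pointwise formulas take arbitrary values at their poles. It suffices to compare them
  off the zero set of one entire function, whose complement is open and dense.\<close>

lemma mero_eqI_nvd:
  fixes h :: "complex ^ 'n::finite \<Rightarrow> complex"
  assumes "nvd h UNIV" "holomorphic_several h UNIV" "meromorphic_several f" "meromorphic_several g"
    "\<And>x. h x \<noteq> 0 \<Longrightarrow> f x = g x"
  shows "mero_eq f g"
  unfolding mero_eq_def using assms nvd_dense[OF assms(1,2)] by blast

abbreviation qc :: "complex \<Rightarrow> 'n::finite mero" where "qc lq \<equiv> const_mero (qpow lq 1)"

lemma qc_nonzero [simp]: "qc lq \<noteq> 0"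
proof
  assume "qc lq = (0 :: 'a mero)"
  then have "qc lq * const_mero (qpow lq (-1)) = (0 :: 'a mero)" by simp
  then show False by (simp add: qpow_def flip: const_mero_mult exp_add)
qed

lemma const_mero_inverse: "const_mero (qpow lq (-1)) = inverse (qc lq)"
  by (rule inverse_unique[symmetric]) (simp add: qpow_def flip: const_mero_mult exp_add)

section \<open>The structure functions as rational functions of \<open>qvar\<close>\<close>

lemma of_diff_h:
  fixes a b :: "'n::finite"
  shows "of_diff (h_fun lq) a b = qc lq - of_diff (h0_fun lq) a b"
  unfolding of_diff_def h_fun_def const_mero_def minus_mero_def map_fun_def o_def id_def
  by (subst uminus_mero.abs_eq plus_mero.abs_eq;
       (intro mero_eq_refl mero_const mero_uminus mero_struct_funs)?)+ simp

context
  fixes lq :: complex and a b :: "'n::finite"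
  assumes nz: "lq \<noteq> 0" and ab: "a \<noteq> b"
begin

text \<open>This is q^(-2z) - 1 at z = \<lambda>_a - \<lambda>_b, whose powers are the denominators
  of h_0, h and g.\<close>

abbreviation "exp_diff_minus_one \<equiv> \<lambda>l::complex^'n. exp ((- 2 * lq) * (l $ a - l $ b)) - 1"

lemma exp_diff_minus_one_nvd: "nvd exp_diff_minus_one UNIV" "holomorphic_several exp_diff_minus_one UNIV"
  by (rule nvd_exp; use nz ab in simp) (rule hol_exp_diff)

lemma exp_diff_minus_one_nonzero: "exp_diff_minus_one x \<noteq> 0 \<Longrightarrow> exp (- 2 * lq * x $ a) \<noteq> exp (- 2 * lq * x $ b)"
proof -
  have "exp ((- 2 * lq) * (x $ a - x $ b)) = exp (- 2 * lq * x $ a) / exp (- 2 * lq * x $ b)"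
    by (simp add: algebra_simps flip: exp_diff)
  then show "exp_diff_minus_one x \<noteq> 0 \<Longrightarrow> exp (- 2 * lq * x $ a) \<noteq> exp (- 2 * lq * x $ b)" by auto
qed

lemma qvar_neq: "qvar lq a \<noteq> qvar lq b"
proof
  assume "qvar lq a = qvar lq b"
  then have "mero_eq (\<lambda>l::complex^'n. exp (- 2 * lq * l $ a)) (\<lambda>l::complex^'n. exp (- 2 * lq * l $ b))" by transfer
  then obtain U where U: "open U" "closure U = (UNIV::(complex^'n) set)"
    "\<forall>x\<in>U. exp (- 2 * lq * x $ a) = exp (- 2 * lq * x $ b)"
    unfolding mero_eq_def by blast
  then have "U \<noteq> {}" by auto
  then obtain z where "z \<in> U" "exp_diff_minus_one z \<noteq> 0" using exp_diff_minus_one_nvd(1) U(1) unfolding nvd_def by blast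
  then show False using U(3) exp_diff_minus_one_nonzero by blast
qed

lemma of_diff_h0:
  "of_diff (h0_fun lq) a b = (inverse (qc lq) - qc lq) * qvar lq b / (qvar lq a - qvar lq b)"
proof -
  have mq: "meromorphic_several (\<lambda>l::complex^'n. exp (- 2 * lq * l $ i))" for i
    using qvar.rsp unfolding rel_fun_def mero_eq_def by blast
  let ?h = "\<lambda>l::complex^'n. h0_fun lq (l $ a - l $ b)"
  let ?f = "\<lambda>l::complex^'n. ?h l * (exp (- 2 * lq * l $ a) + - exp (- 2 * lq * l $ b))"
  let ?g = "\<lambda>l::complex^'n. (qpow lq (-1) + - qpow lq 1) * exp (- 2 * lq * l $ b)"
  \<comment> \<open>The identity is first compared pointwise with the denominator multiplied out;
    the division is then done in the field of meromorphic functions, where \<open>qvar_neq\<close>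
    applies.\<close>
  have "mero_eq ?f ?g"
  proof (rule mero_eqI_nvd[OF exp_diff_minus_one_nvd])
    show "meromorphic_several ?f" by (intro mero_mult mero_struct_funs mero_add mero_uminus mq)
    show "meromorphic_several ?g" by (intro mero_mult mero_const mq)
    fix x :: "complex^'n" assume x: "exp_diff_minus_one x \<noteq> 0"
    have e: "qpow lq (-2 * (x $ a - x $ b)) = exp (- 2 * lq * x $ a) / exp (- 2 * lq * x $ b)"
      by (simp add: qpow_def algebra_simps flip: exp_diff)
    have "exp (- 2 * lq * x $ a) / exp (- 2 * lq * x $ b) \<noteq> 1"
      using exp_diff_minus_one_nonzero[OF x] by (simp only: divide_eq_1_iff) simp
    then show "?f x = ?g x" unfolding h0_fun_def e by (simp add: field_simps)
  qed
  then have "abs_mero ?f = abs_mero ?g" by (rule abs_mero_cong)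
  moreover have "abs_mero ?f = of_diff (h0_fun lq) a b * (qvar lq a - qvar lq b)"
    unfolding of_diff_def qvar_def minus_mero_def map_fun_def o_def id_def
    by (subst uminus_mero.abs_eq plus_mero.abs_eq times_mero.abs_eq;
       (intro mero_eq_refl mero_struct_funs mero_add mero_uminus mq | rule refl)?)+
  moreover have "abs_mero ?g = (inverse (qc lq) - qc lq) * qvar lq b"
    unfolding const_mero_inverse[symmetric] unfolding const_mero_def qvar_def minus_mero_def map_fun_def o_def id_def
    by (subst uminus_mero.abs_eq plus_mero.abs_eq times_mero.abs_eq;
       (intro mero_eq_refl mero_const mero_add mero_uminus mq | rule refl)?)+
  ultimately have "of_diff (h0_fun lq) a b * (qvar lq a - qvar lq b) = (inverse (qc lq) - qc lq) * qvar lq b"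
    by argo
  then show ?thesis using qvar_neq by (simp add: eq_divide_eq)
qed

lemma of_diff_h_explicit:
  "of_diff (h_fun lq) a b = (qc lq ^ 2 * qvar lq a - qvar lq b) / (qc lq * (qvar lq a - qvar lq b))"
  unfolding of_diff_h of_diff_h0 using qvar_neq by (simp add: field_simps power2_eq_square)

text \<open>In terms of [z] = q^z - q^(-z): h(-z) = [z+1]/[z] and g(z) = [z-1][z+1]/[z]^2.\<close>

lemma of_diff_g: "of_diff (g_fun lq) a b = of_diff (h_fun lq) a b * of_diff (h_fun lq) b a"
proof -
  let ?g = "\<lambda>l::complex^'n. g_fun lq (l $ a - l $ b)"
  let ?h = "\<lambda>a b (l::complex^'n). h_fun lq (l $ a - l $ b)"
  have "mero_eq ?g (\<lambda>l. ?h a b l * ?h b a l)"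
  proof (rule mero_eqI_nvd[OF exp_diff_minus_one_nvd])
    show "meromorphic_several ?g" "meromorphic_several (\<lambda>l. ?h a b l * ?h b a l)"
      by (intro mero_mult mero_struct_funs)+
    fix x :: "complex^'n" assume x: "exp_diff_minus_one x \<noteq> 0"
    define s t where "s = qpow lq 1" and "t = qpow lq (-2 * (x $ a - x $ b))"
    have s0: "s \<noteq> 0" "t \<noteq> 0" by (auto simp: s_def t_def qpow_def)
    have "t = exp ((- 2 * lq) * (x $ a - x $ b))" by (simp only: t_def qpow_def mult_ac)
    then have t1: "t \<noteq> 1" using x by simp
    have [simp]: "qpow lq (-1) = 1 / s" "qpow lq 2 = s * s" "qpow lq (-2) = 1 / (s * s)"
      by (auto simp: s_def qpow_def field_simps simp flip: exp_add)
    have t': "qpow lq (-2 * (x $ b - x $ a)) = 1 / t"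
      by (simp add: t_def qpow_def field_simps flip: exp_add)
    show "?g x = ?h a b x * ?h b a x"
      unfolding g_fun_def h_fun_def h0_fun_def t' t_def[symmetric] s_def[symmetric]
      using s0 t1 by (simp add: divide_simps power2_eq_square) (simp add: algebra_simps)
  qed
  then have "abs_mero ?g = abs_mero (\<lambda>l. ?h a b l * ?h b a l)" by (rule abs_mero_cong)
  then show ?thesis unfolding of_diff_def
    by (subst times_mero.abs_eq) (auto intro!: mero_eq_refl mero_struct_funs)
qed

end

abbreviation h_diff :: "complex \<Rightarrow> 'n \<Rightarrow> 'n \<Rightarrow> 'n::finite mero" where "h_diff lq \<equiv> of_diff (h_fun lq)"

lemma shift_of_diff:
  fixes \<alpha> :: "complex ^ 'n::finite"
  assumes "meromorphic_several (\<lambda>l::complex^'n. \<phi> (l $ a - l $ b))" "\<alpha> $ a = \<alpha> $ b"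
  shows "shift \<alpha> (of_diff \<phi> a b) = of_diff \<phi> a b"
  unfolding of_diff_def using shift.abs_eq[OF mero_eq_refl[OF assms(1)], of \<alpha>] assms(2) by simp

lemma shift_h_diff: "(\<alpha> :: complex ^ 'n::finite) $ a = \<alpha> $ b \<Longrightarrow> shift \<alpha> (h_diff lq a b) = h_diff lq a b"
  by (rule shift_of_diff[OF mero_struct_funs(3)])

lemma omega_nth [simp]: "omega (c :: 'n::finite) $ a = (if a = c then 1 else 0)"
  by (auto simp: omega_def axis_def)

text \<open>With x_a = q^(-2\<lambda>_a), the difference q^2 x_a - x_b is the translate of x_a - x_b
  by \<open>- omega a\<close>, and translation is injective.\<close>

lemma qvar_shifted_neq:
  assumes "lq \<noteq> 0" "a \<noteq> b"
  shows "qc lq ^ 2 * qvar lq a \<noteq> (qvar lq b :: 'n::finite mero)"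
proof
  assume "qc lq ^ 2 * qvar lq a = (qvar lq b :: 'n mero)"
  then have "shift (- omega a) (qvar lq a - qvar lq b :: 'n mero) = 0"
    using assms by (simp add: shift_diff shift_qvar)
  then show False using qvar_neq[OF assms] by simp
qed

lemma h_diff_nonzero: "lq \<noteq> 0 \<Longrightarrow> a \<noteq> b \<Longrightarrow> h_diff lq a b \<noteq> 0"
  using qvar_shifted_neq[of lq a b] qvar_neq[of lq a b] by (simp add: of_diff_h_explicit)

text \<open>In \<open>W\<close> one has \<open>w\<^sub>i w\<^sub>J = inv_coef i J \<cdot> w\<^bsub>J \<union> {i}\<^esub>\<close> for \<open>i \<notin> J\<close>, so \<open>word_coef cs\<close> is \<open>S(\<sigma>, I)\<close> for the arrangement \<open>cs\<close> of \<open>I\<close>.\<close>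

definition inv_coef :: "complex \<Rightarrow> 'n \<Rightarrow> 'n set \<Rightarrow> 'n::{finite,linorder} mero" where
  "inv_coef lq i J = (\<Prod>b\<in>{b\<in>J. b < i}. - h_diff lq i b)"

fun word_coef :: "complex \<Rightarrow> 'n list \<Rightarrow> 'n::{finite,linorder} mero" where
  "word_coef lq [] = 1"
| "word_coef lq (a # cs) = inv_coef lq a (set cs) * word_coef lq cs"

text \<open>Only the differences \<lambda>_i - \<lambda>_b enter. In particular the coefficient
  passes t_cj unchanged whenever c is neither i nor in J.\<close>

lemma shift_inv_coef:
  fixes \<alpha> :: "complex ^ 'n::{finite,linorder}"
  assumes "\<And>b. b \<in> J \<Longrightarrow> \<alpha> $ b = \<alpha> $ i"
  shows "shift \<alpha> (inv_coef lq i J) = inv_coef lq i J"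
  unfolding inv_coef_def shift_prod using assms
  by (intro prod.cong) (auto simp: shift_uminus shift_h_diff)

lemma shift_word_coef:
  fixes \<alpha> :: "complex ^ 'n::{finite,linorder}"
  assumes "\<And>a b. a \<in> set cs \<Longrightarrow> b \<in> set cs \<Longrightarrow> \<alpha> $ a = \<alpha> $ b"
  shows "shift \<alpha> (word_coef lq cs) = word_coef lq cs"
  using assms by (induction cs) (auto simp: shift_mult shift_inv_coef)

lemma inv_coef_nonzero: "lq \<noteq> 0 \<Longrightarrow> inv_coef lq i J \<noteq> 0"
  by (auto simp: inv_coef_def h_diff_nonzero)

lemma word_coef_nonzero: "lq \<noteq> 0 \<Longrightarrow> word_coef lq cs \<noteq> 0"
  by (induction cs) (auto simp: inv_coef_nonzero)

lemma inv_coef_insert: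
  assumes "c \<notin> J" shows "inv_coef lq i (insert c J) = (if c < i then - h_diff lq i c * inv_coef lq i J else inv_coef lq i J)"
proof -
  have "{b \<in> insert c J. b < i} = (if c < i then insert c {b\<in>J. b < i} else {b\<in>J. b < i})" by auto
  then show ?thesis using assms by (simp add: inv_coef_def)
qed

lemma word_coef_sorted: "sorted cs \<Longrightarrow> distinct cs \<Longrightarrow> word_coef lq cs = 1"
proof (induction cs)
  case (Cons a cs)
  then have e: "{b \<in> set cs. b < a} = {}" by auto
  show ?case using Cons by (simp add: inv_coef_def e)
qed simp

text \<open>The length is a parameter so that sums can be unfolded letter by letter. If
  \<open>k\<close> is not the cardinality of \<open>I\<close>, the set is empty.\<close>

definition arrangements :: "'n set \<Rightarrow> nat \<Rightarrow> 'n list set" where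
  "arrangements I k = {cs. distinct cs \<and> set cs = I \<and> length cs = k}"

lemma finite_arrangements [simp]: "finite (arrangements (I :: 'n::finite set) k)"
proof (rule finite_subset)
  show "arrangements I k \<subseteq> {cs. set cs \<subseteq> UNIV \<and> length cs = k}" by (auto simp: arrangements_def)
  show "finite {cs :: 'n list. set cs \<subseteq> UNIV \<and> length cs = k}" by (rule finite_lists_length_eq) simp
qed

lemma sum_arrangements_Suc:
  fixes F :: "'n::finite list \<Rightarrow> 'm::ab_group_add"
  shows "(\<Sum>cs\<in>arrangements I (Suc k). F cs) = (\<Sum>i\<in>I. \<Sum>cs\<in>arrangements (I - {i}) k. F (i # cs))"
proof -
  have "(\<Sum>i\<in>I. \<Sum>cs\<in>arrangements (I - {i}) k. F (i # cs)) = (\<Sum>(i, cs)\<in>(SIGMA i:I. arrangements (I - {i}) k). F (i # cs))"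
    by (rule sum.Sigma) (simp, blast intro: finite_arrangements)
  also have "\<dots> = (\<Sum>cs\<in>arrangements I (Suc k). F cs)"
  proof (rule sum.reindex_bij_witness[where i = "\<lambda>cs. (hd cs, tl cs)" and j = "\<lambda>(i, cs). i # cs"])
    fix cs assume "cs \<in> arrangements I (Suc k)"
    then obtain i ds where "cs = i # ds" "distinct (i # ds)" "set (i # ds) = I" "length ds = k"
      unfolding arrangements_def by (cases cs) auto
    then show "(hd cs, tl cs) \<in> (SIGMA i:I. arrangements (I - {i}) k)"
      "(case (hd cs, tl cs) of (i, cs) \<Rightarrow> i # cs) = cs"
      by (auto simp: arrangements_def)
  next
    fix p assume "p \<in> (SIGMA i:I. arrangements (I - {i}) k)"
    then obtain i cs where "p = (i, cs)" "i \<in> I" "distinct cs" "set cs = I - {i}" "length cs = k"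
      unfolding arrangements_def by auto
    then show "(case p of (i, cs) \<Rightarrow> i # cs) \<in> arrangements I (Suc k)"
      "(hd (case p of (i, cs) \<Rightarrow> i # cs), tl (case p of (i, cs) \<Rightarrow> i # cs)) = p"
      "F (case p of (i, cs) \<Rightarrow> i # cs) = (case p of (i, cs) \<Rightarrow> F (i # cs))"
      by (simp_all add: arrangements_def insert_absorb)
  qed
  finally show ?thesis by simp
qed

section \<open>The exterior algebra and permutation of columns\<close>

text \<open>The last two relations express R(w_i)^2 = 0 and R(w_j) R(w_i) = -h(\<mu>_j - \<mu>_i)
  R(w_i) R(w_j) for i < j, read off at the basis element w_a w_c with a < c. \<open>l 1\<close> and
  \<open>r 1\<close> are the identity only on images of the \<open>t i j\<close>, which accommodates
  embeddings that do not preserve the unit.\<close>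

locale dyn_module =
  fixes lq :: complex
    and l r :: "'n::{finite,linorder} mero \<Rightarrow> 'm::ab_group_add \<Rightarrow> 'm"
    and t :: "'n \<Rightarrow> 'n \<Rightarrow> 'm \<Rightarrow> 'm"
  assumes lq_nonzero: "lq \<noteq> 0"
    and l_add: "l f (x + y) = l f x + l f y"
    and r_add: "r f (x + y) = r f x + r f y"
    and t_add: "t i j (x + y) = t i j x + t i j y"
    and add_l: "l (f + g) x = l f x + l g x"
    and add_r: "r (f + g) x = r f x + r g x"
    and l_mult: "l (f * g) x = l f (l g x)"
    and r_mult: "r (f * g) x = r f (r g x)"
    and l_r: "l f (r g x) = r g (l f x)"
    and l_one: "l 1 (t i j x) = t i j x"
    and r_one: "r 1 (t i j x) = t i j x"
    and l_t: "l f (t i j x) = t i j (l (shift (omega i) f) x)"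
    and r_t: "r f (t i j x) = t i j (r (shift (omega j) f) x)"
    and t_same: "a < c \<Longrightarrow> t a i (t c i x) = l (h_diff lq c a) (t c i (t a i x))"
    and t_cross: "a < c \<Longrightarrow> i < j \<Longrightarrow>
       t a j (t c i x) - l (h_diff lq c a) (t c j (t a i x)) =
       - r (h_diff lq j i) (t a i (t c j x) - l (h_diff lq c a) (t c i (t a j x)))"
begin

lemma l_additive: "Modules.additive (l f)" and r_additive: "Modules.additive (r f)" and t_additive: "Modules.additive (t i j)"
  by (auto simp: Modules.additive_def l_add r_add t_add)

lemmas l_simps = Modules.additive.zero[OF l_additive] Modules.additive.minus[OF l_additive] Modules.additive.diff[OF l_additive] Modules.additive.sum[OF l_additive]
lemmas r_simps = Modules.additive.zero[OF r_additive] Modules.additive.minus[OF r_additive] Modules.additive.diff[OF r_additive] Modules.additive.sum[OF r_additive]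
lemmas t_simps = Modules.additive.zero[OF t_additive] Modules.additive.minus[OF t_additive] Modules.additive.diff[OF t_additive] Modules.additive.sum[OF t_additive]

lemma uminus_l: "l (- f) x = - l f x"
proof -
  have "l 0 x = 0" using add_l[of 0 0 x] by simp
  then show ?thesis using add_l[of f "- f" x] by (simp add: eq_neg_iff_add_eq_0 add.commute)
qed

lemma uminus_r: "r (- f) x = - r f x"
proof -
  have "r 0 x = 0" using add_r[of 0 0 x] by simp
  then show ?thesis using add_r[of f "- f" x] by (simp add: eq_neg_iff_add_eq_0 add.commute)
qed

lemma t_l: "t i j (l f x) = l (shift (- omega i) f) (t i j x)"
  by (simp add: l_t)

lemma t_r: "t i j (r f x) = r (shift (- omega j) f) (t i j x)"
  by (simp add: r_t)

text \<open>
  A function \<open>\<Phi>\<close> on subsets stands for \<open>\<Sum>\<^sub>I w\<^sub>I \<otimes> \<Phi>(I)\<close>, and \<open>L j\<close> is left multiplication by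
  \<open>R(w\<^sub>j) = \<Sum>\<^sub>i w\<^sub>i \<otimes> t\<^sub>i\<^sub>j\<close>.
\<close>

definition L :: "'n \<Rightarrow> ('n set \<Rightarrow> 'm) \<Rightarrow> 'n set \<Rightarrow> 'm" where
  "L j \<Phi> I = (\<Sum>i\<in>I. l (inv_coef lq i (I - {i})) (t i j (\<Phi> (I - {i}))))"

text \<open>A pair a < c is removed from I in two orders. The order in which w_c stands to the left
  of w_a costs the factor -h(\<lambda>_c - \<lambda>_a), which produces the second term; the
  remaining coefficients are common to both.\<close>

lemma L_L:
  "L j (L i \<Phi>) I = (\<Sum>(a, c)\<in>{(a, c). a \<in> I \<and> c \<in> I \<and> a < c}.
     l (inv_coef lq a (I - {a, c}) * inv_coef lq c (I - {a, c}))
       (t a j (t c i (\<Phi> (I - {a, c}))) - l (h_diff lq c a) (t c j (t a i (\<Phi> (I - {a, c}))))))"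
proof -
  define G where "G = (\<lambda>(a, c). l (inv_coef lq a (I - {a}) * inv_coef lq c (I - {a, c})) (t a j (t c i (\<Phi> (I - {a, c})))))"
  have "L j (L i \<Phi>) I = (\<Sum>a\<in>I. \<Sum>c\<in>I - {a}. G (a, c))"
    unfolding L_def G_def t_simps l_simps prod.case
  proof (intro sum.cong refl)
    fix a c assume ac: "a \<in> I" "c \<in> I - {a}"
    have eq: "I - {a} - {c} = I - {a, c}" by auto
    have "shift (- omega a) (inv_coef lq c (I - {a, c})) = inv_coef lq c (I - {a, c})"
      by (rule shift_inv_coef) (use ac in auto)
    then show "l (inv_coef lq a (I - {a})) (t a j (l (inv_coef lq c (I - {a} - {c})) (t c i (\<Phi> (I - {a} - {c}))))) =
       l (inv_coef lq a (I - {a}) * inv_coef lq c (I - {a, c})) (t a j (t c i (\<Phi> (I - {a, c}))))"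
      by (simp add: eq t_l l_mult)
  qed
  also have "\<dots> = sum G (SIGMA a:I. I - {a})"
    by (subst sum.Sigma) auto
  also have "(SIGMA a:I. I - {a}) = {(a, c). a \<in> I \<and> c \<in> I \<and> a < c} \<union> {(a, c). a \<in> I \<and> c \<in> I \<and> c < a}"
    by auto
  also have "sum G \<dots> = sum G {(a, c). a \<in> I \<and> c \<in> I \<and> a < c} + sum G {(a, c). a \<in> I \<and> c \<in> I \<and> c < a}"
    by (rule sum.union_disjoint) auto
  also have "sum G {(a, c). a \<in> I \<and> c \<in> I \<and> c < a} = (\<Sum>(a, c)\<in>{(a, c). a \<in> I \<and> c \<in> I \<and> a < c}. G (c, a))"
    by (rule sum.reindex_bij_witness[where i = "\<lambda>(a, c). (c, a)" and j = "\<lambda>(a, c). (c, a)"]) auto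
  also have "sum G {(a, c). a \<in> I \<and> c \<in> I \<and> a < c} + \<dots> =
     (\<Sum>(a, c)\<in>{(a, c). a \<in> I \<and> c \<in> I \<and> a < c}. G (a, c) + G (c, a))"
    by (simp add: sum.distrib split_def)
  also have "\<dots> = (\<Sum>(a, c)\<in>{(a, c). a \<in> I \<and> c \<in> I \<and> a < c}.
     l (inv_coef lq a (I - {a, c}) * inv_coef lq c (I - {a, c}))
       (t a j (t c i (\<Phi> (I - {a, c}))) - l (h_diff lq c a) (t c j (t a i (\<Phi> (I - {a, c}))))))"
  proof (intro sum.cong refl, clarify)
    fix a c assume ac: "a \<in> I" "c \<in> I" "a < c"
    have eq: "I - {a} = insert c (I - {a, c})" "I - {c} = insert a (I - {a, c})" "I - {c, a} = I - {a, c}"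
      using ac by auto
    have "inv_coef lq a (I - {a}) = inv_coef lq a (I - {a, c})"
      unfolding eq(1) using ac by (subst inv_coef_insert) auto
    moreover have "inv_coef lq c (I - {c}) = - h_diff lq c a * inv_coef lq c (I - {a, c})"
      unfolding eq(2) using ac by (subst inv_coef_insert) auto
    ultimately show "G (a, c) + G (c, a) = l (inv_coef lq a (I - {a, c}) * inv_coef lq c (I - {a, c}))
       (t a j (t c i (\<Phi> (I - {a, c}))) - l (h_diff lq c a) (t c j (t a i (\<Phi> (I - {a, c})))))"
      unfolding G_def prod.case eq(3) l_simps
      by (simp add: uminus_l mult_ac flip: l_mult)
  qed
  finally show ?thesis .
qed

lemma L_L_same: "L i (L i \<Phi>) = (\<lambda>I. 0)"
  unfolding L_L by (rule ext, rule sum.neutral) (auto simp: t_same l_simps)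

lemma L_L_swap: "i < j \<Longrightarrow> L j (L i \<Phi>) = (\<lambda>I. - r (h_diff lq j i) (L i (L j \<Phi>) I))"
  unfolding L_L r_simps sum_negf[symmetric]
  by (intro ext sum.cong refl, clarify, subst t_cross) (auto simp: l_simps l_r)

lemma L_r: "L j (\<lambda>I. r f (\<Phi> I)) = (\<lambda>I. r (shift (- omega j) f) (L j \<Phi> I))"
  unfolding L_def r_simps by (intro ext sum.cong refl) (simp add: t_r l_r)

lemma L_zero: "L j (\<lambda>I. 0) = (\<lambda>I. 0)"
  by (simp add: L_def[abs_def] t_simps l_simps)

lemma L_one: "r 1 (L j \<Phi> I) = L j \<Phi> I"
  unfolding L_def r_simps by (intro sum.cong refl) (simp add: r_one flip: l_r)

text \<open>Straightening as in W: passing a smaller letter b costs -h(\<mu>_a - \<mu>_b), so the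
  coefficient is the one that orders w_a w_ds, now evaluated at \<mu>.\<close>

lemma L_insort:
  "a \<notin> set ds \<Longrightarrow> sorted ds \<Longrightarrow> distinct ds \<Longrightarrow>
   L a (foldr L ds \<Phi>) = (\<lambda>I. r (inv_coef lq a (set ds)) (foldr L (insort a ds) \<Phi> I))"
proof (induction ds)
  case Nil
  then show ?case by (simp add: inv_coef_def L_one)
next
  case (Cons b ds)
  show ?case
  proof (cases "a \<le> b")
    case True
    then have "{c \<in> set (b # ds). c < a} = {}" using Cons.prems by auto
    then have "inv_coef lq a (set (b # ds)) = 1" unfolding inv_coef_def by (simp only: prod.empty)
    then show ?thesis using True by (simp add: L_one)
  next
    case False
    then have ba: "b < a" by simp
    \<comment> \<open>Carrying the coefficient to the left of \<open>L b\<close> translates it by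
      \<open>- omega b\<close>; this has no effect because b differs from a and from all letters of
      \<open>ds\<close>.\<close>
    have sh: "shift (- omega b) (inv_coef lq a (set ds)) = inv_coef lq a (set ds)"
      by (rule shift_inv_coef) (use Cons.prems in auto)
    have "L a (foldr L (b # ds) \<Phi>) = (\<lambda>I. - r (h_diff lq a b) (L b (L a (foldr L ds \<Phi>)) I))"
      using L_L_swap[OF ba] by simp
    also have "\<dots> = (\<lambda>I. - r (h_diff lq a b * inv_coef lq a (set ds)) (L b (foldr L (insort a ds) \<Phi>) I))"
      using Cons by (simp add: L_r sh r_mult)
    also have "\<dots> = (\<lambda>I. r (inv_coef lq a (insert b (set ds))) (L b (foldr L (insort a ds) \<Phi>) I))"
      using Cons.prems ba by (subst inv_coef_insert) (auto simp: uminus_r)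
    finally show ?thesis using False by simp
  qed
qed

text \<open>For the empty word the coefficient would be \<open>r 1\<close>, which is known to be the
  identity on values of \<open>L\<close>; hence the condition on \<open>ds\<close>.\<close>

lemma foldr_L_sort:
  "distinct ds \<Longrightarrow> ds \<noteq> [] \<Longrightarrow> foldr L ds \<Phi> = (\<lambda>I. r (word_coef lq ds) (foldr L (sort ds) \<Phi> I))"
proof (induction ds)
  case (Cons a ds)
  show ?case
  proof (cases "ds = []")
    case True
    then show ?thesis by (simp add: inv_coef_def L_one)
  next
    case False
    have sh: "shift (- omega a) (word_coef lq ds) = word_coef lq ds"
      by (rule shift_word_coef) (use Cons.prems in auto)
    have "foldr L (a # ds) \<Phi> = L a (\<lambda>I. r (word_coef lq ds) (foldr L (sort ds) \<Phi> I))"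
      using Cons False by simp
    also have "\<dots> = (\<lambda>I. r (word_coef lq ds) (L a (foldr L (sort ds) \<Phi>) I))"
      by (simp add: L_r sh)
    also have "\<dots> = (\<lambda>I. r (word_coef lq ds * inv_coef lq a (set ds)) (foldr L (insort a (sort ds)) \<Phi> I))"
      using Cons.prems by (subst L_insort) (auto simp: r_mult)
    finally show ?thesis by (simp add: mult.commute)
  qed
qed simp

text \<open>\<open>L a\<close> is moved to the right past the smaller letters until it meets the
  other \<open>L a\<close>, where \<open>L_L_same\<close> applies.\<close>

lemma L_sorted_member:
  "a \<in> set ds \<Longrightarrow> sorted ds \<Longrightarrow> L a (foldr L ds \<Phi>) = (\<lambda>I. 0)"
proof (induction ds)
  case (Cons b ds)
  show ?case
  proof (cases "a = b")
    case False
    then have "b < a" "a \<in> set ds" using Cons.prems by auto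
    then show ?thesis using Cons by (simp add: L_L_swap L_zero r_simps)
  qed (simp add: L_L_same)
qed simp

lemma foldr_L_not_distinct:
  "\<not> distinct ds \<Longrightarrow> foldr L ds \<Phi> = (\<lambda>I. 0)"
proof (induction ds)
  case (Cons a ds)
  show ?case
  proof (cases "distinct ds")
    case True
    then have a: "a \<in> set ds" "ds \<noteq> []" using Cons by auto
    show ?thesis using L_sorted_member[of a "sort ds" \<Phi>] a
      by (simp add: foldr_L_sort[OF True] L_r r_simps)
  qed (use Cons L_zero in auto)
qed simp

section \<open>Products of generators along words, and the alternating sum over rows\<close>

fun word_act :: "'n list \<Rightarrow> 'n list \<Rightarrow> 'm \<Rightarrow> 'm" where
  "word_act (c # cs) (d # ds) x = t c d (word_act cs ds x)"
| "word_act _ _ x = x"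

text \<open>The coefficient of the top element w_1 ... w_n in R(w_d1) ... R(w_dk) applied to x. For
  k different from n there are no arrangements and the sum is 0.\<close>

definition alt_sum :: "'n list \<Rightarrow> 'm \<Rightarrow> 'm" where
  "alt_sum ds x = (\<Sum>cs\<in>arrangements UNIV (length ds). l (word_coef lq cs) (word_act cs ds x))"

text \<open>The initial function, concentrated on the empty set, stands for 1 tensored with x; the
  value at I is the coefficient of w_I. Coefficients of shorter words pass the new generator
  untranslated, since its row i is no longer in the set that they depend on.\<close>

lemma foldr_L_eq_sum:
  assumes "l 1 x = x"
  shows "foldr L ds (\<lambda>I. if I = {} then x else 0) I =
    (\<Sum>cs\<in>arrangements I (length ds). l (word_coef lq cs) (word_act cs ds x))"
proof (induction ds arbitrary: I)
  case Nil
  have "arrangements I 0 = (if I = {} then {[]} else {})" by (auto simp: arrangements_def)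
  then show ?case using assms by simp
next
  case (Cons d ds)
  have "l (inv_coef lq i (I - {i})) (t i d (l (word_coef lq cs) y)) = l (word_coef lq (i # cs)) (t i d y)"
    if "i \<in> I" "cs \<in> arrangements (I - {i}) k" for i cs y k
  proof -
    have cs: "set cs = I - {i}" using that(2) by (simp add: arrangements_def)
    then have "shift (- omega i) (word_coef lq cs) = word_coef lq cs"
      by (intro shift_word_coef) simp
    with cs show ?thesis by (simp add: t_l l_mult)
  qed
  then show ?case
    unfolding length_Cons sum_arrangements_Suc foldr.simps o_apply L_def[of d] Cons.IH
    by (simp add: t_simps l_simps del: word_coef.simps cong: sum.cong)
qed

lemma alt_sum_distinct:
  assumes "l 1 x = x" "distinct ds" "ds \<noteq> []"
  shows "alt_sum ds x = r (word_coef lq ds) (alt_sum (sort ds) x)"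
  using fun_cong[OF foldr_L_sort[OF assms(2,3), of "\<lambda>I. if I = {} then x else 0"], of UNIV]
  by (simp add: foldr_L_eq_sum[OF assms(1)] alt_sum_def)

lemma alt_sum_not_distinct:
  assumes "l 1 x = x" "\<not> distinct ds"
  shows "alt_sum ds x = 0"
  using fun_cong[OF foldr_L_not_distinct[OF assms(2), of "\<lambda>I. if I = {} then x else 0"], of UNIV]
  by (simp add: foldr_L_eq_sum[OF assms(1)] alt_sum_def)

end

section \<open>The vector representation\<close>

type_synonym 'n mvec = "('n mero, 'n) vec"

text \<open>The entry R^{xc}_{xc}, with g(z) written as h(z) h(-z).\<close>

definition Rdiag :: "complex \<Rightarrow> 'n \<Rightarrow> 'n \<Rightarrow> 'n::{finite,linorder} mero" where
  "Rdiag lq x c = (if x = c then qc lq else if x < c then 1 else h_diff lq x c * h_diff lq c x)"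

text \<open>
  The vector representation sends \<open>t\<^sub>c\<^sub>y\<close> to the matrix of \<open>R\<close>-entries with \<open>c\<close> and \<open>y\<close> fixed, composed
  with a shift. The two identities \<open>vec_t_same\<close> and \<open>vec_t_cross\<close> are the part of the dynamical Yang--Baxter
  equation that the column rule needs.
\<close>

definition vec_t :: "complex \<Rightarrow> 'n \<Rightarrow> 'n \<Rightarrow> 'n mvec \<Rightarrow> ('n::{finite,linorder}) mvec" where
  "vec_t lq c y F = (\<chi> x. if y = c then Rdiag lq x c * shift (- omega c) (F $ x)
     else if x = c then of_diff (h0_fun lq) c y * shift (- omega c) (F $ y) else 0)"

definition vec_l :: "'n mero \<Rightarrow> 'n mvec \<Rightarrow> ('n::{finite,linorder}) mvec" where
  "vec_l f F = (\<chi> x. f * F $ x)"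

text \<open>The coordinate x has weight \<omega>(x), so \<mu> acts on it as \<lambda> -
  \<omega>(x).\<close>

definition vec_r :: "'n mero \<Rightarrow> 'n mvec \<Rightarrow> ('n::{finite,linorder}) mvec" where
  "vec_r f F = (\<chi> x. shift (- omega x) f * F $ x)"

text \<open>A separate name keeps q^2 an atom while denominators are cleared; it is unfolded only in
  the final polynomial identities.\<close>

definition qsq :: "complex \<Rightarrow> 'n::finite mero" where "qsq lq = qc lq * qc lq"

lemma qsq_nonzero [simp]: "qsq lq \<noteq> 0" by (simp add: qsq_def)

lemma shift_qsq [simp]: "shift \<alpha> (qsq lq) = qsq lq" by (simp add: qsq_def shift_mult)

lemma shift_qvar': "shift (- omega c) (qvar lq a) = (if a = c then qsq lq * qvar lq a else qvar lq a)"
  by (simp add: shift_qvar qsq_def power2_eq_square)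

text \<open>Used at a fixed instance, to write the two composite translations, by a after c and by c
  after a, in the same form.\<close>

lemma omega_comm: "- omega c - omega a = - omega a - (omega c :: complex ^ 'n::finite)" by simp

context
  fixes lq :: complex
  assumes nz: "lq \<noteq> 0"
begin

lemma R_entry_diag: "R_entry lq x c x c = Rdiag lq x c"
  by (auto simp: R_entry_def Rdiag_def of_diff_g nz)

lemma vec_t_R_entry:
  "vec_t lq c y F $ x = (\<Sum>a\<in>UNIV. R_entry lq x y a c * shift (- omega c) (F $ a))"
proof -
  have "(\<Sum>a\<in>UNIV. R_entry lq x y a c * shift (- omega c) (F $ a)) =
    (\<Sum>a\<in>(if y = c then {x} else if x = c then {y} else {}). R_entry lq x y a c * shift (- omega c) (F $ a))"
    by (rule sum.mono_neutral_right) (auto simp: R_entry_def)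
  then show ?thesis by (auto simp: vec_t_def R_entry_diag) (simp add: R_entry_def)
qed

lemma qvar_eq_iff: "(qvar lq a = qvar lq b) = (a = b)"
  using qvar_neq[OF nz, of a b] by auto

lemma qvar_shifted_neq': "a \<noteq> b \<Longrightarrow> qsq lq * qvar lq a \<noteq> qvar lq b"
   "a \<noteq> b \<Longrightarrow> qvar lq b \<noteq> qsq lq * qvar lq a"
  using qvar_shifted_neq[OF nz, of a b] by (auto simp: power2_eq_square mult.assoc qsq_def)

lemma h_diff_qsq: "a \<noteq> b \<Longrightarrow> h_diff lq a b = (qsq lq * qvar lq a - qvar lq b) / (qc lq * (qvar lq a - qvar lq b))"
  by (simp add: of_diff_h_explicit[OF nz] qsq_def power2_eq_square)

lemma h0_qsq: "a \<noteq> b \<Longrightarrow> of_diff (h0_fun lq) a b = (1 - qsq lq) * qvar lq b / (qc lq * (qvar lq a - qvar lq b))"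
  using qvar_neq[OF nz, of a b] by (simp add: of_diff_h0[OF nz] qsq_def field_simps)

lemmas shift_explicit = shift_mult shift_divide shift_diff shift_qvar' h_diff_qsq h0_qsq
lemmas qvar_divide_simps = divide_simps qvar_eq_iff qvar_shifted_neq'

lemma vec_t_same:
  assumes "a < c"
  shows "vec_t lq a i (vec_t lq c i F) = vec_l (h_diff lq c a) (vec_t lq c i (vec_t lq a i F))"
proof (subst vec_eq_iff, rule allI)
  fix x
  have neq: "a \<noteq> c" "c \<noteq> a" "\<not> c < a" using assms by auto
  have "i = a \<and> x = c \<or> i = c \<and> x = a \<or> \<not> (i = a \<and> x = c \<or> i = c \<and> x = a)" by auto
  then show "vec_t lq a i (vec_t lq c i F) $ x = vec_l (h_diff lq c a) (vec_t lq c i (vec_t lq a i F)) $ x"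
  proof (elim disjE)
    assume "i = a \<and> x = c"
    then show ?thesis using assms neq
      by (simp add: vec_t_def vec_l_def Rdiag_def shift_explicit omega_comm[of c a],
          simp add: qvar_divide_simps, simp add: qsq_def algebra_simps)
  next
    assume "i = c \<and> x = a"
    then show ?thesis using assms neq
      by (simp add: vec_t_def vec_l_def Rdiag_def shift_explicit omega_comm[of c a],
          simp add: qvar_divide_simps, simp add: qsq_def algebra_simps)
  next
    assume "\<not> (i = a \<and> x = c \<or> i = c \<and> x = a)"
    then show ?thesis using assms neq by (auto simp: vec_t_def vec_l_def)
  qed
qed

lemma vec_t_cross:
  assumes "a < c" "i < j"
  shows "vec_t lq a j (vec_t lq c i F) - vec_l (h_diff lq c a) (vec_t lq c j (vec_t lq a i F)) =
       - vec_r (h_diff lq j i) (vec_t lq a i (vec_t lq c j F) - vec_l (h_diff lq c a) (vec_t lq c i (vec_t lq a j F)))"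
proof (subst vec_eq_iff, rule allI)
  fix x
  have neq: "a \<noteq> c" "c \<noteq> a" "i \<noteq> j" "j \<noteq> i" "\<not> c < a" "\<not> j < i" "\<not> (i = c \<and> j = a)" "\<not> (i = a \<and> i = c)" "\<not> (j = a \<and> j = c)" "\<not> (i = a \<and> j = a)" "\<not> (i = c \<and> j = c)" "\<not> (x = a \<and> x = c)" using assms by auto
  \<comment> \<open>A product of two of these operators is nonzero at x only if i, j and x meet a
    and c suitably. In the first seven cases some products can survive, and most of these reduce to
    an identity of rational functions; in the last five every product vanishes at x.\<close>
  consider "i = a \<and> j = c \<and> x = a" | "i = a \<and> j = c \<and> x = c" | "i = a \<and> j = c \<and> x \<noteq> a \<and> x \<noteq> c"
    | "i = a \<and> j \<noteq> c \<and> x = c" | "i = c \<and> j \<noteq> a \<and> x = a" | "i \<noteq> a \<and> i \<noteq> c \<and> j = a \<and> x = c"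
    | "i \<noteq> a \<and> i \<noteq> c \<and> j = c \<and> x = a"
    | "i = a \<and> j \<noteq> c \<and> x \<noteq> c" | "i = c \<and> x \<noteq> a" |  "i \<noteq> a \<and> i \<noteq> c \<and> j = a \<and> x \<noteq> c"
    | "i \<noteq> a \<and> i \<noteq> c \<and> j = c \<and> x \<noteq> a"
    | "i \<noteq> a \<and> i \<noteq> c \<and> j \<noteq> a \<and> j \<noteq> c" using neq by satx
  then show "(vec_t lq a j (vec_t lq c i F) - vec_l (h_diff lq c a) (vec_t lq c j (vec_t lq a i F))) $ x =
       (- vec_r (h_diff lq j i) (vec_t lq a i (vec_t lq c j F) - vec_l (h_diff lq c a) (vec_t lq c i (vec_t lq a j F)))) $ x"
  proof cases
    case 1
    then show ?thesis using assms neq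
      by (simp add: vec_t_def vec_l_def vec_r_def Rdiag_def shift_explicit omega_comm[of c a],
          simp add: qvar_divide_simps, simp add: qsq_def algebra_simps)
  next
    case 2
    then show ?thesis using assms neq
      by (simp add: vec_t_def vec_l_def vec_r_def Rdiag_def shift_explicit omega_comm[of c a],
          simp add: qvar_divide_simps, simp add: qsq_def algebra_simps)
  next
    case 3
    then have "a \<noteq> x" "c \<noteq> x" by auto
    then show ?thesis using assms neq 3
      by (simp add: vec_t_def vec_l_def vec_r_def Rdiag_def shift_explicit omega_comm[of c a])
  next
    case 4
    then have "a \<noteq> j" "j \<noteq> a" "c \<noteq> j" "\<not> j < a" using assms by auto
    then show ?thesis using assms neq 4
      by (simp add: vec_t_def vec_l_def vec_r_def Rdiag_def shift_explicit omega_comm[of c a],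
          simp add: qvar_divide_simps, simp add: qsq_def algebra_simps)
  next
    case 5
    then have "a \<noteq> j" "j \<noteq> a" "c \<noteq> j" "\<not> j < c" using assms by auto
    then show ?thesis using assms neq 5
      by (simp add: vec_t_def vec_l_def vec_r_def Rdiag_def shift_explicit omega_comm[of c a],
          simp add: qvar_divide_simps, simp add: qsq_def algebra_simps)
  next
    case 6
    then have "a \<noteq> i" "i \<noteq> a" "c \<noteq> i" "i \<noteq> c" "i < c" using assms by auto
    then show ?thesis using assms neq 6
      by (simp add: vec_t_def vec_l_def vec_r_def Rdiag_def shift_explicit omega_comm[of c a],
          simp add: qvar_divide_simps, simp add: qsq_def algebra_simps)
  next
    case 7
    then have "a \<noteq> i" "c \<noteq> i" "i < c" "j = c" "x = a" using assms by auto
    then show ?thesis using assms neq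
      by (simp add: vec_t_def vec_l_def vec_r_def Rdiag_def shift_explicit omega_comm[of c a],
          simp add: qvar_divide_simps, simp add: qsq_def algebra_simps)
  qed (use assms neq in \<open>auto simp: vec_t_def vec_l_def vec_r_def\<close>)
qed

lemma dyn_module_vec: "dyn_module lq vec_l vec_r (vec_t lq)"
proof
  show "vec_t lq a j (vec_t lq c i F) - vec_l (h_diff lq c a) (vec_t lq c j (vec_t lq a i F)) =
       - vec_r (h_diff lq j i) (vec_t lq a i (vec_t lq c j F) - vec_l (h_diff lq c a) (vec_t lq c i (vec_t lq a j F)))"
    if "a < c" "i < j" for a c i j F
    by (rule vec_t_cross[OF that])
  show "vec_r f (vec_t lq i j F) = vec_t lq i j (vec_r (shift (omega j) f) F)" for f i j F
    by (simp add: vec_eq_iff vec_r_def vec_t_def shift_mult add.commute)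
qed (auto simp: nz vec_t_same vec_eq_iff vec_l_def vec_r_def,
     auto simp: vec_t_def algebra_simps shift_add shift_mult)

end

text \<open>Products of \<open>R\<close>-entries collected by one strand, entering as \<open>x\<close> and leaving as \<open>a\<close>, along a word.\<close>

fun R_word :: "complex \<Rightarrow> 'n list \<Rightarrow> 'n list \<Rightarrow> 'n \<Rightarrow> 'n \<Rightarrow> 'n::{finite,linorder} mero" where
  "R_word lq (c # cs) (y # ys) x a = (\<Sum>x'\<in>UNIV. R_entry lq x y x' c * shift (- omega c) (R_word lq cs ys x' a))"
| "R_word lq _ _ x a = (if x = a then 1 else 0)"

text \<open>An R-entry vanishes unless its upper and lower indices agree as unordered pairs, so at
  most one x' contributes: the strand keeps its label if y = c and takes over the label y if x =
  c.\<close>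

lemma sum_R_entry:
  fixes G :: "'n::{finite,linorder} \<Rightarrow> 'n mero"
  shows "(\<Sum>x'\<in>UNIV. R_entry lq x y x' c * G x') =
     (if y = c then R_entry lq x c x c * G x else if x = c then of_diff (h0_fun lq) c y * G y else 0)"
proof -
  have "(\<Sum>x'\<in>UNIV. R_entry lq x y x' c * G x') =
    (\<Sum>x'\<in>(if y = c then {x} else if x = c then {y} else {}). R_entry lq x y x' c * G x')"
    by (rule sum.mono_neutral_right) (auto simp: R_entry_def)
  then show ?thesis by auto (auto simp: R_entry_def)
qed

section \<open>Matrix entries of the determinant in the vector representation\<close>

context
  fixes lq :: complex
  assumes nz: "lq \<noteq> 0"
begin

interpretation V: dyn_module lq vec_l vec_r "vec_t lq"
  by (rule dyn_module_vec[OF nz])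

lemma word_act_vec: "length cs = length ys \<Longrightarrow> V.word_act cs ys (axis a 1) $ x = R_word lq cs ys x a"
proof (induction cs ys arbitrary: x rule: list_induct2)
  case Nil
  then show ?case by (simp add: axis_def)
next
  case (Cons c cs y ys)
  then show ?case by (simp add: vec_t_R_entry[OF nz])
qed

text \<open>A strand labelled b can change its label only at a letter c = b of \<open>cs\<close>.
  There is none, so all factors are diagonal and force equal letters. Each translation lowers some
  \<lambda>_c that does not occur in the later factors.\<close>

lemma R_word_avoiding:
  "length cs = length ds \<Longrightarrow> distinct cs \<Longrightarrow> b \<notin> set cs \<Longrightarrow> b \<notin> set ds \<Longrightarrow>
   R_word lq cs ds b a = (if a = b \<and> cs = ds then \<Prod>k\<in>set ds. Rdiag lq b k else 0)"
proof (induction cs ds rule: list_induct2)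
  case (Cons c cs d ds)
  have "shift (- omega c) (\<Prod>k\<in>set cs. Rdiag lq b k) = (\<Prod>k\<in>set cs. Rdiag lq b k)"
    unfolding shift_prod using Cons.prems
    by (intro prod.cong) (auto simp: Rdiag_def shift_mult intro!: arg_cong2[where f = "(*)"] shift_h_diff)
  then show ?case using Cons by (auto simp: sum_R_entry R_entry_diag[OF nz])
qed auto

text \<open>At the first letter both upper indices are b, so the entry vanishes unless c = b, where
  it is q. Here the translation by \<open>- omega b\<close> does act on the remaining factors, which
  all involve \<lambda>_b.\<close>

lemma R_word_first:
  assumes "length cs = Suc (length ds)" "distinct cs" "b \<notin> set ds"
  shows "R_word lq cs (b # ds) b a =
    (if a = b \<and> cs = b # ds then qc lq * shift (- omega b) (\<Prod>k\<in>set ds. Rdiag lq b k) else 0)"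
proof -
  obtain c cs' where cs: "cs = c # cs'" using assms(1) by (cases cs) auto
  show ?thesis
  proof (cases "c = b")
    case True
    then show ?thesis using assms cs by (simp add: sum_R_entry R_word_avoiding) (simp add: R_entry_def)
  qed (use cs in \<open>simp add: sum_R_entry\<close>)
qed

text \<open>For z = \<lambda>_x - \<lambda>_k the translation turns -z into 1 - z, so this is h(z)
  h(1-z) = 1.\<close>

lemma h_diff_shift_inverse:
  fixes x k :: "'n::{finite,linorder}"
  assumes "x \<noteq> k"
  shows "h_diff lq x k * shift (- omega x) (h_diff lq k x) = 1"
  using assms qvar_eq_iff[OF nz, of x k] qvar_shifted_neq'[OF nz, of x k]
  by (simp add: shift_explicit[OF nz] divide_simps) (simp add: qsq_def algebra_simps)

text \<open>Only k < x contribute: there the diagonal entry is h(z) h(-z) with z = \<lambda>_x -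
  \<lambda>_k, and its translated second factor cancels h(z). The identity is used twice, for the
  scalar of the determinant on the vector representation and for the cancellation in
  \<open>det_commute\<close>.\<close>

lemma inv_coef_shift:
  fixes x :: "'n::{finite,linorder}"
  assumes "x \<notin> J"
  shows "inv_coef lq x J * shift (- omega x) (\<Prod>k\<in>J. Rdiag lq x k) = shift (- omega x) (inv_coef lq x J)"
proof -
  have "(\<Prod>k\<in>J. Rdiag lq x k) = (\<Prod>k\<in>{k\<in>J. k < x}. h_diff lq x k * h_diff lq k x)"
    by (rule prod.mono_neutral_cong_right) (use assms in \<open>auto simp: Rdiag_def\<close>)
  moreover have "- h_diff lq x k * shift (- omega x) (h_diff lq x k * h_diff lq k x) = shift (- omega x) (- h_diff lq x k)"
    if "k \<in> J" for k
  proof -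
    have "x \<noteq> k" using assms that by auto
    from h_diff_shift_inverse[OF this] show ?thesis
      by (simp add: shift_mult shift_uminus mult.left_commute)
  qed
  ultimately show ?thesis
    by (simp add: inv_coef_def shift_prod flip: prod.distrib)
qed

text \<open>The determinant acts on the vector representation by \<open>q\<close> times a shift: by the column rule it suffices to look at words \<open>ys\<close> starting with \<open>x\<close>.\<close>

lemma sum_word_coef_R_word:
  fixes ys :: "'n::{finite,linorder} list"
  assumes len: "length ys = CARD('n)"
  shows "(\<Sum>cs\<in>arrangements UNIV (CARD('n)). word_coef lq cs * R_word lq cs ys x a) =
    (if distinct ys \<and> x = a then qc lq * shift (- omega x) (word_coef lq ys) else 0)"
proof -
  have alt: "V.alt_sum ds (axis a 1) $ x = (\<Sum>cs\<in>arrangements UNIV (CARD('n)). word_coef lq cs * R_word lq cs ds x a)"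
    if "length ds = CARD('n)" for ds
    unfolding V.alt_sum_def that by (auto simp: vec_l_def word_act_vec that arrangements_def intro!: sum.cong)
  have one: "vec_l 1 F = F" for F :: "('n mero, 'n) vec" by (simp add: vec_l_def vec_eq_iff)
  show ?thesis
  proof (cases "distinct ys")
    case False
    then show ?thesis using V.alt_sum_not_distinct[OF one, of ys "axis a 1"] alt[OF len] by simp
  next
    case True
    define os where "os = sorted_list_of_set (UNIV - {x})"
    \<comment> \<open>In coordinate x the operator \<open>vec_r\<close> is multiplication by a
      translate, so \<open>Z\<close> is a common factor for all words with distinct letters. The
      word \<open>x # os\<close> determines it because a single arrangement contributes
      there.\<close>
    define Z where "Z = V.alt_sum (sorted_list_of_set UNIV) (axis a 1) $ x"
    have Z: "V.alt_sum ds (axis a 1) $ x = shift (- omega x) (word_coef lq ds) * Z"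
      if "distinct ds" "length ds = CARD('n)" for ds
    proof -
      have "set ds = UNIV" using that by (metis card_subset_eq distinct_card finite subset_UNIV)
      then have "sort ds = sorted_list_of_set UNIV" using that(1) by (metis sorted_list_of_set_sort_remdups distinct_remdups_id)
      moreover have "ds \<noteq> []" using that by auto
      ultimately show ?thesis using V.alt_sum_distinct[OF one that(1)] by (simp add: Z_def vec_r_def)
    qed
    have os: "set os = UNIV - {x}" "distinct (x # os)" "sorted os" "length (x # os) = CARD('n)"
      by (auto simp: os_def card_Diff_singleton card_gt_0_iff)
    have "shift (- omega x) (word_coef lq (x # os)) * Z = (\<Sum>cs\<in>arrangements UNIV (CARD('n)). word_coef lq cs * R_word lq cs (x # os) x a)"
      using Z[OF os(2,4)] alt[OF os(4)] by simp
    also have "\<dots> = (\<Sum>cs\<in>arrangements UNIV (CARD('n)). if cs = x # os then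
        (if a = x then word_coef lq (x # os) * (qc lq * shift (- omega x) (\<Prod>k\<in>set os. Rdiag lq x k)) else 0) else 0)"
    proof (rule sum.cong[OF refl])
      fix cs :: "'n list" assume "cs \<in> arrangements UNIV (CARD('n))"
      then have "length cs = Suc (length os)" "distinct cs" using os(4) by (auto simp: arrangements_def)
      from R_word_first[OF this, of x a] os(2)
      show "word_coef lq cs * R_word lq cs (x # os) x a = (if cs = x # os then
        (if a = x then word_coef lq (x # os) * (qc lq * shift (- omega x) (\<Prod>k\<in>set os. Rdiag lq x k)) else 0) else 0)"
        by (simp del: word_coef.simps R_word.simps)
    qed
    also have "\<dots> = (if a = x then qc lq * shift (- omega x) (word_coef lq (x # os)) else 0)"
    proof -
      have "x # os \<in> arrangements UNIV (CARD('n))" using os by (auto simp: arrangements_def)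
      then show ?thesis using os inv_coef_shift[of x "set os"] by (simp add: word_coef_sorted mult_ac)
    qed
    finally have "Z = (if a = x then qc lq else 0)"
      using word_coef_nonzero[OF nz, of "x # os"] by (auto split: if_splits simp del: word_coef.simps simp: mult.commute)
    then show ?thesis using True Z[OF True len] alt[OF len] by (simp add: mult.commute)
  qed
qed

end

section \<open>The determinant commutes with the generators\<close>

lemma R_entry_eq_0:
  "(x, y) \<notin> {(a, c), (c, a)} \<Longrightarrow> R_entry lq x y a c = 0"
  "(x, y) \<notin> {(a, c), (c, a)} \<Longrightarrow> R_entry lq a c x y = 0"
  by (auto simp: R_entry_def)

text \<open>The two index pairs that can contribute coincide when a = c. \<open>G\<close> is kept
  general so that the coefficient may enter through \<open>l\<close> together with a product of
  generators.\<close>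

lemma sum_R_entry_upper:
  fixes G :: "'n::{finite,linorder} \<Rightarrow> 'n \<Rightarrow> 'n mero \<Rightarrow> 'r::ab_group_add"
  assumes "\<And>x y. G x y 0 = 0"
  shows "(\<Sum>x\<in>UNIV. \<Sum>y\<in>UNIV. G x y (R_entry lq x y a c)) =
     (if a = c then G a a (qc lq) else G a c (R_entry lq a c a c) + G c a (of_diff (h0_fun lq) c a))"
proof -
  have "(\<Sum>x\<in>UNIV. \<Sum>y\<in>UNIV. G x y (R_entry lq x y a c)) =
     (\<Sum>(x, y)\<in>UNIV. G x y (R_entry lq x y a c))"
    by (simp add: sum.cartesian_product UNIV_Times_UNIV)
  also have "\<dots> = (\<Sum>(x, y)\<in>{(a, c), (c, a)}. G x y (R_entry lq x y a c))"
  proof (rule sum.mono_neutral_right)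
    show "\<forall>p\<in>UNIV - {(a, c), (c, a)}. (case p of (x, y) \<Rightarrow> G x y (R_entry lq x y a c)) = 0"
    proof
      fix p assume "p \<in> UNIV - {(a, c), (c, a)}"
      then show "(case p of (x, y) \<Rightarrow> G x y (R_entry lq x y a c)) = 0"
        by (cases p) (simp add: R_entry_eq_0 assms)
    qed
  qed auto
  also have "\<dots> = (if a = c then G a a (qc lq) else G a c (R_entry lq a c a c) + G c a (of_diff (h0_fun lq) c a))"
    by (auto simp: R_entry_def)
  finally show ?thesis .
qed

lemma sum_R_entry_lower:
  fixes G :: "'n::{finite,linorder} \<Rightarrow> 'n \<Rightarrow> 'n mero \<Rightarrow> 'r::ab_group_add"
  assumes "\<And>x y. G x y 0 = 0"
  shows "(\<Sum>x\<in>UNIV. \<Sum>y\<in>UNIV. G x y (R_entry lq b d x y)) =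
     (if b = d then G b b (qc lq) else G b d (R_entry lq b d b d) + G d b (of_diff (h0_fun lq) b d))"
proof -
  have "(\<Sum>x\<in>UNIV. \<Sum>y\<in>UNIV. G x y (R_entry lq b d x y)) =
     (\<Sum>(x, y)\<in>UNIV. G x y (R_entry lq b d x y))"
    by (simp add: sum.cartesian_product UNIV_Times_UNIV)
  also have "\<dots> = (\<Sum>(x, y)\<in>{(b, d), (d, b)}. G x y (R_entry lq b d x y))"
  proof (rule sum.mono_neutral_right)
    show "\<forall>p\<in>UNIV - {(b, d), (d, b)}. (case p of (x, y) \<Rightarrow> G x y (R_entry lq b d x y)) = 0"
    proof
      fix p assume "p \<in> UNIV - {(b, d), (d, b)}"
      then show "(case p of (x, y) \<Rightarrow> G x y (R_entry lq b d x y)) = 0"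
        by (cases p) (simp add: R_entry_eq_0 assms)
    qed
  qed auto
  also have "\<dots> = (if b = d then G b b (qc lq) else G b d (R_entry lq b d b d) + G d b (of_diff (h0_fun lq) b d))"
    by (auto simp: R_entry_def)
  finally show ?thesis .
qed

section \<open>Sums over all words of a given length\<close>

definition words :: "nat \<Rightarrow> 'n list set" where
  "words k = {ys. length ys = k}"

lemma finite_words [simp]: "finite (words k :: 'n::finite list set)"
  using finite_lists_length_eq[of "UNIV :: 'n set" k] by (simp add: words_def)

lemma sum_words_Suc:
  fixes F :: "'n::finite list \<Rightarrow> 'm::comm_monoid_add"
  shows "(\<Sum>ys\<in>words (Suc k). F ys) = (\<Sum>y\<in>UNIV. \<Sum>ys\<in>words k. F (y # ys))"
proof -
  have "(\<Sum>y\<in>UNIV. \<Sum>ys\<in>words k. F (y # ys)) = (\<Sum>(y, ys)\<in>UNIV \<times> words k. F (y # ys))"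
    by (rule sum.cartesian_product)
  also have "\<dots> = (\<Sum>ys\<in>words (Suc k). F ys)"
    by (rule sum.reindex_bij_witness[where i = "\<lambda>ys. (hd ys, tl ys)" and j = "\<lambda>(y, ys). y # ys"])
       (auto simp: words_def length_Suc_conv)
  finally show ?thesis by simp
qed

lemma sum_pairs: "(\<Sum>x\<in>A. \<Sum>y\<in>B. H x y) = (\<Sum>p\<in>A \<times> B. H (fst p) (snd p))"
  by (simp only: sum.cartesian_product split_def)

lemma sum_swap_pairs:
  fixes G :: "'a \<Rightarrow> 'b \<Rightarrow> 'c \<Rightarrow> 'd \<Rightarrow> 'e::comm_monoid_add"
  shows "(\<Sum>x\<in>A. \<Sum>y\<in>B. \<Sum>u\<in>C. \<Sum>v\<in>D. G x y u v) = (\<Sum>u\<in>C. \<Sum>v\<in>D. \<Sum>x\<in>A. \<Sum>y\<in>B. G x y u v)"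
proof -
  show ?thesis
    unfolding sum_pairs[where A = C and B = D] unfolding sum_pairs[where A = A and B = B] by (rule sum.swap)
qed

text \<open>No unit is required of the ring, since carrier-based rings will be embedded without
  preserving theirs. \<open>ring_const\<close> replaces the complex algebra structure: it makes the
  constants of the two copies agree.\<close>

locale dyn_ring =
  fixes lq :: complex
    and l r :: "'n::{finite,linorder} mero \<Rightarrow> 'r::ring"
    and t :: "'n \<Rightarrow> 'n \<Rightarrow> 'r"
  assumes lq_nz: "lq \<noteq> 0"
    and ring_l_add: "l (f + g) = l f + l g"
    and ring_r_add: "r (f + g) = r f + r g"
    and ring_l_mult: "l (f * g) = l f * l g"
    and ring_r_mult: "r (f * g) = r f * r g"
    and ring_const: "l (const_mero z) = r (const_mero z)"
    and ring_l_r: "l f * r g = r g * l f"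
    and ring_l_one: "l 1 * t i j = t i j"
    and ring_l_t: "l f * t i j = t i j * l (shift (omega i) f)"
    and ring_r_t: "r f * t i j = t i j * r (shift (omega j) f)"
    and RLL: "(\<Sum>x\<in>UNIV. \<Sum>y\<in>UNIV. l (R_entry lq x y a c) * t x b * t y d) =
              (\<Sum>x\<in>UNIV. \<Sum>y\<in>UNIV. r (R_entry lq b d x y) * t c y * t a x)"
begin

lemma l_zero [simp]: "l 0 = 0" and r_zero [simp]: "r 0 = 0"
  using ring_l_add[of 0 0] ring_r_add[of 0 0] by auto

lemma l_diff: "l (f - g) = l f - l g" and r_diff: "r (f - g) = r f - r g"
  using ring_l_add[of "f - g" g] ring_r_add[of "f - g" g] by (auto simp: algebra_simps)

lemma l_one_eq: "l 1 = r 1"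
  using ring_const[of 1] by simp

lemma RLL_neq:
  assumes "a \<noteq> c" "b \<noteq> d"
  shows "l (R_entry lq a c a c) * t a b * t c d + l (of_diff (h0_fun lq) c a) * t c b * t a d =
         r (R_entry lq b d b d) * t c d * t a b + r (of_diff (h0_fun lq) b d) * t c b * t a d"
  using RLL[of a c b d] assms
    sum_R_entry_upper[of "\<lambda>x y f. l f * t x b * t y d" lq a c]
    sum_R_entry_lower[of "\<lambda>x y f. r f * t c y * t a x" lq b d]
  by simp

text \<open>For equal columns the right side of RLL reduces to the entry q, and q - h_0 = h.\<close>

lemma ring_t_same:
  assumes "a < c" shows "t a i * t c i = l (h_diff lq c a) * (t c i * t a i)"
proof -
  have "a \<noteq> c" using assms by auto
  have "l 1 * t a i * t c i + l (of_diff (h0_fun lq) c a) * t c i * t a i = r (qc lq) * t c i * t a i"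
    using RLL[of a c i i] assms \<open>a \<noteq> c\<close>
      sum_R_entry_upper[of "\<lambda>x y f. l f * t x i * t y i" lq a c]
      sum_R_entry_lower[of "\<lambda>x y f. r f * t c y * t a x" lq i i]
    by (simp add: R_entry_def)
  then have "t a i * t c i = (l (qc lq) - l (of_diff (h0_fun lq) c a)) * (t c i * t a i)"
    by (simp add: ring_const ring_l_one algebra_simps)
  then show ?thesis using assms by (simp add: of_diff_h l_diff)
qed

text \<open>Two RLL-relations are combined, one with columns (i, j) and one with (j, i). After
  substituting both, the factorization g(z) = h(z) h(-z) makes everything a multiple of h(\<mu>_j -
  \<mu>_i).\<close>

lemma ring_t_cross:
  assumes "a < c" "i < j"
  shows "t a j * t c i - l (h_diff lq c a) * (t c j * t a i) =
       - (r (h_diff lq j i) * (t a i * t c j - l (h_diff lq c a) * (t c i * t a j)))"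
proof -
  have "\<not> j < i" "i \<noteq> j" "a \<noteq> c" using assms by auto
  note assms = assms this
  define A B C h h' where "A = t a i * t c j" and "B = t c i * t a j" and "C = t c j * t a i"
    and "h = l (of_diff (h0_fun lq) c a)" and "h' = r (of_diff (h0_fun lq) i j)"
  have one: "l 1 * A = A" "l 1 * C = C"  "l 1 * (t a j * t c i) = t a j * t c i"
    by (simp_all add: A_def C_def ring_l_one flip: mult.assoc)
  have 1: "A = C + h' * B - h * B"
    using RLL_neq[of a c i j] assms by (simp add: R_entry_def ring_l_one A_def B_def C_def h_def h'_def mult.assoc
      one[unfolded A_def C_def] l_one_eq[symmetric] eq_diff_eq)
  have 2: "t a j * t c i = r (of_diff (g_fun lq) j i) * B + r (of_diff (h0_fun lq) j i) * C - h * C"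
    using RLL_neq[of a c j i] assms by (simp add: R_entry_def ring_l_one A_def B_def C_def h_def h'_def mult.assoc
      one[unfolded A_def C_def] l_one_eq[symmetric] eq_diff_eq)
  have hca: "l (h_diff lq c a) = r (qc lq) - h"
    using assms by (simp add: of_diff_h l_diff ring_const h_def)
  have hij: "r (h_diff lq i j) = r (qc lq) - h'"
    using assms by (simp add: of_diff_h r_diff h'_def)
  have hji: "r (of_diff (h0_fun lq) j i) = r (qc lq) - r (h_diff lq j i)"
    using assms by (simp add: of_diff_h r_diff)
  have g: "r (of_diff (g_fun lq) j i) = r (h_diff lq j i) * (r (qc lq) - h')"
    using assms by (simp add: of_diff_g[OF lq_nz] ring_r_mult hij)
  show ?thesis
    unfolding A_def[symmetric] B_def[symmetric] C_def[symmetric] 1 2 hca hji g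
    by (simp add: algebra_simps)
qed

sublocale dyn_module lq "\<lambda>f. (*) (l f)" "\<lambda>f. (*) (r f)" "\<lambda>i j. (*) (t i j)"
proof
  show "t a j * (t c i * x) - l (h_diff lq c a) * (t c j * (t a i * x)) =
       - (r (h_diff lq j i) * (t a i * (t c j * x) - l (h_diff lq c a) * (t c i * (t a j * x))))"
    if "a < c" "i < j" for a c i j x
    using arg_cong[OF ring_t_cross[OF that], of "\<lambda>y. y * x"] by (simp add: algebra_simps)
  show "t a i * (t c i * x) = l (h_diff lq c a) * (t c i * (t a i * x))" if "a < c" for a c i x
    using ring_t_same[OF that, of i] by (metis mult.assoc)
  show "l f * (r g * x) = r g * (l f * x)" for f g x by (metis ring_l_r mult.assoc)
  show "l f * (t i j * x) = t i j * (l (shift (omega i) f) * x)" for f i j x by (metis ring_l_t mult.assoc)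
  show "r f * (t i j * x) = t i j * (r (shift (omega j) f) * x)" for f i j x by (metis ring_r_t mult.assoc)
  show "l 1 * (t i j * x) = t i j * x" "r 1 * (t i j * x) = t i j * x" for i j x
    by (metis ring_l_one mult.assoc l_one_eq)+
qed (auto simp: lq_nz distrib_left distrib_right ring_l_add ring_r_add ring_l_mult ring_r_mult mult.assoc)

text \<open>One RLL-relation moves the generator past the first letter and changes its column from b
  to a summed b'. The induction therefore runs over arbitrary b.\<close>

lemma exchange:
  "length cs = length ds \<Longrightarrow>
   (\<Sum>x\<in>UNIV. \<Sum>ys\<in>words (length ds). l (R_word lq cs ys x a) * (t x b * word_act ys ds m)) =
   (\<Sum>x\<in>UNIV. \<Sum>ys\<in>words (length ds). r (R_word lq ys ds b x) * word_act cs ys (t a x * m))"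
proof (induction cs ds arbitrary: b rule: list_induct2)
  case Nil
  have "(\<Sum>x\<in>UNIV. l (if x = a then 1 else 0) * (t x b * m)) = (\<Sum>x\<in>UNIV. if x = a then t a b * m else 0)"
    by (rule sum.cong) (auto simp: l_one)
  moreover have "(\<Sum>x\<in>UNIV. r (if b = x then 1 else 0) * (t a x * m)) = (\<Sum>x\<in>UNIV. if x = b then t a b * m else 0)"
    by (rule sum.cong) (auto simp: r_one)
  ultimately show ?case by (simp add: words_def)
next
  case (Cons c cs d ds)
  let ?W = "words (length ds)"
  have l_sum: "l (sum F A) = (\<Sum>x\<in>A. l (F x))" for F :: "'n \<Rightarrow> 'n mero" and A
    by (induction A rule: infinite_finite_induct) (auto simp: ring_l_add)
  have r_sum: "r (sum F A) = (\<Sum>x\<in>A. r (F x))" for F :: "'n \<Rightarrow> 'n mero" and A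
    by (induction A rule: infinite_finite_induct) (auto simp: ring_r_add)
  have "(\<Sum>x\<in>UNIV. \<Sum>ys\<in>words (length (d # ds)). l (R_word lq (c # cs) ys x a) * (t x b * word_act ys (d # ds) m)) =
    (\<Sum>x\<in>UNIV. \<Sum>y\<in>UNIV. \<Sum>ys\<in>?W. \<Sum>x'\<in>UNIV.
       l (shift (- omega c) (R_word lq cs ys x' a)) * (l (R_entry lq x y x' c) * t x b * t y d * word_act ys ds m))"
    by (simp add: sum_words_Suc l_sum sum_distrib_right ring_l_mult[of "R_entry _ _ _ _ _"] mult.assoc mult.commute[of "R_entry _ _ _ _ _"] ring_l_mult)
  also have "\<dots> = (\<Sum>ys\<in>?W. \<Sum>x'\<in>UNIV. l (shift (- omega c) (R_word lq cs ys x' a)) *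
       ((\<Sum>x\<in>UNIV. \<Sum>y\<in>UNIV. l (R_entry lq x y x' c) * t x b * t y d) * word_act ys ds m))"
    by (subst sum_swap_pairs) (simp only: sum_distrib_left sum_distrib_right mult.assoc)
  also have "\<dots> = (\<Sum>ys\<in>?W. \<Sum>x'\<in>UNIV. l (shift (- omega c) (R_word lq cs ys x' a)) *
       ((\<Sum>b'\<in>UNIV. \<Sum>y\<in>UNIV. r (R_entry lq b d b' y) * t c y * t x' b') * word_act ys ds m))"
    by (simp add: RLL)
  also have "\<dots> = (\<Sum>b'\<in>UNIV. \<Sum>y\<in>UNIV. r (R_entry lq b d b' y) * (t c y *
       (\<Sum>x'\<in>UNIV. \<Sum>ys\<in>?W. l (R_word lq cs ys x' a) * (t x' b' * word_act ys ds m))))"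
  proof -
    \<comment> \<open>Functions of \<lambda> and of \<mu> commute. Moving the first one to the right
      past t_cy cancels the translation that the recursion of \<open>R_word\<close> has put on it,
      so that the induction hypothesis applies.\<close>
    have "l (shift (- omega c) f) * (r g * t c y * t x' b' * z) = r g * (t c y * (l f * (t x' b' * z)))" for f g y x' b' z
      by (metis ring_l_r t_l mult.assoc)
    then show ?thesis
      by (simp only: sum_distrib_left sum_distrib_right) (subst sum_swap_pairs, subst (3) sum.swap, rule refl)
  qed
  also have "\<dots> = (\<Sum>b'\<in>UNIV. \<Sum>y\<in>UNIV. r (R_entry lq b d b' y) * (t c y *
       (\<Sum>x\<in>UNIV. \<Sum>ys\<in>?W. r (R_word lq ys ds b' x) * word_act cs ys (t a x * m))))"
    by (simp only: Cons.IH)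
  also have "\<dots> = (\<Sum>x\<in>UNIV. \<Sum>y\<in>UNIV. \<Sum>ys\<in>?W. \<Sum>b'\<in>UNIV. r (R_entry lq b d b' y) * (t c y *
        (r (R_word lq ys ds b' x) * word_act cs ys (t a x * m))))"
  proof -
    have "(\<Sum>b'\<in>UNIV. \<Sum>y\<in>UNIV. \<Sum>x\<in>UNIV. \<Sum>ys\<in>?W. G b' y x ys) = (\<Sum>x\<in>UNIV. \<Sum>y\<in>UNIV. \<Sum>ys\<in>?W. \<Sum>b'\<in>UNIV. G b' y x ys)"
      for G :: "'n \<Rightarrow> 'n \<Rightarrow> 'n \<Rightarrow> 'n list \<Rightarrow> 'r"
    proof -
      have "(\<Sum>b'\<in>UNIV. \<Sum>y\<in>UNIV. \<Sum>x\<in>UNIV. \<Sum>ys\<in>?W. G b' y x ys) = (\<Sum>x\<in>UNIV. \<Sum>ys\<in>?W. \<Sum>b'\<in>UNIV. \<Sum>y\<in>UNIV. G b' y x ys)"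
        by (rule sum_swap_pairs)
      also have "\<dots> = (\<Sum>x\<in>UNIV. \<Sum>y\<in>UNIV. \<Sum>ys\<in>?W. \<Sum>b'\<in>UNIV. G b' y x ys)"
        by (intro sum.cong refl) (rule trans[OF sum.cong[OF refl sum.swap] sum.swap])
      finally show ?thesis .
    qed
    then show ?thesis by (simp only: sum_distrib_left)
  qed
  also have "\<dots> = (\<Sum>x\<in>UNIV. \<Sum>ys\<in>words (length (d # ds)). r (R_word lq ys (d # ds) b x) * word_act (c # cs) ys (t a x * m))"
    \<comment> \<open>On the \<mu> side the translation demanded by the recursion of
      \<open>R_word\<close> is created by moving the coefficient to the left of t_cy.\<close>
    by (simp add: sum_words_Suc r_sum sum_distrib_right ring_r_mult t_r mult.assoc)
  finally show ?case .
qed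

end

section \<open>Commutation of the determinant with one generator\<close>

context dyn_ring
begin

lemma l_sum: "l (sum F A) = (\<Sum>x\<in>A. l (F x))"
  by (induction A rule: infinite_finite_induct) (auto simp: ring_l_add)

lemma word_act_mult: "word_act cs ds (x * y) = word_act cs ds x * y"
  by (induction cs ds x rule: word_act.induct) (auto simp: mult.assoc)

lemma alt_sum_mult: "alt_sum ds (x * y) = alt_sum ds x * y"
  by (simp add: alt_sum_def word_act_mult sum_distrib_right mult.assoc)

definition det :: 'r where "det = alt_sum (sorted_list_of_set UNIV) (l 1)"

lemma arrangements_sub_words: "arrangements UNIV k \<subseteq> words k"
  by (auto simp: arrangements_def words_def)

lemma words_distinct: "ys \<in> words (CARD('n)) \<Longrightarrow> ys \<in> arrangements UNIV (CARD('n)) \<longleftrightarrow> distinct (ys :: 'n list)"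
  by (auto simp: words_def arrangements_def) (metis UNIV_I card_subset_eq distinct_card finite subset_UNIV)

text \<open>Collecting the sum over \<open>cs\<close> gives the coefficients of
  \<open>sum_word_coef_R_word\<close>. Their translation by \<open>- omega a\<close> is the one
  produced by moving \<open>word_coef lq ys\<close> from the right of t_ab to its left, so the
  alternating sum reappears behind t_ab.\<close>

lemma t_alt_sum:
  assumes ds: "length ds = CARD('n)"
  shows "(\<Sum>cs\<in>arrangements UNIV (CARD('n)). l (word_coef lq cs) *
      (\<Sum>x\<in>UNIV. \<Sum>ys\<in>words (CARD('n)). l (R_word lq cs ys x a) * (t x b * word_act ys ds m)))
    = l (qc lq) * (t a b * alt_sum ds m)"
proof -
  have "(\<Sum>cs\<in>arrangements UNIV (CARD('n)). l (word_coef lq cs) *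
      (\<Sum>x\<in>UNIV. \<Sum>ys\<in>words (CARD('n)). l (R_word lq cs ys x a) * (t x b * word_act ys ds m)))
    = (\<Sum>x\<in>UNIV. \<Sum>ys\<in>words (CARD('n)). l (\<Sum>cs\<in>arrangements UNIV (CARD('n)). word_coef lq cs * R_word lq cs ys x a) *
        (t x b * word_act ys ds m))"
    unfolding sum_distrib_left l_sum sum_distrib_right ring_l_mult mult.assoc
    by (subst sum.swap) (intro sum.cong refl sum.swap)
  also have "\<dots> = (\<Sum>x\<in>UNIV. \<Sum>ys\<in>words (CARD('n)).
      l (if distinct ys \<and> x = a then qc lq * shift (- omega x) (word_coef lq ys) else 0) * (t x b * word_act ys ds m))"
    by (intro sum.cong refl, subst sum_word_coef_R_word[OF lq_nz]) (auto simp: words_def)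
  also have "\<dots> = (\<Sum>x\<in>UNIV. if x = a then \<Sum>ys\<in>words (CARD('n)). if distinct ys then
       l (qc lq) * (t a b * (l (word_coef lq ys) * word_act ys ds m)) else 0 else 0)"
    by (intro sum.cong refl) (auto simp: ring_l_mult t_l mult.assoc intro!: sum.cong)
  also have "\<dots> = (\<Sum>ys\<in>words (CARD('n)). if distinct ys then
       l (qc lq) * (t a b * (l (word_coef lq ys) * word_act ys ds m)) else 0)"
    by simp
  also have "\<dots> = (\<Sum>ys\<in>arrangements UNIV (CARD('n)). l (qc lq) * (t a b * (l (word_coef lq ys) * word_act ys ds m)))"
    by (rule sum.mono_neutral_cong_right) (use arrangements_sub_words words_distinct in auto)
  finally show ?thesis by (simp add: alt_sum_def ds sum_distrib_left)
qed

text \<open>Words \<open>ys\<close> with a repeated letter drop out by the column rule. For the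
  others \<open>R_word_first\<close> leaves only the strand that keeps the label b along
  \<open>b # ds\<close>.\<close>

lemma alt_sum_t:
  assumes m: "l 1 * m = m" and b: "b # ds \<in> arrangements UNIV (CARD('n))"
  shows "(\<Sum>cs\<in>arrangements UNIV (CARD('n)). l (word_coef lq cs) *
      (\<Sum>x\<in>UNIV. \<Sum>ys\<in>words (CARD('n)). r (R_word lq ys (b # ds) b x) * word_act cs ys (t a x * m)))
    = r (qc lq * shift (- omega b) (\<Prod>k\<in>set ds. Rdiag lq b k)) * alt_sum (b # ds) (t a b * m)"
proof -
  have "(\<Sum>cs\<in>arrangements UNIV (CARD('n)). l (word_coef lq cs) *
      (\<Sum>x\<in>UNIV. \<Sum>ys\<in>words (CARD('n)). r (R_word lq ys (b # ds) b x) * word_act cs ys (t a x * m)))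
    = (\<Sum>x\<in>UNIV. \<Sum>ys\<in>words (CARD('n)). r (R_word lq ys (b # ds) b x) * alt_sum ys (t a x * m))"
  proof -
    have "(\<Sum>cs\<in>arrangements UNIV (CARD('n)). l (word_coef lq cs) *
      (\<Sum>x\<in>UNIV. \<Sum>ys\<in>words (CARD('n)). r (R_word lq ys (b # ds) b x) * word_act cs ys (t a x * m)))
      = (\<Sum>cs\<in>arrangements UNIV (CARD('n)). \<Sum>x\<in>UNIV. \<Sum>ys\<in>words (CARD('n)).
         r (R_word lq ys (b # ds) b x) * (l (word_coef lq cs) * word_act cs ys (t a x * m)))"
      unfolding sum_distrib_left by (simp only: l_r)
    also have "\<dots> = (\<Sum>x\<in>UNIV. \<Sum>ys\<in>words (CARD('n)). \<Sum>cs\<in>arrangements UNIV (CARD('n)).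
         r (R_word lq ys (b # ds) b x) * (l (word_coef lq cs) * word_act cs ys (t a x * m)))"
      by (subst sum.swap) (intro sum.cong refl sum.swap)
    also have "\<dots> = (\<Sum>x\<in>UNIV. \<Sum>ys\<in>words (CARD('n)). r (R_word lq ys (b # ds) b x) * alt_sum ys (t a x * m))"
      by (intro sum.cong refl) (simp add: alt_sum_def sum_distrib_left words_def)
    finally show ?thesis .
  qed
  also have "\<dots> = (\<Sum>x\<in>UNIV. \<Sum>ys\<in>words (CARD('n)).
     if ys = b # ds \<and> x = b then r (qc lq * shift (- omega b) (\<Prod>k\<in>set ds. Rdiag lq b k)) * alt_sum (b # ds) (t a b * m) else 0)"
  proof (intro sum.cong refl)
    fix x and ys :: "'n list" assume ys: "ys \<in> words (CARD('n))"
    show "r (R_word lq ys (b # ds) b x) * alt_sum ys (t a x * m) = (if ys = b # ds \<and> x = b then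
       r (qc lq * shift (- omega b) (\<Prod>k\<in>set ds. Rdiag lq b k)) * alt_sum (b # ds) (t a b * m) else 0)"
    proof (cases "distinct ys")
      case True
      have "length ys = Suc (length ds)" "b \<notin> set ds" using ys b by (auto simp: words_def arrangements_def)
      from R_word_first[OF lq_nz this(1) True this(2)] show ?thesis by auto
    next
      case False
      then have "ys \<noteq> b # ds" using b by (auto simp: arrangements_def)
      moreover have "alt_sum ys (t a x * m) = 0" by (rule alt_sum_not_distinct) (auto simp: l_one False)
      ultimately show ?thesis by simp
    qed
  qed
  also have "\<dots> = (\<Sum>x\<in>UNIV. if x = b then r (qc lq * shift (- omega b) (\<Prod>k\<in>set ds. Rdiag lq b k)) * alt_sum (b # ds) (t a b * m) else 0)"
  proof (intro sum.cong refl)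
    fix x
    have "b # ds \<in> words (CARD('n))" using b by (auto simp: words_def arrangements_def)
    then show "(\<Sum>ys\<in>words (CARD('n)). if ys = b # ds \<and> x = b then r (qc lq * shift (- omega b) (\<Prod>k\<in>set ds. Rdiag lq b k)) * alt_sum (b # ds) (t a b * m) else 0)
      = (if x = b then r (qc lq * shift (- omega b) (\<Prod>k\<in>set ds. Rdiag lq b k)) * alt_sum (b # ds) (t a b * m) else 0)"
      by (cases "x = b") auto
  qed
  finally show ?thesis by simp
qed

lemma one_one: "l 1 * l 1 = l 1"
  by (simp flip: ring_l_mult)

theorem det_commute: "det * t a b = t a b * det"
proof -
  define ds where "ds = sorted_list_of_set (UNIV - {b})"
  define u where "u = shift (- omega b) (inv_coef lq b (set ds))"
  have ds: "set ds = UNIV - {b}" "distinct (b # ds)" "sorted ds" "length (b # ds) = CARD('n)"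
    by (auto simp: ds_def card_Diff_singleton card_gt_0_iff)
  then have b: "b # ds \<in> arrangements UNIV (CARD('n))" by (auto simp: arrangements_def)
  have coef: "word_coef lq (b # ds) = inv_coef lq b (set ds)"
    using ds by (simp add: word_coef_sorted)
  have "sort (b # ds) = sorted_list_of_set UNIV" (is "?s = _")
    using ds by (metis sorted_list_of_set_sort_remdups distinct_remdups_id insert_Diff UNIV_I list.simps(15))
  then have alt: "alt_sum (b # ds) m = r (inv_coef lq b (set ds)) * alt_sum (sorted_list_of_set UNIV) m" if "l 1 * m = m" for m
    using alt_sum_distinct[OF that ds(2)] unfolding coef \<open>?s = _\<close> by simp
  have "l (qc lq) * (t a b * alt_sum (b # ds) (l 1)) =
     r (qc lq * shift (- omega b) (\<Prod>k\<in>set ds. Rdiag lq b k)) * alt_sum (b # ds) (t a b * l 1)"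
    unfolding t_alt_sum[OF ds(4), symmetric] alt_sum_t[OF one_one b, symmetric]
    using exchange[of _ "b # ds" a b "l 1"] ds(4) by (intro sum.cong refl) (simp add: arrangements_def del: R_word.simps word_act.simps)
  also have "t a b * l 1 = l 1 * t a b"
    by (simp add: ring_l_t)
  also have "alt_sum (b # ds) (l 1 * t a b) = r (inv_coef lq b (set ds)) * (det * t a b)"
    unfolding det_def alt_sum_mult[symmetric] by (rule alt) (simp add: ring_l_one)
  \<comment> \<open>\<open>u\<close> is the ordering coefficient after being carried to the left of
    t_ab; the other side produces the same \<open>u\<close> through
    \<open>inv_coef_shift\<close>.\<close>
  also have "t a b * alt_sum (b # ds) (l 1) = r u * (t a b * det)"
    by (simp add: alt one_one t_r u_def det_def)
  also have "r (qc lq * shift (- omega b) (\<Prod>k\<in>set ds. Rdiag lq b k)) * (r (inv_coef lq b (set ds)) * (det * t a b))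
     = r (qc lq * (inv_coef lq b (set ds) * shift (- omega b) (\<Prod>k\<in>set ds. Rdiag lq b k))) * (det * t a b)"
    by (simp only: mult.assoc[symmetric] ring_r_mult[symmetric]) (simp only: mult_ac)
  also have "inv_coef lq b (set ds) * shift (- omega b) (\<Prod>k\<in>set ds. Rdiag lq b k) = u"
    unfolding u_def by (rule inv_coef_shift[OF lq_nz]) (use ds in auto)
  finally have "r (qc lq * u) * (t a b * det) = r (qc lq * u) * (det * t a b)"
    by (simp add: ring_const ring_r_mult mult.assoc)
  \<comment> \<open>Since \<open>qc lq * u\<close> is a nonzero meromorphic function, it cancels up
    to \<open>r 1\<close>, and \<open>r 1\<close> fixes both products.\<close>
  then have "r (inverse (qc lq * u)) * (r (qc lq * u) * (t a b * det)) = r (inverse (qc lq * u)) * (r (qc lq * u) * (det * t a b))"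
    by simp
  moreover have "inverse (qc lq * u) * (qc lq * u) = 1"
    using inv_coef_nonzero[OF lq_nz, of b "set ds"] by (intro left_inverse) (simp add: u_def)
  ultimately have "r 1 * (t a b * det) = r 1 * (det * t a b)"
    by (simp flip: ring_r_mult mult.assoc)
  moreover have "r 1 * (det * t a b) = det * t a b"
    by (simp add: det_def alt_sum_def sum_distrib_left sum_distrib_right flip: l_one_eq mult.assoc ring_l_mult)
  ultimately show ?thesis by (simp add: r_one)
qed

end

section \<open>Carrier-based rings inside a type class\<close>

text \<open>
  The product of all rings with elements of type \<open>'a\<close> is a type of class \<open>ring\<close> that contains every
  such ring. The embedding is not unital: the image of the unit is only an idempotent.
\<close>

typedef 'a ringprod = "{F :: 'a ring \<Rightarrow> 'a. \<forall>R. if Ring.ring R then F R \<in> carrier R else F R = undefined}"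
proof -
  show "\<exists>F :: 'a ring \<Rightarrow> 'a. F \<in> {F. \<forall>R. if Ring.ring R then F R \<in> carrier R else F R = undefined}"
    by (rule exI[of _ "\<lambda>R. if Ring.ring R then \<zero>\<^bsub>R\<^esub> else undefined"]) (auto dest: ring.ring_simprules(2))
qed

setup_lifting type_definition_ringprod

instantiation ringprod :: (type) ring
begin

lift_definition zero_ringprod :: "'a ringprod" is "\<lambda>R. if Ring.ring R then \<zero>\<^bsub>R\<^esub> else undefined"
  by (auto dest: ring.ring_simprules)
lift_definition plus_ringprod :: "'a ringprod \<Rightarrow> 'a ringprod \<Rightarrow> 'a ringprod" is
  "\<lambda>F G R. if Ring.ring R then F R \<oplus>\<^bsub>R\<^esub> G R else undefined"
  by (auto intro: ring.ring_simprules)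
lift_definition uminus_ringprod :: "'a ringprod \<Rightarrow> 'a ringprod" is
  "\<lambda>F R. if Ring.ring R then \<ominus>\<^bsub>R\<^esub> F R else undefined"
  by (auto intro: ring.ring_simprules)
lift_definition minus_ringprod :: "'a ringprod \<Rightarrow> 'a ringprod \<Rightarrow> 'a ringprod" is
  "\<lambda>F G R. if Ring.ring R then F R \<ominus>\<^bsub>R\<^esub> G R else undefined"
  by (auto intro: ring.ring_simprules)
lift_definition times_ringprod :: "'a ringprod \<Rightarrow> 'a ringprod \<Rightarrow> 'a ringprod" is
  "\<lambda>F G R. if Ring.ring R then F R \<otimes>\<^bsub>R\<^esub> G R else undefined"
  by (auto intro: ring.ring_simprules)

instance
proof
  fix a b c :: "'a ringprod"
  show "a + b + c = a + (b + c)" by transfer (auto simp: fun_eq_iff ring.ring_simprules)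
  show "a + b = b + a" by transfer (auto simp: fun_eq_iff ring.ring_simprules(10))
  show "0 + a = a" by transfer (auto simp: fun_eq_iff ring.ring_simprules)
  show "- a + a = 0" by transfer (auto simp: fun_eq_iff ring.ring_simprules)
  show "a - b = a + - b" by transfer (auto simp: fun_eq_iff a_minus_def)
  show "a * b * c = a * (b * c)" by transfer (auto simp: fun_eq_iff ring.ring_simprules)
  show "(a + b) * c = a * c + b * c" by transfer (auto simp: fun_eq_iff ring.ring_simprules)
  show "a * (b + c) = a * b + a * c" by transfer (auto simp: fun_eq_iff ring.ring_simprules)
qed

end

lemma ring_zero_mult_zero: "Ring.ring S \<Longrightarrow> \<zero>\<^bsub>S\<^esub> \<otimes>\<^bsub>S\<^esub> \<zero>\<^bsub>S\<^esub> = \<zero>\<^bsub>S\<^esub>"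
proof -
  assume "Ring.ring S"
  then interpret S: Ring.ring S .
  show ?thesis by simp
qed

definition ring_embed :: "'a ring \<Rightarrow> 'a \<Rightarrow> 'a ringprod" where
  "ring_embed R x = Abs_ringprod (\<lambda>S. if S = R then x else if Ring.ring S then \<zero>\<^bsub>S\<^esub> else undefined)"

context
  fixes R :: "'a ring"
  assumes R: "Ring.ring R"
begin

interpretation R: Ring.ring R by (rule R)

lemma Rep_ring_embed: "x \<in> carrier R \<Longrightarrow> Rep_ringprod (ring_embed R x) = (\<lambda>S. if S = R then x else if Ring.ring S then \<zero>\<^bsub>S\<^esub> else undefined)"
  unfolding ring_embed_def by (rule Abs_ringprod_inverse) (auto simp: R intro: ring.ring_simprules)

lemma ring_embed_inject: "x \<in> carrier R \<Longrightarrow> y \<in> carrier R \<Longrightarrow> ring_embed R x = ring_embed R y \<longleftrightarrow> x = y"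
  using Rep_ring_embed[of x] Rep_ring_embed[of y] by metis

lemma ring_embed_add: "x \<in> carrier R \<Longrightarrow> y \<in> carrier R \<Longrightarrow> ring_embed R (x \<oplus>\<^bsub>R\<^esub> y) = ring_embed R x + ring_embed R y"
  by (simp add: Rep_ringprod_inject[symmetric] plus_ringprod.rep_eq Rep_ring_embed fun_eq_iff R ring.ring_simprules)

lemma ring_embed_mult: "x \<in> carrier R \<Longrightarrow> y \<in> carrier R \<Longrightarrow> ring_embed R (x \<otimes>\<^bsub>R\<^esub> y) = ring_embed R x * ring_embed R y"
  by (simp add: Rep_ringprod_inject[symmetric] times_ringprod.rep_eq Rep_ring_embed fun_eq_iff R ring_zero_mult_zero ring.ring_simprules)

lemma ring_embed_zero: "ring_embed R \<zero>\<^bsub>R\<^esub> = 0"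
  by (simp add: Rep_ringprod_inject[symmetric] zero_ringprod.rep_eq Rep_ring_embed fun_eq_iff R)

lemma ring_embed_finsum:
  "finite A \<Longrightarrow> F \<in> A \<rightarrow> carrier R \<Longrightarrow> ring_embed R (finsum R F A) = (\<Sum>x\<in>A. ring_embed R (F x))"
  by (induction A rule: finite_induct) (auto simp: ring_embed_zero ring_embed_add Pi_iff)

lemma foldr_mult_closed: "set xs \<subseteq> carrier R \<Longrightarrow> foldr (\<otimes>\<^bsub>R\<^esub>) xs \<one>\<^bsub>R\<^esub> \<in> carrier R"
  by (induction xs) auto

lemma ring_embed_foldr:
  "set xs \<subseteq> carrier R \<Longrightarrow> ring_embed R (foldr (\<otimes>\<^bsub>R\<^esub>) xs \<one>\<^bsub>R\<^esub>) = foldr (*) (map (ring_embed R) xs) (ring_embed R \<one>\<^bsub>R\<^esub>)"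
  by (induction xs) (auto simp: ring_embed_mult foldr_mult_closed)

end

section \<open>The algebra and its determinant\<close>

lemma free_ring_simps: "\<zero>\<^bsub>free_ring\<^esub> = 0" "x \<oplus>\<^bsub>free_ring\<^esub> y = x + y" "\<one>\<^bsub>free_ring\<^esub> = Poly_Mapping.single [] 1"
  by (auto simp: monoid_algebra_def free_monoid_def)

lemma free_ring_mult_single:
  "Poly_Mapping.single v a \<otimes>\<^bsub>free_ring\<^esub> Poly_Mapping.single w b = Poly_Mapping.single (v @ w) (a * b)"
  by (simp add: monoid_algebra_def free_monoid_def)

lemma FR_proj_closed [simp]: "FR_proj lq x \<in> carrier (FR lq)"
  using ring_hom_closed[OF FR_proj_hom, of x] by simp

definition fr_val :: "complex \<Rightarrow> ('n::{finite,linorder}) free_alg \<Rightarrow> 'n fr ringprod" where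
  "fr_val lq x = ring_embed (FR lq) (FR_proj lq x)"

lemma fr_val_add: "fr_val lq (x + y) = fr_val lq x + fr_val lq y"
  using ring_hom_add[OF FR_proj_hom, of x y lq] by (simp add: fr_val_def free_ring_simps ring_embed_add[OF FR_ring])

lemma fr_val_mult: "fr_val lq (x \<otimes>\<^bsub>free_ring\<^esub> y) = fr_val lq x * fr_val lq y"
  using ring_hom_mult[OF FR_proj_hom, of x y lq] by (simp add: fr_val_def ring_embed_mult[OF FR_ring])

lemma fr_val_zero: "fr_val lq 0 = 0"
  using fr_val_add[of lq 0 0] by simp

lemma fr_val_diff: "fr_val lq (x - y) = fr_val lq x - fr_val lq y"
  using fr_val_add[of lq "x - y" y] by simp

lemma fr_val_sum: "fr_val lq (sum F A) = (\<Sum>x\<in>A. fr_val lq (F x))"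
  by (induction A rule: infinite_finite_induct) (auto simp: fr_val_zero fr_val_add)

text \<open>Stated for words of at least two letters so that it terminates as a rewrite
  rule.\<close>

lemma fr_val_Cons: "fr_val lq (word (g # h # w)) = fr_val lq (word [g]) * fr_val lq (word (h # w))"
  unfolding fr_val_mult[symmetric] by (simp add: word_def free_ring_mult_single)

lemma FR_ideal_rels: "FR_rels lq \<subseteq> FR_ideal lq"
  unfolding FR_ideal_def by (rule ring.genideal_self[OF monoid_algebra_ring[OF free_monoid_monoid] FR_rels_carrier])

lemma FR_proj_ideal: "x \<in> FR_ideal lq \<Longrightarrow> FR_proj lq x = \<zero>\<^bsub>FR lq\<^esub>"
  unfolding FR_proj_def FR_def FactRing_def
  by (simp add: ring.a_rcos_zero[OF monoid_algebra_ring[OF free_monoid_monoid] FR_ideal_ideal])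

lemma fr_val_rel: "x - y \<in> FR_rels lq \<Longrightarrow> fr_val lq x = fr_val lq y"
  using fr_val_diff[of lq x y] FR_proj_ideal[of "x - y" lq] FR_ideal_rels[of lq]
  by (auto simp: fr_val_def ring_embed_zero[OF FR_ring])

abbreviation "fr_l lq f \<equiv> fr_val lq (word [Lam f])"
abbreviation "fr_r lq f \<equiv> fr_val lq (word [Mu f])"
abbreviation "fr_t lq i j \<equiv> fr_val lq (word [Tgen i j])"

lemma fr_dyn_ring:
  assumes "lq \<noteq> 0"
  shows "dyn_ring lq (fr_l lq) (fr_r lq) (fr_t lq :: 'n \<Rightarrow> 'n::{finite,linorder} \<Rightarrow> _)"
proof
  fix f g :: "'n mero" and i j a b c d :: 'n and z
  have "word [Lam (f + g)] - word [Lam f] - word [Lam g] \<in> {word [Lam (f + g)] - word [Lam f] - word [Lam g] | f g. True}"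
    by (rule CollectI, rule exI[of _ f], rule exI[of _ g]) simp
  then have "word [Lam (f + g)] - word [Lam f] - word [Lam g] \<in> FR_rels lq"
    unfolding FR_rels_def Un_iff by (simp only: simp_thms)
  then have "word [Lam (f + g)] - (word [Lam f] + word [Lam g]) \<in> FR_rels lq"
    by (simp only: diff_diff_add)
  from fr_val_rel[OF this] show "fr_l lq (f + g) = fr_l lq f + fr_l lq g" by (simp add: fr_val_add)
  have "word [Mu (f + g)] - word [Mu f] - word [Mu g] \<in> {word [Mu (f + g)] - word [Mu f] - word [Mu g] | f g. True}"
    by (rule CollectI, rule exI[of _ f], rule exI[of _ g]) simp
  then have "word [Mu (f + g)] - word [Mu f] - word [Mu g] \<in> FR_rels lq"
    unfolding FR_rels_def Un_iff by (simp only: simp_thms)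
  then have "word [Mu (f + g)] - (word [Mu f] + word [Mu g]) \<in> FR_rels lq"
    by (simp only: diff_diff_add)
  from fr_val_rel[OF this] show "fr_r lq (f + g) = fr_r lq f + fr_r lq g" by (simp add: fr_val_add)
  have "word [Lam (f * g)] - word [Lam f, Lam g] \<in> FR_rels lq" unfolding FR_rels_def by blast
  from fr_val_rel[OF this] show "fr_l lq (f * g) = fr_l lq f * fr_l lq g" by (simp add: fr_val_Cons)
  have "word [Mu (f * g)] - word [Mu f, Mu g] \<in> FR_rels lq" unfolding FR_rels_def by blast
  from fr_val_rel[OF this] show "fr_r lq (f * g) = fr_r lq f * fr_r lq g" by (simp add: fr_val_Cons)
  have 1: "word [Lam (const_mero z :: 'n mero)] - Poly_Mapping.single [] z \<in> FR_rels lq" for z unfolding FR_rels_def by blast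
  have 2: "word [Mu (const_mero z :: 'n mero)] - Poly_Mapping.single [] z \<in> FR_rels lq" for z unfolding FR_rels_def by blast
  show "fr_l lq (const_mero z :: 'n mero) = fr_r lq (const_mero z)" using fr_val_rel[OF 1] fr_val_rel[OF 2] by simp
  have "fr_l lq (1 :: 'n mero) = fr_val lq (Poly_Mapping.single [] 1)" using fr_val_rel[OF 1[of 1]] by simp
  then have "fr_l lq 1 * fr_t lq i j = fr_val lq (Poly_Mapping.single [] 1 \<otimes>\<^bsub>free_ring\<^esub> word [Tgen i j])"
    by (simp add: fr_val_mult)
  then show "fr_l lq 1 * fr_t lq i j = fr_t lq i j" by (simp add: word_def free_ring_mult_single)
  have "word [Lam f, Mu g] - word [Mu g, Lam f] \<in> FR_rels lq" unfolding FR_rels_def by blast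
  from fr_val_rel[OF this] show "fr_l lq f * fr_r lq g = fr_r lq g * fr_l lq f" by (simp add: fr_val_Cons)
  have "word [Lam f, Tgen i j] - word [Tgen i j, Lam (shift (omega i) f)] \<in> FR_rels lq" unfolding FR_rels_def by blast
  from fr_val_rel[OF this] show "fr_l lq f * fr_t lq i j = fr_t lq i j * fr_l lq (shift (omega i) f)" by (simp add: fr_val_Cons)
  have "word [Mu f, Tgen i j] - word [Tgen i j, Mu (shift (omega j) f)] \<in> FR_rels lq" unfolding FR_rels_def by blast
  from fr_val_rel[OF this] show "fr_r lq f * fr_t lq i j = fr_t lq i j * fr_r lq (shift (omega j) f)" by (simp add: fr_val_Cons)
  have "(\<Sum>x\<in>UNIV. \<Sum>y\<in>UNIV. word [Lam (R_entry lq x y a c), Tgen x b, Tgen y d])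
       - (\<Sum>x\<in>UNIV. \<Sum>y\<in>UNIV. word [Mu (R_entry lq b d x y), Tgen c y, Tgen a x]) \<in> FR_rels lq" unfolding FR_rels_def by blast
  from fr_val_rel[OF this]
  show "(\<Sum>x\<in>UNIV. \<Sum>y\<in>UNIV. fr_l lq (R_entry lq x y a c) * fr_t lq x b * fr_t lq y d) =
              (\<Sum>x\<in>UNIV. \<Sum>y\<in>UNIV. fr_r lq (R_entry lq b d x y) * fr_t lq c y * fr_t lq a x)"
    by (simp add: fr_val_sum fr_val_Cons mult.assoc)
qed (rule assms)

lemma ring_embed_gens:
  "ring_embed (FR lq) (mu_l lq f) = fr_l lq f" "ring_embed (FR lq) (mu_r lq f) = fr_r lq f" "ring_embed (FR lq) (t_gen lq i j) = fr_t lq i j"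
  by (simp_all add: fr_val_def mu_l_def mu_r_def t_gen_def)

lemma gens_closed [simp]: "mu_l lq f \<in> carrier (FR lq)" "mu_r lq f \<in> carrier (FR lq)" "t_gen lq i j \<in> carrier (FR lq)"
  by (simp_all add: mu_l_def mu_r_def t_gen_def)

lemma FR_proj_one: "FR_proj lq (Poly_Mapping.single [] 1) = \<one>\<^bsub>FR lq\<^esub>"
  using ring_hom_one[OF FR_proj_hom] by (metis free_ring_simps(3))

lemma ring_embed_one: "ring_embed (FR lq) \<one>\<^bsub>FR lq\<^esub> = fr_l lq (1 :: 'n::{finite,linorder} mero)"
proof -
  have 1: "word [Lam (const_mero 1 :: 'n mero)] - Poly_Mapping.single [] 1 \<in> FR_rels lq" unfolding FR_rels_def by blast
  from fr_val_rel[OF this] show ?thesis by (simp add: fr_val_def FR_proj_one)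
qed

lemma qminor_closed [simp]: "qminor lq I J \<in> carrier (FR lq)"
proof -
  interpret F: Ring.ring "FR lq :: 'a fr ring" by (rule FR_ring)
  show ?thesis unfolding qminor_def
    by (auto intro!: F.finsum_closed F.m_closed foldr_mult_closed[OF FR_ring])
qed

lemma ring_embed_qminor:
  fixes I J :: "'n::{finite,linorder} set"
  shows "ring_embed (FR lq) (qminor lq I J) =
     (if card I = card J then \<Sum>\<sigma>\<in>{\<sigma>. \<sigma> permutes {..<card J}}. fr_l lq (inv_factor lq \<sigma> I) *
        foldr (*) (map (\<lambda>k. fr_t lq (sorted_list_of_set I ! \<sigma> k) (sorted_list_of_set J ! k)) [0..<card J]) (fr_l lq 1)
      else 0)"
proof -
  interpret F: Ring.ring "FR lq :: 'n fr ring" by (rule FR_ring)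
  have c: "foldr (\<otimes>\<^bsub>FR lq\<^esub>) (map (\<lambda>k. t_gen lq (sorted_list_of_set I ! \<sigma> k) (sorted_list_of_set J ! k)) xs) \<one>\<^bsub>FR lq\<^esub> \<in> carrier (FR lq)"
    for \<sigma> xs by (rule foldr_mult_closed[OF FR_ring]) auto
  have e: "ring_embed (FR lq) (foldr (\<otimes>\<^bsub>FR lq\<^esub>) (map (\<lambda>k. t_gen lq (sorted_list_of_set I ! \<sigma> k) (sorted_list_of_set J ! k)) xs) \<one>\<^bsub>FR lq\<^esub>)
     = foldr (*) (map (\<lambda>k. fr_t lq (sorted_list_of_set I ! \<sigma> k) (sorted_list_of_set J ! k)) xs) (fr_l lq 1)" for \<sigma> xs
    by (subst ring_embed_foldr[OF FR_ring]) (auto simp: ring_embed_one ring_embed_gens o_def)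
  show ?thesis
    by (auto simp: qminor_def ring_embed_zero[OF FR_ring] c finite_permutations ring_embed_finsum[OF FR_ring] ring_embed_mult[OF FR_ring] e ring_embed_gens)
qed

text \<open>An inversion of \<open>c # cs\<close> either starts at position 0 or is an inversion of
  \<open>cs\<close> moved by one. This links the recursive coefficient with the product over
  inversions in \<open>inv_factor\<close>.\<close>

lemma word_coef_pairs:
  "distinct cs \<Longrightarrow> word_coef lq cs = (\<Prod>(k, m)\<in>{(k, m). k < m \<and> m < length cs \<and> cs ! m < cs ! k}. - h_diff lq (cs ! k) (cs ! m))"
proof (induction cs)
  case (Cons c cs)
  let ?P = "\<lambda>xs. {(k, m). k < m \<and> m < length xs \<and> xs ! m < xs ! k}"
  have fin: "finite (?P xs)" for xs :: "'a list"
    by (rule finite_subset[of _ "{..<length xs} \<times> {..<length xs}"]) auto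
  have split: "?P (c # cs) = (\<lambda>m. (0, Suc m)) ` {m. m < length cs \<and> cs ! m < c} \<union> (\<lambda>(k, m). (Suc k, Suc m)) ` ?P cs"
  proof (rule Set.set_eqI)
    fix p :: "nat \<times> nat"
    obtain k m where p: "p = (k, m)" by (cases p)
    show "p \<in> ?P (c # cs) \<longleftrightarrow> p \<in> (\<lambda>m. (0, Suc m)) ` {m. m < length cs \<and> cs ! m < c} \<union> (\<lambda>(k, m). (Suc k, Suc m)) ` ?P cs"
      unfolding p by (cases k; cases m) (auto simp: image_iff)
  qed
  have "inv_coef lq c (set cs) = (\<Prod>m\<in>{m. m < length cs \<and> cs ! m < c}. - h_diff lq c (cs ! m))"
    unfolding inv_coef_def
    by (rule prod.reindex_bij_betw[symmetric, of "\<lambda>m. cs ! m"])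
       (use Cons.prems in \<open>auto simp: bij_betw_def inj_on_def nth_eq_iff_index_eq image_iff in_set_conv_nth\<close>)
  moreover have "(\<Prod>(k, m)\<in>?P (c # cs). - h_diff lq ((c # cs) ! k) ((c # cs) ! m)) =
     (\<Prod>m\<in>{m. m < length cs \<and> cs ! m < c}. - h_diff lq c (cs ! m)) * (\<Prod>(k, m)\<in>?P cs. - h_diff lq (cs ! k) (cs ! m))"
    unfolding split
    by (subst prod.union_disjoint) (use fin[of cs] in \<open>auto simp: prod.reindex inj_on_def split_def\<close>)
  ultimately show ?case using Cons by simp
qed simp

section \<open>The determinant as a sum over permutations\<close>

context dyn_ring
begin

lemma word_act_foldr:
  "length cs = length ds \<Longrightarrow> word_act cs ds x = foldr (*) (map (\<lambda>k. t (cs ! k) (ds ! k)) [0..<length ds]) x"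
proof (induction cs ds rule: list_induct2)
  case (Cons c cs d ds)
  have "[0..<length (d # ds)] = 0 # map Suc [0..<length ds]" by (simp add: map_Suc_upt upt_conv_Cons del: upt_Suc)
  then show ?case using Cons by (simp add: o_def del: upt_Suc)
qed simp

lemma det_eq_sum_permutations:
  "det = (\<Sum>\<sigma>\<in>{\<sigma>. \<sigma> permutes {..<CARD('n)}}. l (inv_factor lq \<sigma> UNIV) *
        foldr (*) (map (\<lambda>k. t (sorted_list_of_set UNIV ! \<sigma> k) (sorted_list_of_set UNIV ! k)) [0..<CARD('n)]) (l 1))"
proof -
  define s where "s = sorted_list_of_set (UNIV :: 'n set)"
  define n where "n = CARD('n)"
  have s: "length s = n" "distinct s" "set s = UNIV" "sorted s" by (auto simp: s_def n_def)
  define \<phi> where "\<phi> = (\<lambda>\<sigma>. map (\<lambda>k. s ! \<sigma> k) [0..<n])"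
  have phi: "\<phi> \<sigma> = permute_list \<sigma> s" for \<sigma> by (simp add: \<phi>_def permute_list_def s)
  have lt: "\<sigma> k < n" if "\<sigma> permutes {..<n}" "k < n" for \<sigma> k using that permutes_in_image by fastforce
  have bij: "bij_betw \<phi> {\<sigma>. \<sigma> permutes {..<n}} (arrangements UNIV n)"
  proof (rule bij_betwI')
    fix \<sigma> \<tau> assume st: "\<sigma> \<in> {\<sigma>. \<sigma> permutes {..<n}}" "\<tau> \<in> {\<sigma>. \<sigma> permutes {..<n}}"
    show "\<phi> \<sigma> = \<phi> \<tau> \<longleftrightarrow> \<sigma> = \<tau>"
    proof
      assume e: "\<phi> \<sigma> = \<phi> \<tau>"
      have "\<sigma> k = \<tau> k" for k
      proof (cases "k < n")
        case True
        then have "s ! \<sigma> k = s ! \<tau> k" using arg_cong[OF e, of "\<lambda>xs. xs ! k"] by (simp add: \<phi>_def)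
        then show ?thesis using nth_eq_iff_index_eq[OF s(2)] lt st True s(1) by auto
      qed (use st in \<open>auto simp: permutes_def\<close>)
      then show "\<sigma> = \<tau>" by auto
    qed auto
  next
    fix \<sigma> assume "\<sigma> \<in> {\<sigma>. \<sigma> permutes {..<n}}"
    then show "\<phi> \<sigma> \<in> arrangements UNIV n" using s by (simp add: phi arrangements_def)
  next
    fix cs assume "cs \<in> arrangements (UNIV :: 'n set) n"
    then have "distinct cs" "set cs = UNIV" by (auto simp: arrangements_def)
    then have "mset cs = mset s" using s set_eq_iff_mset_eq_distinct[of cs s] by simp
    then obtain \<sigma> where "\<sigma> permutes {..<length s}" "permute_list \<sigma> s = cs" by (rule mset_eq_permutation)
    then show "\<exists>\<sigma>\<in>{\<sigma>. \<sigma> permutes {..<n}}. cs = \<phi> \<sigma>" using s by (auto simp: phi)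
  qed
  have "det = (\<Sum>cs\<in>arrangements UNIV n. l (word_coef lq cs) * word_act cs s (l 1))"
    by (simp add: det_def alt_sum_def s_def n_def)
  also have "\<dots> = (\<Sum>\<sigma>\<in>{\<sigma>. \<sigma> permutes {..<n}}. l (word_coef lq (\<phi> \<sigma>)) * word_act (\<phi> \<sigma>) s (l 1))"
    by (rule sum.reindex_bij_betw[OF bij, symmetric])
  also have "\<dots> = (\<Sum>\<sigma>\<in>{\<sigma>. \<sigma> permutes {..<n}}. l (inv_factor lq \<sigma> UNIV) *
        foldr (*) (map (\<lambda>k. t (s ! \<sigma> k) (s ! k)) [0..<n]) (l 1))"
  proof (rule sum.cong[OF refl])
    fix \<sigma> assume \<sigma>: "\<sigma> \<in> {\<sigma>. \<sigma> permutes {..<n}}"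
    then have "distinct (\<phi> \<sigma>)" using s by (simp add: phi)
    moreover have "{(k, m). k < m \<and> m < length (\<phi> \<sigma>) \<and> \<phi> \<sigma> ! m < \<phi> \<sigma> ! k} = {(k, m). k < m \<and> m < n \<and> \<sigma> m < \<sigma> k}"
    proof -
      \<comment> \<open>The list \<open>s\<close> is increasing, so comparing letters of the
        arrangement is comparing values of \<sigma>.\<close>
      have "s ! i < s ! j \<longleftrightarrow> i < j" if "i < n" "j < n" for i j
        using that s by (metis strict_sorted_iff sorted_wrt_nth_less not_less_iff_gr_or_eq)
      then show ?thesis using \<sigma> lt[of \<sigma>] by (auto simp: \<phi>_def)
    qed
    ultimately have "word_coef lq (\<phi> \<sigma>) = (\<Prod>(k, m)\<in>{(k, m). k < m \<and> m < n \<and> \<sigma> m < \<sigma> k}. - h_diff lq (\<phi> \<sigma> ! k) (\<phi> \<sigma> ! m))"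
      by (simp only: word_coef_pairs)
    also have "\<dots> = inv_factor lq \<sigma> UNIV"
      unfolding inv_factor_def n_def[symmetric] s_def[symmetric] by (rule prod.cong) (auto simp: \<phi>_def)
    finally have "word_coef lq (\<phi> \<sigma>) = inv_factor lq \<sigma> UNIV" .
    then show "l (word_coef lq (\<phi> \<sigma>)) * word_act (\<phi> \<sigma>) s (l 1) = l (inv_factor lq \<sigma> UNIV) *
        foldr (*) (map (\<lambda>k. t (s ! \<sigma> k) (s ! k)) [0..<n]) (l 1)"
    proof -
      have "map (\<lambda>k. t (\<phi> \<sigma> ! k) (s ! k)) [0..<n] = map (\<lambda>k. t (s ! \<sigma> k) (s ! k)) [0..<n]"
        by (simp add: \<phi>_def)
      moreover have "length (\<phi> \<sigma>) = length s" by (simp add: \<phi>_def s)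
      ultimately show ?thesis using \<open>word_coef lq (\<phi> \<sigma>) = inv_factor lq \<sigma> UNIV\<close>
        by (simp only: word_act_foldr s(1))
    qed
  qed
  finally show ?thesis by (simp add: s_def n_def)
qed

lemma l_word_act:
  "length cs = length ds \<Longrightarrow> l f * word_act cs ds x = word_act cs ds (l (shift (\<Sum>c\<leftarrow>cs. omega c) f) * x)"
proof (induction cs ds arbitrary: f rule: list_induct2)
  case (Cons c cs d ds)
  then show ?case by (simp add: l_t add.commute)
qed simp

lemma det_l:
  assumes "shift (\<chi> i. 1) f = f"
  shows "det * l f = l f * det"
proof -
  have "word_act cs ds (l 1) * l f = l f * word_act cs ds (l 1)"
    if "cs \<in> arrangements UNIV (CARD('n))" "length ds = CARD('n)" for cs ds
  proof -
    have cs: "distinct cs" "set cs = UNIV" "length cs = length ds" using that by (auto simp: arrangements_def)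
    then have "(\<Sum>c\<leftarrow>cs. omega c) = (\<Sum>c\<in>UNIV. omega c :: (complex, 'n) vec)"
      using sum_list_distinct_conv_sum_set[OF cs(1), of omega] by simp
    also have "\<dots> = (\<chi> i. 1)" by (simp add: vec_eq_iff)
    finally show ?thesis using l_word_act[OF cs(3), of f "l 1"] assms
      by (simp add: word_act_mult[symmetric]) (simp flip: ring_l_mult)
  qed
  then show ?thesis
    by (auto simp: det_def alt_sum_def sum_distrib_left sum_distrib_right mult.assoc intro!: sum.cong)
       (simp add: mult.assoc[symmetric] ring_l_mult[symmetric] mult.commute)
qed

end

lemma ring_embed_qdet:
  assumes "lq \<noteq> 0"
  shows "ring_embed (FR lq) (qdet lq) = dyn_ring.det lq (fr_l lq) (fr_t lq :: 'n \<Rightarrow> 'n::{finite,linorder} \<Rightarrow> _)"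
proof -
  interpret F: dyn_ring lq "fr_l lq" "fr_r lq" "fr_t lq :: 'n \<Rightarrow> 'n \<Rightarrow> _" by (rule fr_dyn_ring[OF assms])
  show ?thesis by (simp add: qdet_def ring_embed_qminor F.det_eq_sum_permutations)
qed

lemma qdet_commutes:
  fixes i j :: "'n::{finite,linorder}" and I J :: "'n set"
  assumes lq: "lq \<noteq> 0"
  shows "qdet lq \<otimes>\<^bsub>FR lq\<^esub> t_gen lq i j = t_gen lq i j \<otimes>\<^bsub>FR lq\<^esub> qdet lq"
    and "qdet lq \<otimes>\<^bsub>FR lq\<^esub> qminor lq I J = qminor lq I J \<otimes>\<^bsub>FR lq\<^esub> qdet lq"
proof -
  interpret F: dyn_ring lq "fr_l lq" "fr_r lq" "fr_t lq :: 'n \<Rightarrow> 'n \<Rightarrow> _" by (rule fr_dyn_ring[OF lq])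
  interpret R: Ring.ring "FR lq :: 'n fr ring" by (rule FR_ring)
  have q: "qdet lq \<in> carrier (FR lq)" by (simp add: qdet_def)
  have comm: "x \<otimes>\<^bsub>FR lq\<^esub> y = y \<otimes>\<^bsub>FR lq\<^esub> x"
    if "ring_embed (FR lq) x * ring_embed (FR lq) y = ring_embed (FR lq) y * ring_embed (FR lq) x" "x \<in> carrier (FR lq)" "y \<in> carrier (FR lq)" for x y :: "'n fr"
  proof -
    have "ring_embed (FR lq) (x \<otimes>\<^bsub>FR lq\<^esub> y) = ring_embed (FR lq) (y \<otimes>\<^bsub>FR lq\<^esub> x)"
      using that by (simp add: ring_embed_mult[OF FR_ring])
    then show ?thesis using that ring_embed_inject[OF FR_ring, of "x \<otimes>\<^bsub>FR lq\<^esub> y"] by simp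
  qed
  show "qdet lq \<otimes>\<^bsub>FR lq\<^esub> t_gen lq i j = t_gen lq i j \<otimes>\<^bsub>FR lq\<^esub> qdet lq"
    by (rule comm) (simp_all add: q ring_embed_qdet[OF lq] ring_embed_gens F.det_commute)
  have l: "F.det * fr_l lq (inv_factor lq \<sigma> I) = fr_l lq (inv_factor lq \<sigma> I) * F.det" for \<sigma> and I :: "'n set"
    by (rule F.det_l) (simp add: inv_factor_def shift_prod shift_uminus split_def,
       intro prod.cong refl arg_cong[where f = uminus] shift_h_diff, simp)
  have 1: "F.det * fr_l lq 1 = fr_l lq 1 * F.det" by (rule F.det_l) simp
  have f: "F.det * foldr (*) (map (\<lambda>k. fr_t lq (u k) (v k)) xs) (fr_l lq 1) = foldr (*) (map (\<lambda>k. fr_t lq (u k) (v k)) xs) (fr_l lq 1) * F.det"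
    for u v and xs :: "nat list"
    by (induction xs) (simp_all add: 1 mult.assoc[symmetric] F.det_commute, simp add: mult.assoc)
  have "F.det * (fr_l lq (inv_factor lq \<sigma> I) * foldr (*) (map (\<lambda>k. fr_t lq (u k) (v k)) xs) (fr_l lq 1))
     = (fr_l lq (inv_factor lq \<sigma> I) * foldr (*) (map (\<lambda>k. fr_t lq (u k) (v k)) xs) (fr_l lq 1)) * F.det" for \<sigma> and I :: "'n set" and u v and xs :: "nat list"
    by (simp only: mult.assoc[symmetric] l) (simp only: mult.assoc f)
  then show "qdet lq \<otimes>\<^bsub>FR lq\<^esub> qminor lq I J = qminor lq I J \<otimes>\<^bsub>FR lq\<^esub> qdet lq"
    by (intro comm) (simp_all add: q ring_embed_qdet[OF lq] ring_embed_qminor sum_distrib_left sum_distrib_right)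
qed

section \<open>Homomorphisms out of the algebra\<close>

lemma FR_carrier: "carrier (FR lq) = range (FR_proj lq)"
  unfolding FR_def FactRing_def A_RCOSETS_def' FR_proj_def by auto

lemma FR_proj_cases:
  assumes "X \<in> carrier (FR lq)" obtains x where "X = FR_proj lq x"
  using assms unfolding FR_carrier by auto

lemma FR_proj_hom_simps:
  "FR_proj lq (x + y) = FR_proj lq x \<oplus>\<^bsub>FR lq\<^esub> FR_proj lq y"
  "FR_proj lq (x \<otimes>\<^bsub>free_ring\<^esub> y) = FR_proj lq x \<otimes>\<^bsub>FR lq\<^esub> FR_proj lq y"
  using ring_hom_add[OF FR_proj_hom, of x y lq] ring_hom_mult[OF FR_proj_hom, of x y lq] by (simp_all add: free_ring_simps)

lemma fr_val_inject: "fr_val lq x = fr_val lq y \<longleftrightarrow> FR_proj lq x = FR_proj lq y"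
  by (simp add: fr_val_def ring_embed_inject[OF FR_ring])

lemma FR_proj_scalar: "FR_proj lq (Poly_Mapping.single [] c) = mu_l lq (const_mero c :: 'n::{finite,linorder} mero)"
proof -
  have "word [Lam (const_mero c :: 'n mero)] - Poly_Mapping.single [] c \<in> FR_rels lq" unfolding FR_rels_def by blast
  from fr_val_rel[OF this] show ?thesis by (simp add: fr_val_inject mu_l_def)
qed

text \<open>A word is a product of generators, and a complex scalar is \<open>mu_l\<close> of a
  constant function, so the values on generators determine the map.\<close>

lemma FR_hom_unique:
  fixes \<phi> \<psi> :: "'n::{finite,linorder} fr \<Rightarrow> 'b"
  assumes hom: "\<phi> \<in> ring_hom (FR lq) S" "\<psi> \<in> ring_hom (FR lq) S"
    and gens: "\<And>f. \<phi> (mu_l lq f) = \<psi> (mu_l lq f)" "\<And>f. \<phi> (mu_r lq f) = \<psi> (mu_r lq f)" "\<And>i j. \<phi> (t_gen lq i j) = \<psi> (t_gen lq i j)"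
    and X: "X \<in> carrier (FR lq)"
  shows "\<phi> X = \<psi> X"
proof -
  have words: "\<phi> (FR_proj lq (word w)) = \<psi> (FR_proj lq (word w))" for w
  proof (induction w)
    case Nil
    have "FR_proj lq (word [] :: 'n free_alg) = \<one>\<^bsub>FR lq\<^esub>" using FR_proj_one by (simp add: word_def)
    then show ?case using ring_hom_one[OF hom(1)] ring_hom_one[OF hom(2)] by simp
  next
    case (Cons g w)
    have "word (g # w) = word [g] \<otimes>\<^bsub>free_ring\<^esub> word w" by (simp add: word_def free_ring_mult_single)
    then have "FR_proj lq (word (g # w)) = FR_proj lq (word [g]) \<otimes>\<^bsub>FR lq\<^esub> FR_proj lq (word w)" by (simp only: FR_proj_hom_simps)
    moreover have "\<phi> (FR_proj lq (word [g])) = \<psi> (FR_proj lq (word [g]))"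
      by (cases g) (use gens in \<open>simp_all add: mu_l_def mu_r_def t_gen_def\<close>)
    ultimately show ?case using Cons ring_hom_mult[OF hom(1)] ring_hom_mult[OF hom(2)] by simp
  qed
  have single: "\<phi> (FR_proj lq (Poly_Mapping.single w c)) = \<psi> (FR_proj lq (Poly_Mapping.single w c))" for w c
  proof -
    have "Poly_Mapping.single w c = Poly_Mapping.single [] c \<otimes>\<^bsub>free_ring\<^esub> word w" by (simp add: word_def free_ring_mult_single)
    then have "FR_proj lq (Poly_Mapping.single w c) = mu_l lq (const_mero c) \<otimes>\<^bsub>FR lq\<^esub> FR_proj lq (word w)" by (simp only: FR_proj_hom_simps FR_proj_scalar)
    then show ?thesis using words gens ring_hom_mult[OF hom(1)] ring_hom_mult[OF hom(2)] by simp
  qed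
  have "\<phi> (FR_proj lq x) = \<psi> (FR_proj lq x)" for x
  proof (rule poly_mapping_carrier_induct[of x UNIV])
    show "\<phi> (FR_proj lq 0) = \<psi> (FR_proj lq 0)" using single[of "[]" 0] by simp
    show "\<phi> (FR_proj lq (a + b)) = \<psi> (FR_proj lq (a + b))"
      if "\<phi> (FR_proj lq a) = \<psi> (FR_proj lq a)" "\<phi> (FR_proj lq b) = \<psi> (FR_proj lq b)" for a b
      using that ring_hom_add[OF hom(1)] ring_hom_add[OF hom(2)] by (simp add: FR_proj_hom_simps)
  qed (use single in auto)
  then show ?thesis using FR_proj_cases[OF X] by metis
qed

section \<open>Evaluation of the free algebra at prescribed generators\<close>

context dyn_ring
begin

fun gen_val :: "'n gen \<Rightarrow> 'r" where
  "gen_val (Lam f) = l f"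
| "gen_val (Mu f) = r f"
| "gen_val (Tgen i j) = t i j"

definition word_val :: "'n gen list \<Rightarrow> 'r" where
  "word_val w = foldr (\<lambda>g x. gen_val g * x) w (l 1)"

text \<open>The target is only a ring, so complex scalars have to act through \<open>l\<close> of
  constant functions.\<close>

definition free_val :: "'n free_alg \<Rightarrow> 'r" where
  "free_val x = (\<Sum>w\<in>Poly_Mapping.keys x. l (const_mero (Poly_Mapping.lookup x w)) * word_val w)"

text \<open>Constants are invariant under every translation and hence commute with all generators;
  multiplicativity of \<open>free_val\<close> rests on this.\<close>

lemma gen_val_scalar: "gen_val g * l (const_mero c) = l (const_mero c) * gen_val g"
  by (cases g) (simp_all add: ring_l_r ring_l_t mult.commute flip: ring_l_mult)

lemma gen_val_one: "l 1 * gen_val g = gen_val g"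
  by (cases g) (simp_all add: ring_l_one ring_l_mult[symmetric], simp add: l_one_eq ring_r_mult[symmetric])

lemma word_val_one: "l 1 * word_val w = word_val w"
  by (cases w) (simp_all add: word_val_def gen_val_one one_one flip: mult.assoc)

lemma word_val_scalar: "word_val w * l (const_mero c) = l (const_mero c) * word_val w"
proof (induction w)
  case Nil
  then show ?case by (simp add: word_val_def mult.commute flip: ring_l_mult)
next
  case (Cons g w)
  have "gen_val g * (word_val w * l (const_mero c)) = gen_val g * l (const_mero c) * word_val w"
    by (simp add: Cons mult.assoc)
  then show ?case by (simp add: gen_val_scalar word_val_def mult.assoc)
qed

lemma word_val_append: "word_val (v @ w) = word_val v * word_val w"
proof (induction v)
  case Nil
  then show ?case using word_val_one[of w] by (simp add: word_val_def)
qed (simp add: word_val_def mult.assoc)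

lemma free_val_single: "free_val (Poly_Mapping.single w c) = l (const_mero c) * word_val w"
  by (simp add: free_val_def)

lemma free_val_word: "free_val (word w) = word_val w"
  by (simp add: word_def free_val_single word_val_one)

lemma free_val_add: "free_val (x + y) = free_val x + free_val y"
  unfolding free_val_def
  by (rule setsum_keys_plus_distrib[where f = "\<lambda>w c. l (const_mero c) * word_val w"])
     (auto simp: const_mero_add ring_l_add distrib_right)

lemma free_val_zero: "free_val 0 = 0"
  by (simp add: free_val_def)

lemma free_val_diff: "free_val (x - y) = free_val x - free_val y"
  using free_val_add[of "x - y" y] by simp

lemma free_val_sum: "free_val (sum F A) = (\<Sum>x\<in>A. free_val (F x))"
  by (induction A rule: infinite_finite_induct) (auto simp: free_val_zero free_val_add)

lemma free_val_mult: "free_val (x \<otimes>\<^bsub>free_ring\<^esub> y) = free_val x * free_val y"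
proof -
  interpret A: Ring.ring "free_ring :: 'n free_alg ring" by (rule monoid_algebra_ring[OF free_monoid_monoid])
  note A = A.l_distr[unfolded free_ring_simps] A.r_distr[unfolded free_ring_simps] A.l_null[unfolded free_ring_simps] A.r_null[unfolded free_ring_simps]
  show ?thesis
  proof (rule poly_mapping_carrier_induct[of x UNIV])
    fix v a
    show "free_val (Poly_Mapping.single v a \<otimes>\<^bsub>free_ring\<^esub> y) = free_val (Poly_Mapping.single v a) * free_val y"
    proof (rule poly_mapping_carrier_induct[of y UNIV])
      fix w b
      have "l (const_mero a) * word_val v * (l (const_mero b) * word_val w) = l (const_mero a) * (word_val v * l (const_mero b)) * word_val w"
        by (simp add: mult.assoc)
      also have "\<dots> = l (const_mero (a * b)) * word_val (v @ w)"
        by (simp add: word_val_scalar word_val_append const_mero_mult ring_l_mult mult.assoc)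
      finally show "free_val (Poly_Mapping.single v a \<otimes>\<^bsub>free_ring\<^esub> Poly_Mapping.single w b) =
         free_val (Poly_Mapping.single v a) * free_val (Poly_Mapping.single w b)"
        by (simp add: free_ring_mult_single free_val_single)
    qed (auto simp: A free_val_zero free_val_add distrib_left)
  qed (auto simp: A free_val_zero free_val_add distrib_right)
qed

lemma word_val_Cons: "word_val (g # h # w) = gen_val g * word_val (h # w)"
  by (simp add: word_val_def)

lemma word_val_gen: "word_val [g] = gen_val g"
  using gen_val_scalar[of g 1] gen_val_one[of g] by (simp add: word_val_def)

lemma free_val_rels: "x \<in> FR_rels lq \<Longrightarrow> free_val x = 0"
  unfolding FR_rels_def Un_iff
  by (elim disjE; clarify;
      simp only: free_val_diff free_val_word free_val_single free_val_sum word_val_Cons word_val_gen gen_val.simps;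
      simp add: ring_l_add ring_r_add ring_l_mult ring_r_mult ring_const ring_l_r ring_l_t ring_r_t word_val_def one_one
         RLL[unfolded mult.assoc])
   (simp_all flip: const_mero_1 ring_l_mult ring_r_mult const_mero_mult ring_const)

end

text \<open>All values of \<open>free_val\<close> lie in the embedded copy of S. Pulled back they
  give a ring homomorphism on the free algebra whose kernel contains the relations, and this
  descends to the quotient. The last clause records how to compute the result with type-class
  arithmetic.\<close>

lemma FR_hom_exists:
  fixes S :: "'b ring" and gl gr :: "'n::{finite,linorder} mero \<Rightarrow> 'b" and gt :: "'n \<Rightarrow> 'n \<Rightarrow> 'b"
  assumes S: "Ring.ring S"
    and D: "dyn_ring lq (\<lambda>f. ring_embed S (gl f)) (\<lambda>f. ring_embed S (gr f)) (\<lambda>i j. ring_embed S (gt i j))"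
    and closed: "\<And>f. gl f \<in> carrier S" "\<And>f. gr f \<in> carrier S" "\<And>i j. gt i j \<in> carrier S"
    and one: "gl 1 = \<one>\<^bsub>S\<^esub>"
  shows "\<exists>\<phi>\<in>ring_hom (FR lq) S. (\<forall>f. \<phi> (mu_l lq f) = gl f) \<and> (\<forall>f. \<phi> (mu_r lq f) = gr f) \<and> (\<forall>i j. \<phi> (t_gen lq i j) = gt i j) \<and>
     (\<forall>x. ring_embed S (\<phi> (FR_proj lq x)) = dyn_ring.free_val (\<lambda>f. ring_embed S (gl f)) (\<lambda>f. ring_embed S (gr f)) (\<lambda>i j. ring_embed S (gt i j)) x)"
proof -
  interpret D: dyn_ring lq "\<lambda>f. ring_embed S (gl f)" "\<lambda>f. ring_embed S (gr f)" "\<lambda>i j. ring_embed S (gt i j)" by (rule D)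
  interpret S: Ring.ring S by (rule S)
  interpret A: Ring.ring "free_ring :: 'n free_alg ring" by (rule monoid_algebra_ring[OF free_monoid_monoid])
  have gen: "\<exists>y\<in>carrier S. ring_embed S y = D.gen_val g" for g
    by (cases g) (use closed in auto)
  have word: "\<exists>y\<in>carrier S. ring_embed S y = D.word_val w" for w
  proof (induction w)
    case Nil
    then show ?case using closed(1)[of 1] by (auto simp: D.word_val_def)
  next
    case (Cons g w)
    then obtain y z where "y \<in> carrier S" "ring_embed S y = D.word_val w" "z \<in> carrier S" "ring_embed S z = D.gen_val g" using gen[of g] by auto
    then show ?case by (intro bexI[of _ "z \<otimes>\<^bsub>S\<^esub> y"]) (auto simp: ring_embed_mult[OF S] D.word_val_def)
  qed
  have ex: "\<exists>y\<in>carrier S. ring_embed S y = D.free_val x" for x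
  proof (rule poly_mapping_carrier_induct[of x UNIV])
    show "\<exists>y\<in>carrier S. ring_embed S y = D.free_val 0" by (intro bexI[of _ "\<zero>\<^bsub>S\<^esub>"]) (auto simp: ring_embed_zero[OF S] D.free_val_zero)
    fix w c
    obtain y where "y \<in> carrier S" "ring_embed S y = D.word_val w" using word by auto
    then show "\<exists>y\<in>carrier S. ring_embed S y = D.free_val (Poly_Mapping.single w c)"
      by (intro bexI[of _ "gl (const_mero c) \<otimes>\<^bsub>S\<^esub> y"]) (auto simp: ring_embed_mult[OF S] D.free_val_single closed)
  next
    fix a b assume "\<exists>y\<in>carrier S. ring_embed S y = D.free_val a" "\<exists>y\<in>carrier S. ring_embed S y = D.free_val b"
    then obtain y z where "y \<in> carrier S" "ring_embed S y = D.free_val a" "z \<in> carrier S" "ring_embed S z = D.free_val b" by auto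
    then show "\<exists>y\<in>carrier S. ring_embed S y = D.free_val (a + b)"
      by (intro bexI[of _ "y \<oplus>\<^bsub>S\<^esub> z"]) (auto simp: ring_embed_add[OF S] D.free_val_add)
  qed simp
  define u where "u = (\<lambda>x. SOME y. y \<in> carrier S \<and> ring_embed S y = D.free_val x)"
  have u: "u x \<in> carrier S" "ring_embed S (u x) = D.free_val x" for x
    using someI_ex[of "\<lambda>y. y \<in> carrier S \<and> ring_embed S y = D.free_val x"] ex[of x] by (auto simp: u_def)
  have u_eq: "u x = y" if "y \<in> carrier S" "ring_embed S y = D.free_val x" for x y
    using u[of x] that ring_embed_inject[OF S] by metis
  have hom: "u \<in> ring_hom free_ring S"
  proof (rule ring_hom_memI)
    show "u \<one>\<^bsub>free_ring\<^esub> = \<one>\<^bsub>S\<^esub>"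
      by (rule u_eq) (auto simp: free_ring_simps D.free_val_single D.word_val_def one[symmetric] D.one_one closed)
  qed (use u in \<open>auto intro!: u_eq simp: ring_embed_mult[OF S] ring_embed_add[OF S] D.free_val_mult D.free_val_add free_ring_simps\<close>)
  interpret U: ring_hom_ring free_ring S u
    by (rule ring_hom_ringI2[OF A.ring_axioms S hom])
  have "FR_rels lq \<subseteq> a_kernel free_ring S u"
    unfolding a_kernel_def' using D.free_val_rels by (auto intro!: u_eq simp: ring_embed_zero[OF S])
  then have ideal: "FR_ideal lq \<subseteq> a_kernel free_ring S u"
    unfolding FR_ideal_def by (rule A.genideal_minimal[OF U.kernel_is_ideal])
  have well: "u x = u y" if "FR_proj lq x = FR_proj lq y" for x y
  proof -
    have "x \<ominus>\<^bsub>free_ring\<^esub> y \<in> FR_ideal lq"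
      using that A.quotient_eq_iff_same_a_r_cos[OF FR_ideal_ideal, of x y lq] by (simp add: FR_proj_def)
    then have "u (x \<ominus>\<^bsub>free_ring\<^esub> y) = \<zero>\<^bsub>S\<^esub>" using ideal unfolding a_kernel_def' by blast
    then have "D.free_val (x \<ominus>\<^bsub>free_ring\<^esub> y) = 0" using u(2)[of "x \<ominus>\<^bsub>free_ring\<^esub> y"] by (simp add: ring_embed_zero[OF S])
    moreover have "(x \<ominus>\<^bsub>free_ring\<^esub> y) + y = x"
    proof -
      have "(x \<ominus>\<^bsub>free_ring\<^esub> y) \<oplus>\<^bsub>free_ring\<^esub> y = x"
        unfolding a_minus_def by (subst A.a_assoc) (simp_all only: A.l_neg A.r_zero A.a_inv_closed free_carrier UNIV_I)
      then show ?thesis by (simp only: free_ring_simps)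
    qed
    ultimately have "D.free_val x = D.free_val y" using D.free_val_add by (metis add.left_neutral)
    then show ?thesis using u_eq[of "u y" x] u by simp
  qed
  define \<phi> where "\<phi> = (\<lambda>X. u (SOME x. X = FR_proj lq x))"
  have phi: "\<phi> (FR_proj lq x) = u x" for x
    unfolding \<phi>_def by (rule well) (metis (mono_tags, lifting) someI_ex)
  have "\<phi> \<in> ring_hom (FR lq) S"
  proof (rule ring_hom_memI)
    fix X :: "'n fr" assume "X \<in> carrier (FR lq)"
    then show "\<phi> X \<in> carrier S" by (rule FR_proj_cases) (simp add: phi u)
  next
    fix X Y :: "'n fr" assume "X \<in> carrier (FR lq)" "Y \<in> carrier (FR lq)"
    then obtain x y where XY: "X = FR_proj lq x" "Y = FR_proj lq y" by (metis FR_proj_cases)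
    show "\<phi> (X \<otimes>\<^bsub>FR lq\<^esub> Y) = \<phi> X \<otimes>\<^bsub>S\<^esub> \<phi> Y" "\<phi> (X \<oplus>\<^bsub>FR lq\<^esub> Y) = \<phi> X \<oplus>\<^bsub>S\<^esub> \<phi> Y"
      unfolding XY FR_proj_hom_simps[symmetric] phi
      using U.hom_mult[of x y] U.hom_add[of x y] by (simp_all add: free_ring_simps)
  next
    show "\<phi> \<one>\<^bsub>FR lq\<^esub> = \<one>\<^bsub>S\<^esub>"
      unfolding FR_proj_one[symmetric] phi using U.hom_one by (simp add: free_ring_simps)
  qed
  moreover have "u (word [g]) = y" if "y \<in> carrier S" "ring_embed S y = D.gen_val g" for g y
    by (rule u_eq) (simp_all add: that D.free_val_word D.word_val_gen)
  then have "\<phi> (mu_l lq f) = gl f" "\<phi> (mu_r lq f) = gr f" "\<phi> (t_gen lq i j) = gt i j" for f i j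
    using closed by (simp_all add: mu_l_def mu_r_def t_gen_def phi)
  ultimately show ?thesis using phi u(2) by (intro bexI[of _ \<phi>]) auto
qed

lemma ring_hom_restrict:
  assumes "Ring.ring R" "\<phi> \<in> ring_hom R S"
  shows "restrict \<phi> (carrier R) \<in> ring_hom R S"
proof -
  interpret R: Ring.ring R by (rule assms)
  show ?thesis using assms(2) by (auto simp: ring_hom_def)
qed

text \<open>The statement has the shape of the definite descriptions that define
  \<open>comult\<close> and \<open>counit\<close>, so that these can be replaced by their
  characterizing properties.\<close>

lemma FR_hom_unique_exists:
  fixes S :: "'b ring" and gl gr :: "'n::{finite,linorder} mero \<Rightarrow> 'b" and gt :: "'n \<Rightarrow> 'n \<Rightarrow> 'b"
  assumes "Ring.ring S"
    and "dyn_ring lq (\<lambda>f. ring_embed S (gl f)) (\<lambda>f. ring_embed S (gr f)) (\<lambda>i j. ring_embed S (gt i j))"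
    and "\<And>f. gl f \<in> carrier S" "\<And>f. gr f \<in> carrier S" "\<And>i j. gt i j \<in> carrier S"
    and "gl 1 = \<one>\<^bsub>S\<^esub>"
  shows "\<exists>!\<phi>. \<phi> \<in> ring_hom (FR lq) S \<and> \<phi> \<in> extensional (carrier (FR lq)) \<and>
     (\<forall>i j. \<phi> (t_gen lq i j) = gt i j) \<and> (\<forall>f. \<phi> (mu_l lq f) = gl f) \<and> (\<forall>f. \<phi> (mu_r lq f) = gr f)"
proof -
  obtain \<phi> where \<phi>: "\<phi> \<in> ring_hom (FR lq) S" "\<And>f. \<phi> (mu_l lq f) = gl f" "\<And>f. \<phi> (mu_r lq f) = gr f" "\<And>i j. \<phi> (t_gen lq i j) = gt i j"
    using FR_hom_exists[OF assms] by blast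
  show ?thesis
  proof (rule ex1I[of _ "restrict \<phi> (carrier (FR lq))"])
    show "restrict \<phi> (carrier (FR lq)) \<in> ring_hom (FR lq) S \<and> restrict \<phi> (carrier (FR lq)) \<in> extensional (carrier (FR lq)) \<and>
     (\<forall>i j. restrict \<phi> (carrier (FR lq)) (t_gen lq i j) = gt i j) \<and> (\<forall>f. restrict \<phi> (carrier (FR lq)) (mu_l lq f) = gl f) \<and>
     (\<forall>f. restrict \<phi> (carrier (FR lq)) (mu_r lq f) = gr f)"
      using ring_hom_restrict[OF FR_ring \<phi>(1)] \<phi> by simp
    fix \<psi> assume \<psi>: "\<psi> \<in> ring_hom (FR lq) S \<and> \<psi> \<in> extensional (carrier (FR lq)) \<and>
     (\<forall>i j. \<psi> (t_gen lq i j) = gt i j) \<and> (\<forall>f. \<psi> (mu_l lq f) = gl f) \<and> (\<forall>f. \<psi> (mu_r lq f) = gr f)"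
    show "\<psi> = restrict \<phi> (carrier (FR lq))"
    proof (rule extensionalityI[of _ "carrier (FR lq)"])
      fix X :: "'n fr" assume "X \<in> carrier (FR lq)"
      then show "\<psi> X = restrict \<phi> (carrier (FR lq)) X"
        using FR_hom_unique[of \<psi> lq S \<phi> X] \<psi> \<phi> by simp
    qed (use \<psi> in auto)
  qed
qed

lemma mu_l_one: "mu_l lq 1 = (\<one>\<^bsub>FR lq\<^esub> :: 'n::{finite,linorder} fr)"
proof -
  have "mu_l lq (const_mero 1) = (\<one>\<^bsub>FR lq\<^esub> :: 'n fr)"
    by (simp only: FR_proj_scalar[symmetric] FR_proj_one)
  then show ?thesis by simp
qed

text \<open>By uniqueness every homomorphism with these values is the one given by evaluation, so
  its value on a class can be computed from any free-algebra representative.\<close>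

lemma FR_hom_eval:
  fixes S :: "'b ring" and gl gr :: "'n::{finite,linorder} mero \<Rightarrow> 'b" and gt :: "'n \<Rightarrow> 'n \<Rightarrow> 'b"
  assumes S: "Ring.ring S"
    and D: "dyn_ring lq (\<lambda>f. ring_embed S (gl f)) (\<lambda>f. ring_embed S (gr f)) (\<lambda>i j. ring_embed S (gt i j))"
    and \<phi>: "\<phi> \<in> ring_hom (FR lq) S" "\<And>f. \<phi> (mu_l lq f) = gl f" "\<And>f. \<phi> (mu_r lq f) = gr f" "\<And>i j. \<phi> (t_gen lq i j) = gt i j"
  shows "ring_embed S (\<phi> (FR_proj lq x)) = dyn_ring.free_val (\<lambda>f. ring_embed S (gl f)) (\<lambda>f. ring_embed S (gr f)) (\<lambda>i j. ring_embed S (gt i j)) x"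
proof -
  have closed: "gl f \<in> carrier S" "gr f \<in> carrier S" "gt i j \<in> carrier S" for f i j
    using ring_hom_closed[OF \<phi>(1)] gens_closed unfolding \<phi>(2-4)[symmetric] by blast+
  have one: "gl 1 = \<one>\<^bsub>S\<^esub>"
    using ring_hom_one[OF \<phi>(1)] \<phi>(2)[of 1] by (simp add: mu_l_one)
  obtain \<psi> where \<psi>: "\<psi> \<in> ring_hom (FR lq) S" "\<And>f. \<psi> (mu_l lq f) = gl f" "\<And>f. \<psi> (mu_r lq f) = gr f" "\<And>i j. \<psi> (t_gen lq i j) = gt i j"
    "\<And>x. ring_embed S (\<psi> (FR_proj lq x)) = dyn_ring.free_val (\<lambda>f. ring_embed S (gl f)) (\<lambda>f. ring_embed S (gr f)) (\<lambda>i j. ring_embed S (gt i j)) x"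
    using FR_hom_exists[OF S D closed one] by blast
  have "\<phi> (FR_proj lq x) = \<psi> (FR_proj lq x)"
    by (rule FR_hom_unique[OF \<phi>(1) \<psi>(1)]) (simp_all add: \<phi> \<psi>)
  then show ?thesis by (simp add: \<psi>)
qed

text \<open>A representative of the alternating sum in the free algebra. It can be evaluated under
  any homomorphism, and its bidegree can be read off from its words.\<close>

definition alt_free :: "complex \<Rightarrow> 'n list \<Rightarrow> 'n::{finite,linorder} free_alg" where
  "alt_free lq ds = (\<Sum>cs\<in>arrangements UNIV (length ds). word (Lam (word_coef lq cs) # map2 Tgen cs ds))"

lemma (in dyn_ring) word_val_map2: "length cs = length ds \<Longrightarrow> word_val (map2 Tgen cs ds) = word_act cs ds (l 1)"
  by (induction cs ds rule: list_induct2) (auto simp: word_val_def)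

lemma (in dyn_ring) free_val_alt_free: "free_val (alt_free lq ds) = alt_sum ds (l 1)"
proof -
  have "word_val (Lam (word_coef lq cs) # map2 Tgen cs ds) = l (word_coef lq cs) * word_act cs ds (l 1)"
    if "cs \<in> arrangements UNIV (length ds)" for cs
    using that word_val_append[of "[Lam (word_coef lq cs)]" "map2 Tgen cs ds"]
    by (simp add: word_val_gen word_val_map2 arrangements_def)
  then show ?thesis by (simp add: alt_free_def alt_sum_def free_val_sum free_val_word)
qed

lemma fr_val_eq_free_val:
  assumes "lq \<noteq> 0"
  shows "fr_val lq x = dyn_ring.free_val (fr_l lq) (fr_r lq) (fr_t lq) x"
proof -
  have "ring_embed (FR lq) (id (FR_proj lq x)) = dyn_ring.free_val (\<lambda>f. ring_embed (FR lq) (mu_l lq f)) (\<lambda>f. ring_embed (FR lq) (mu_r lq f))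
     (\<lambda>i j. ring_embed (FR lq) (t_gen lq i j)) x"
    by (rule FR_hom_eval) (auto simp: FR_ring ring_embed_gens fr_dyn_ring assms intro: ring_hom_memI)
  then show ?thesis by (simp add: ring_embed_gens fr_val_def)
qed

lemma qdet_eq_alt_free:
  assumes "lq \<noteq> 0"
  shows "qdet lq = FR_proj lq (alt_free lq (sorted_list_of_set (UNIV :: 'n::{finite,linorder} set)))"
proof -
  interpret F: dyn_ring lq "fr_l lq" "fr_r lq" "fr_t lq :: 'n \<Rightarrow> 'n \<Rightarrow> _" by (rule fr_dyn_ring[OF assms])
  have "ring_embed (FR lq) (qdet lq) = fr_val lq (alt_free lq (sorted_list_of_set (UNIV :: 'n set)))"
    using fr_val_eq_free_val[OF assms, of "alt_free lq (sorted_list_of_set (UNIV :: 'n set))"]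
    by (simp only: ring_embed_qdet[OF assms] F.free_val_alt_free F.det_def)
  moreover have "qdet lq \<in> carrier (FR lq :: 'n fr ring)" by (simp add: qdet_def)
  ultimately show ?thesis by (simp only: fr_val_def ring_embed_inject[OF FR_ring] FR_proj_closed)
qed

section \<open>The counit\<close>

text \<open>The carrier is described with one coefficient per translation. Sums and products lead to
  families in which translations repeat, so the terms are regrouped.\<close>

lemma diff_opsI:
  fixes b :: "'i \<Rightarrow> (complex, 'n::finite) vec"
  assumes "finite A" "D = (\<lambda>\<phi>. \<Sum>i\<in>A. f i * shift (b i) \<phi>)"
  shows "D \<in> carrier diff_ops"
proof -
  have "D = (\<lambda>\<phi>. \<Sum>\<beta>\<in>b ` A. (\<Sum>i\<in>{i\<in>A. b i = \<beta>}. f i) * shift \<beta> \<phi>)"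
  proof
    fix \<phi>
    have "D \<phi> = (\<Sum>\<beta>\<in>b ` A. \<Sum>i\<in>{i\<in>A. b i = \<beta>}. f i * shift (b i) \<phi>)"
      unfolding assms(2) by (rule sum.group[symmetric]) (use assms in auto)
    also have "\<dots> = (\<Sum>\<beta>\<in>b ` A. (\<Sum>i\<in>{i\<in>A. b i = \<beta>}. f i) * shift \<beta> \<phi>)"
      by (auto simp: sum_distrib_right intro!: sum.cong)
    finally show "D \<phi> = \<dots>" .
  qed
  then show ?thesis using assms(1) unfolding diff_ops_def by auto
qed

lemma diff_opsE:
  fixes D :: "'n::finite mero \<Rightarrow> 'n mero"
  assumes "D \<in> carrier diff_ops"
  obtains B and f :: "(complex, 'n) vec \<Rightarrow> 'n mero" where "finite B" "D = (\<lambda>\<phi>. \<Sum>\<beta>\<in>B. f \<beta> * shift \<beta> \<phi>)"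
  using assms unfolding diff_ops_def by auto

lemma diff_ops_additive: "D \<in> carrier diff_ops \<Longrightarrow> D (\<phi> + \<psi>) = D \<phi> + D \<psi>"
  by (erule diff_opsE) (simp add: shift_add distrib_left sum.distrib)

lemma diff_ops_simps:
  "D \<otimes>\<^bsub>diff_ops\<^esub> E = D \<circ> E" "\<one>\<^bsub>diff_ops\<^esub> = id" "\<zero>\<^bsub>diff_ops\<^esub> = (\<lambda>_. 0)" "D \<oplus>\<^bsub>diff_ops\<^esub> E = (\<lambda>\<phi>. D \<phi> + E \<phi>)"
  by (simp_all add: diff_ops_def)

lemma diff_ops_mem:
  "(\<lambda>\<phi>. f * \<phi>) \<in> carrier diff_ops" "shift \<alpha> \<in> carrier diff_ops" "(\<lambda>_. 0) \<in> carrier diff_ops" "id \<in> carrier diff_ops" "(\<lambda>\<phi>. \<phi>) \<in> carrier diff_ops"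
proof -
  show "(\<lambda>\<phi>. \<phi>) \<in> carrier diff_ops" by (rule diff_opsI[of "{0}" _ "\<lambda>_. 1" "\<lambda>\<beta>. \<beta>"]) auto
  show "(\<lambda>\<phi>. f * \<phi>) \<in> carrier diff_ops" by (rule diff_opsI[of "{0}" _ "\<lambda>_. f" "\<lambda>\<beta>. \<beta>"]) auto
  show "shift \<alpha> \<in> carrier diff_ops" by (rule diff_opsI[of "{\<alpha>}" _ "\<lambda>_. 1" "\<lambda>\<beta>. \<beta>"]) auto
  show "(\<lambda>_. 0) \<in> carrier diff_ops" by (rule diff_opsI[of "{}" _ "\<lambda>_. 1" "\<lambda>\<beta>. \<beta>"]) auto
  show "id \<in> carrier diff_ops" by (rule diff_opsI[of "{0}" _ "\<lambda>_. 1" "\<lambda>\<beta>. \<beta>"]) auto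
qed

lemma diff_ops_ring: "Ring.ring (diff_ops :: ('n::finite mero \<Rightarrow> 'n mero) ring)"
proof (rule ringI)
  show "abelian_group (diff_ops :: ('n mero \<Rightarrow> 'n mero) ring)"
  proof (rule abelian_groupI)
    fix D E :: "'n mero \<Rightarrow> 'n mero" assume DE: "D \<in> carrier diff_ops" "E \<in> carrier diff_ops"
    obtain A f where D: "finite A" "D = (\<lambda>\<phi>. \<Sum>\<beta>\<in>A. f \<beta> * shift \<beta> \<phi>)" using DE(1) by (rule diff_opsE)
    obtain B g where E: "finite B" "E = (\<lambda>\<phi>. \<Sum>\<beta>\<in>B. g \<beta> * shift \<beta> \<phi>)" using DE(2) by (rule diff_opsE)
    have "(\<lambda>\<phi>. D \<phi> + E \<phi>) = (\<lambda>\<phi>. \<Sum>i\<in>A <+> B. (case i of Inl \<beta> \<Rightarrow> f \<beta> | Inr \<beta> \<Rightarrow> g \<beta>) * shift (case i of Inl \<beta> \<Rightarrow> \<beta> | Inr \<beta> \<Rightarrow> \<beta>) \<phi>)"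
      using D E by (simp add: sum.Plus o_def)
    then show "D \<oplus>\<^bsub>diff_ops\<^esub> E \<in> carrier diff_ops"
      unfolding diff_ops_simps by (rule diff_opsI[rotated]) (use D E in auto)
  next
    fix D :: "'n mero \<Rightarrow> 'n mero" assume "D \<in> carrier diff_ops"
    then obtain A f where D: "finite A" "D = (\<lambda>\<phi>. \<Sum>\<beta>\<in>A. f \<beta> * shift \<beta> \<phi>)" by (rule diff_opsE)
    have "(\<lambda>\<phi>. - D \<phi>) \<in> carrier diff_ops"
      by (rule diff_opsI[OF D(1), of _ "\<lambda>\<beta>. - f \<beta>" "\<lambda>\<beta>. \<beta>"]) (simp add: D sum_negf)
    then show "\<exists>E\<in>carrier diff_ops. E \<oplus>\<^bsub>diff_ops\<^esub> D = \<zero>\<^bsub>diff_ops\<^esub>"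
      by (rule bexI[rotated]) (simp add: diff_ops_simps)
  qed (auto simp: diff_ops_simps diff_ops_mem algebra_simps)
  show "Group.monoid (diff_ops :: ('n mero \<Rightarrow> 'n mero) ring)"
  proof (rule Group.monoidI)
    fix D E :: "'n mero \<Rightarrow> 'n mero" assume DE: "D \<in> carrier diff_ops" "E \<in> carrier diff_ops"
    obtain A f where D: "finite A" "D = (\<lambda>\<phi>. \<Sum>\<beta>\<in>A. f \<beta> * shift \<beta> \<phi>)" using DE(1) by (rule diff_opsE)
    obtain B g where E: "finite B" "E = (\<lambda>\<phi>. \<Sum>\<beta>\<in>B. g \<beta> * shift \<beta> \<phi>)" using DE(2) by (rule diff_opsE)
    have "D \<circ> E = (\<lambda>\<phi>. \<Sum>(\<alpha>, \<beta>)\<in>A \<times> B. (f \<alpha> * shift \<alpha> (g \<beta>)) * shift (\<alpha> + \<beta>) \<phi>)"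
      by (simp add: D(2) E(2) fun_eq_iff shift_sum shift_mult sum_distrib_left mult.assoc sum.cartesian_product[symmetric])
    then have "D \<circ> E = (\<lambda>\<phi>. \<Sum>i\<in>A \<times> B. (f (fst i) * shift (fst i) (g (snd i))) * shift (fst i + snd i) \<phi>)"
      by (simp add: split_def)
    then show "D \<otimes>\<^bsub>diff_ops\<^esub> E \<in> carrier diff_ops"
      unfolding diff_ops_simps by (rule diff_opsI[rotated]) (use D E in auto)
  qed (auto simp: diff_ops_simps diff_ops_mem)
qed (auto simp: diff_ops_simps diff_ops_additive)

text \<open>For diagonal generators RLL reads R^{bd}_{ac} \<tau>_b \<tau>_d = R^{bd}_{ac} \<tau>_c
  \<tau>_a. A nonzero entry forces (b, d) to be (a, c) or (c, a), and the \<tau>'s commute.\<close>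

lemma dyn_ring_diagonal:
  fixes l :: "'n::{finite,linorder} mero \<Rightarrow> 'r::ring" and \<tau> :: "'n \<Rightarrow> 'r"
  assumes lq: "lq \<noteq> 0"
    and add: "\<And>f g. l (f + g) = l f + l g" and mult: "\<And>f g. l (f * g) = l f * l g"
    and one: "\<And>i. l 1 * \<tau> i = \<tau> i"
    and l_\<tau>: "\<And>f i. l f * \<tau> i = \<tau> i * l (shift (omega i) f)"
    and comm: "\<And>i j. \<tau> i * \<tau> j = \<tau> j * \<tau> i"
  shows "dyn_ring lq l l (\<lambda>i j. if i = j then \<tau> i else 0)"
proof
  fix a b c d
  let ?t = "\<lambda>i j. if i = j then \<tau> i else 0"
  have l0: "l 0 = 0" using add[of 0 0] by simp
  have "\<tau> j * l 1 = \<tau> j" for j using l_\<tau>[of 1 j] one[of j] by simp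
  then show "l 1 * ?t i j = ?t i j" for i j using one by auto
  show "(\<Sum>x\<in>UNIV. \<Sum>y\<in>UNIV. l (R_entry lq x y a c) * ?t x b * ?t y d) =
              (\<Sum>x\<in>UNIV. \<Sum>y\<in>UNIV. l (R_entry lq b d x y) * ?t c y * ?t a x)"
    using sum_R_entry_upper[of "\<lambda>x y f. l f * ?t x b * ?t y d" lq a c] sum_R_entry_lower[of "\<lambda>x y f. l f * ?t c y * ?t a x" lq b d]
    by (auto simp: l0 comm mult.assoc)
qed (auto simp: assms mult.commute simp flip: mult)

lemma counit_dyn_ring:
  assumes "lq \<noteq> 0"
  shows "dyn_ring lq (\<lambda>f. ring_embed diff_ops (\<lambda>\<phi>. f * \<phi>)) (\<lambda>f. ring_embed diff_ops (\<lambda>\<phi>. f * \<phi>))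
     (\<lambda>i j :: 'n::{finite,linorder}. ring_embed diff_ops (if i = j then shift (- omega i) else (\<lambda>_. 0)))"
proof -
  note e = ring_embed_mult[OF diff_ops_ring, symmetric] ring_embed_add[OF diff_ops_ring, symmetric] diff_ops_mem diff_ops_simps
  have "dyn_ring lq (\<lambda>f. ring_embed diff_ops (\<lambda>\<phi>. f * \<phi>)) (\<lambda>f. ring_embed diff_ops (\<lambda>\<phi>. f * \<phi>))
     (\<lambda>i j :: 'n. if i = j then ring_embed diff_ops (shift (- omega i)) else 0)"
    by (rule dyn_ring_diagonal[OF assms]) (simp_all add: e o_def shift_mult distrib_right mult.assoc add.commute)
  moreover have "ring_embed diff_ops (\<lambda>_. 0) = (0 :: ('n mero \<Rightarrow> 'n mero) ringprod)"
    using ring_embed_zero[OF diff_ops_ring] by (simp add: diff_ops_simps)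
  ultimately show ?thesis by (simp add: if_distrib[where f = "ring_embed diff_ops"] cong: if_cong)
qed

lemma counit_qdet:
  assumes lq: "lq \<noteq> 0"
  shows "counit lq (qdet lq :: 'n::{finite,linorder} fr) = shift (- (\<chi> i. 1))"
proof -
  let ?S = "diff_ops :: ('n mero \<Rightarrow> 'n mero) ring"
  interpret D: dyn_ring lq "\<lambda>f. ring_embed ?S (\<lambda>\<phi>. f * \<phi>)" "\<lambda>f. ring_embed ?S (\<lambda>\<phi>. f * \<phi>)"
     "\<lambda>i j :: 'n. ring_embed ?S (if i = j then shift (- omega i) else (\<lambda>_. 0))" by (rule counit_dyn_ring[OF lq])
  have "\<exists>!\<epsilon>. \<epsilon> \<in> ring_hom (FR lq) ?S \<and> \<epsilon> \<in> extensional (carrier (FR lq)) \<and>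
     (\<forall>i j :: 'n. \<epsilon> (t_gen lq i j) = (if i = j then shift (- omega i) else (\<lambda>_. 0))) \<and>
     (\<forall>f. \<epsilon> (mu_l lq f) = (\<lambda>\<phi>. f * \<phi>)) \<and> (\<forall>f. \<epsilon> (mu_r lq f) = (\<lambda>\<phi>. f * \<phi>))"
    by (rule FR_hom_unique_exists[OF diff_ops_ring counit_dyn_ring[OF lq]]) (simp_all add: diff_ops_mem diff_ops_simps id_def)
  from theI'[OF this] have eps: "counit lq \<in> ring_hom (FR lq) ?S" "\<And>f :: 'n mero. counit lq (mu_l lq f) = (\<lambda>\<phi>. f * \<phi>)"
     "\<And>f :: 'n mero. counit lq (mu_r lq f) = (\<lambda>\<phi>. f * \<phi>)"
     "\<And>i j :: 'n. counit lq (t_gen lq i j) = (if i = j then shift (- omega i) else (\<lambda>_. 0))"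
    unfolding counit_def[symmetric] by blast+
  let ?s = "sorted_list_of_set (UNIV :: 'n set)"
  have z: "ring_embed ?S (\<lambda>_. 0) = 0"
    unfolding diff_ops_simps(3)[symmetric] by (rule ring_embed_zero[OF diff_ops_ring])
  \<comment> \<open>Off-diagonal generators act as 0, so only the increasing arrangement contributes
    to the determinant, and its coefficient is 1.\<close>
  have off: "D.word_act cs ds x = 0" if "length cs = length ds" "cs \<noteq> ds" for cs ds x
    using that by (induction cs ds rule: list_induct2) (auto simp: z)
  have diag: "D.word_act cs cs (ring_embed ?S (\<lambda>\<phi>. 1 * \<phi>)) = ring_embed ?S (shift (- (\<Sum>c\<leftarrow>cs. omega c)))" for cs
  proof (induction cs)
    case Nil
    have "shift 0 = (\<lambda>\<phi>. \<phi> :: 'n mero)" by auto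
    then show ?case by simp
  next
    case (Cons c cs)
    have "shift (- omega c) \<circ> shift (- (\<Sum>c\<leftarrow>cs. omega c)) = (shift (- (\<Sum>c\<leftarrow>c # cs. omega c)) :: 'n mero \<Rightarrow> _)" by auto
    moreover have "ring_embed ?S (shift \<alpha>) * ring_embed ?S (shift \<beta>) = ring_embed ?S (shift \<alpha> \<circ> shift \<beta>)" for \<alpha> \<beta>
      by (simp add: ring_embed_mult[OF diff_ops_ring, symmetric] diff_ops_mem diff_ops_simps)
    ultimately show ?case using Cons by simp
  qed
  have "ring_embed ?S (counit lq (qdet lq)) = D.alt_sum ?s (ring_embed ?S (\<lambda>\<phi>. 1 * \<phi>))"
    unfolding qdet_eq_alt_free[OF lq] by (subst FR_hom_eval[OF diff_ops_ring counit_dyn_ring[OF lq] eps]) (rule D.free_val_alt_free)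
  also have "\<dots> = (\<Sum>cs\<in>{?s}. ring_embed ?S (\<lambda>\<phi>. word_coef lq cs * \<phi>) * D.word_act cs ?s (ring_embed ?S (\<lambda>\<phi>. 1 * \<phi>)))"
    unfolding D.alt_sum_def
    by (rule sum.mono_neutral_right[OF finite_arrangements]) (auto simp: arrangements_def off)
  also have "\<dots> = ring_embed ?S (\<lambda>\<phi>. 1 * \<phi>) * ring_embed ?S (shift (- (\<Sum>c\<leftarrow>?s. omega c)))"
    by (simp add: diag[simplified] word_coef_sorted)
  also have "(\<Sum>c\<leftarrow>?s. omega c) = (\<chi> i. 1)"
    using sum_list_distinct_conv_sum_set[of ?s "omega :: 'n \<Rightarrow> _"] by (simp add: vec_eq_iff)
  also have "ring_embed ?S (\<lambda>\<phi>. 1 * \<phi>) * ring_embed ?S (shift (- (\<chi> i. 1))) = ring_embed ?S (shift (- (\<chi> i. 1)))"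
    by (simp add: ring_embed_mult[OF diff_ops_ring, symmetric] diff_ops_mem diff_ops_simps o_def)
  finally show ?thesis
    using ring_embed_inject[OF diff_ops_ring] ring_hom_closed[OF eps(1)] diff_ops_mem(2) by (metis qminor_closed qdet_def)
qed

section \<open>The comultiplication\<close>

text \<open>Degrees are tracked on representatives, where they are visible word by word; bilinearity
  of the tensor product is available only within fixed degrees.\<close>

definition homogeneous :: "(complex, 'n) vec \<Rightarrow> (complex, 'n) vec \<Rightarrow> 'n::{finite,linorder} free_alg \<Rightarrow> bool" where
  "homogeneous \<alpha> \<beta> x \<longleftrightarrow> (\<forall>w\<in>Poly_Mapping.keys x. word_deg w = (\<alpha>, \<beta>))"

lemma homogeneous_zero: "homogeneous \<alpha> \<beta> 0"
  by (simp add: homogeneous_def)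

lemma homogeneous_add: "homogeneous \<alpha> \<beta> x \<Longrightarrow> homogeneous \<alpha> \<beta> y \<Longrightarrow> homogeneous \<alpha> \<beta> (x + y)"
  using Poly_Mapping.keys_add[of x y] by (auto simp: homogeneous_def)

lemma homogeneous_sum: "(\<And>i. i \<in> A \<Longrightarrow> homogeneous \<alpha> \<beta> (F i)) \<Longrightarrow> homogeneous \<alpha> \<beta> (sum F A)"
  by (induction A rule: infinite_finite_induct) (auto simp: homogeneous_zero homogeneous_add)

lemma homogeneous_word: "homogeneous \<alpha> \<beta> (word w) \<longleftrightarrow> word_deg w = (\<alpha>, \<beta>)"
  by (simp add: homogeneous_def word_def)

lemma word_deg_simps: "word_deg [] = (0, 0)" "word_deg (g # w) = gen_deg g + word_deg w"
  by (simp_all add: word_deg_def zero_prod_def)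

lemma homogeneous_FR_comp: "homogeneous \<alpha> \<beta> x \<Longrightarrow> FR_proj lq x \<in> FR_comp lq \<alpha> \<beta>"
  unfolding FR_comp_def homogeneous_def by blast

lemma word_mult: "word v \<otimes>\<^bsub>free_ring\<^esub> word w = word (v @ w)"
  by (simp add: word_def free_ring_mult_single)

section \<open>Pure tensors and bilinearity in fixed degrees\<close>

lemma monoid_algebra_mult_single:
  "Poly_Mapping.single p c \<otimes>\<^bsub>monoid_algebra M\<^esub> Poly_Mapping.single r d = Poly_Mapping.single (p \<otimes>\<^bsub>M\<^esub> r) (c * d)"
  by (simp add: monoid_algebra_def)

abbreviation pair_ring :: "complex \<Rightarrow> (('n::{finite,linorder} fr \<times> 'n fr) \<Rightarrow>\<^sub>0 complex) ring" where
  "pair_ring lq \<equiv> monoid_algebra (tens_pairs lq)"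

lemma pair_ring_ring: "Ring.ring (pair_ring lq)"
  by (rule monoid_algebra_ring[OF tens_pairs_monoid])

lemma tens_ideal_ideal: "ideal (tens_ideal lq) (pair_ring lq)"
  unfolding tens_ideal_def by (rule ring.genideal_ideal[OF pair_ring_ring tens_rels_carrier])

definition tens_proj where "tens_proj lq x = tens_ideal lq +>\<^bsub>pair_ring lq\<^esub> x"

lemma tens_proj_hom: "tens_proj lq \<in> ring_hom (pair_ring lq) (FR_tensor lq)"
  using ideal.rcos_ring_hom[OF tens_ideal_ideal] unfolding FR_tensor_def tens_proj_def[abs_def] .

lemma pair_carrier: "a \<in> FR_comp lq \<alpha> \<gamma> \<Longrightarrow> b \<in> FR_comp lq \<gamma> \<beta> \<Longrightarrow> pair_elem c a b \<in> carrier (pair_ring lq)"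
  by (auto simp: monoid_algebra_def tens_pairs_def split: if_splits)

lemma tens_closed: "a \<in> FR_comp lq \<alpha> \<gamma> \<Longrightarrow> b \<in> FR_comp lq \<gamma> \<beta> \<Longrightarrow> tens lq a b \<in> carrier (FR_tensor lq)"
  using ring_hom_closed[OF tens_proj_hom pair_carrier] unfolding tens_def tens_proj_def by blast

definition tens_val where "tens_val lq x = ring_embed (FR_tensor lq) (tens_proj lq x)"

lemma tens_val_add:
  assumes "x \<in> carrier (pair_ring lq)" "y \<in> carrier (pair_ring lq)"
  shows "tens_val lq (x + y) = tens_val lq x + tens_val lq y"
proof -
  have "x \<oplus>\<^bsub>pair_ring lq\<^esub> y = x + y" by (simp add: monoid_algebra_def)
  then show ?thesis
    using ring_hom_add[OF tens_proj_hom assms] ring_hom_closed[OF tens_proj_hom assms(1)] ring_hom_closed[OF tens_proj_hom assms(2)]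
    by (simp add: tens_val_def ring_embed_add[OF FR_tensor_ring])
qed

lemma tens_val_rel: "x \<in> tens_rels lq \<Longrightarrow> tens_val lq x = 0"
proof -
  assume "x \<in> tens_rels lq"
  then have "x \<in> tens_ideal lq"
    unfolding tens_ideal_def using ring.genideal_self[OF pair_ring_ring tens_rels_carrier] by blast
  then have "tens_proj lq x = \<zero>\<^bsub>FR_tensor lq\<^esub>"
    unfolding tens_proj_def FR_tensor_def FactRing_def by (simp add: ring.a_rcos_zero[OF pair_ring_ring tens_ideal_ideal])
  then show ?thesis by (simp add: tens_val_def ring_embed_zero[OF FR_tensor_ring])
qed

lemma tens_val_rel2:
  assumes "x - y \<in> tens_rels lq" "y \<in> carrier (pair_ring lq)"
  shows "tens_val lq x = tens_val lq y"
proof -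
  have "x - y \<in> carrier (pair_ring lq)" using assms(1) tens_rels_carrier by blast
  from tens_val_add[OF this assms(2)] tens_val_rel[OF assms(1)] show ?thesis by simp
qed

lemma tens_val_rel3:
  assumes "x - y - z \<in> tens_rels lq" "y \<in> carrier (pair_ring lq)" "z \<in> carrier (pair_ring lq)"
  shows "tens_val lq x = tens_val lq y + tens_val lq z"
proof -
  have "y + z \<in> carrier (pair_ring lq)"
    using assms(2,3) Poly_Mapping.keys_add[of y z] by (auto simp: monoid_algebra_def)
  from tens_val_rel2[OF _ this, of x] show ?thesis using assms tens_val_add by (simp add: diff_diff_add)
qed

text \<open>The embedded pure tensor of two classes, given by representatives. The inner degrees
  must match for this to be meaningful, so the rules below carry homogeneity hypotheses.\<close>

definition tw :: "complex \<Rightarrow> 'n::{finite,linorder} free_alg \<Rightarrow> 'n free_alg \<Rightarrow> _" where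
  "tw lq u v = tens_val lq (pair_elem 1 (FR_proj lq u) (FR_proj lq v))"

lemma tw_eq_ring_embed: "tw lq u v = ring_embed (FR_tensor lq) (tens lq (FR_proj lq u) (FR_proj lq v))"
  by (simp add: tw_def tens_val_def tens_proj_def tens_def)

context
  fixes lq :: complex and u v :: "'n::{finite,linorder} free_alg" and \<alpha> \<gamma> \<beta> :: "(complex, 'n) vec"
  assumes u: "homogeneous \<alpha> \<gamma> u" and v: "homogeneous \<gamma> \<beta> v"
begin

lemma tw_mult:
  assumes "homogeneous \<alpha>' \<gamma>' u'" "homogeneous \<gamma>' \<beta>' v'"
  shows "tw lq u v * tw lq u' v' = tw lq (u \<otimes>\<^bsub>free_ring\<^esub> u') (v \<otimes>\<^bsub>free_ring\<^esub> v')"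
proof -
  let ?p = "pair_elem 1 (FR_proj lq u) (FR_proj lq v)" and ?p' = "pair_elem 1 (FR_proj lq u') (FR_proj lq v')"
  have c: "?p \<in> carrier (pair_ring lq)" "?p' \<in> carrier (pair_ring lq)"
    using homogeneous_FR_comp u v assms by (blast intro: pair_carrier)+
  have "?p \<otimes>\<^bsub>pair_ring lq\<^esub> ?p' = pair_elem 1 (FR_proj lq (u \<otimes>\<^bsub>free_ring\<^esub> u')) (FR_proj lq (v \<otimes>\<^bsub>free_ring\<^esub> v'))"
    by (simp add: monoid_algebra_mult_single FR_proj_hom_simps) (simp add: tens_pairs_def)
  then show ?thesis
    using ring_hom_mult[OF tens_proj_hom c] ring_hom_closed[OF tens_proj_hom c(1)] ring_hom_closed[OF tens_proj_hom c(2)]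
    by (simp add: tw_def tens_val_def ring_embed_mult[OF FR_tensor_ring])
qed

lemma tw_add_left:
  assumes "homogeneous \<alpha> \<gamma> u'" shows "tw lq (u + u') v = tw lq u v + tw lq u' v"
proof -
  note c = homogeneous_FR_comp[OF u, of lq] homogeneous_FR_comp[OF assms, of lq] homogeneous_FR_comp[OF v, of lq]
  have "pair_elem 1 (FR_proj lq u \<oplus>\<^bsub>FR lq\<^esub> FR_proj lq u') (FR_proj lq v) - pair_elem 1 (FR_proj lq u) (FR_proj lq v) - pair_elem 1 (FR_proj lq u') (FR_proj lq v) \<in> tens_rels lq"
    unfolding tens_rels_def Un_iff mem_Collect_eq using c by blast
  then show ?thesis unfolding tw_def FR_proj_hom_simps
    by (rule tens_val_rel3) (rule pair_carrier; rule c)+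
qed

lemma tw_add_right:
  assumes "homogeneous \<gamma> \<beta> v'" shows "tw lq u (v + v') = tw lq u v + tw lq u v'"
proof -
  note c = homogeneous_FR_comp[OF u, of lq] homogeneous_FR_comp[OF assms, of lq] homogeneous_FR_comp[OF v, of lq]
  have "pair_elem 1 (FR_proj lq u) (FR_proj lq v \<oplus>\<^bsub>FR lq\<^esub> FR_proj lq v') - pair_elem 1 (FR_proj lq u) (FR_proj lq v) - pair_elem 1 (FR_proj lq u) (FR_proj lq v') \<in> tens_rels lq"
    unfolding tens_rels_def Un_iff mem_Collect_eq using c by blast
  then show ?thesis unfolding tw_def FR_proj_hom_simps
    by (rule tens_val_rel3) (rule pair_carrier; rule c)+
qed

lemma tw_balanced: "tw lq (word [Mu f] \<otimes>\<^bsub>free_ring\<^esub> u) v = tw lq u (word [Lam f] \<otimes>\<^bsub>free_ring\<^esub> v)"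
proof -
  note c = homogeneous_FR_comp[OF u, of lq] homogeneous_FR_comp[OF v, of lq]
  have "pair_elem 1 (mu_r lq f \<otimes>\<^bsub>FR lq\<^esub> FR_proj lq u) (FR_proj lq v) - pair_elem 1 (FR_proj lq u) (mu_l lq f \<otimes>\<^bsub>FR lq\<^esub> FR_proj lq v) \<in> tens_rels lq"
    unfolding tens_rels_def Un_iff mem_Collect_eq using c by (intro disjI2) blast
  moreover have "mu_l lq f \<otimes>\<^bsub>FR lq\<^esub> FR_proj lq v \<in> FR_comp lq \<gamma> \<beta>"
    using FR_comp_mult[OF FR_comp_degree_zero(1) c(2)] by simp
  ultimately show ?thesis unfolding tw_def FR_proj_hom_simps mu_l_def[symmetric] mu_r_def[symmetric]
    by (intro tens_val_rel2) (auto intro: pair_carrier c)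
qed

lemma tw_scalar: "tw lq (Poly_Mapping.single [] z \<otimes>\<^bsub>free_ring\<^esub> u) v = tw lq u (Poly_Mapping.single [] z \<otimes>\<^bsub>free_ring\<^esub> v)"
proof -
  note c = homogeneous_FR_comp[OF u, of lq] homogeneous_FR_comp[OF v, of lq]
  have "pair_elem 1 (FR_scalar lq z \<otimes>\<^bsub>FR lq\<^esub> FR_proj lq u) (FR_proj lq v) - pair_elem z (FR_proj lq u) (FR_proj lq v) \<in> tens_rels lq"
    unfolding tens_rels_def Un_iff mem_Collect_eq by (rule disjI1, rule disjI1, rule disjI2, insert c, blast)
  moreover have "pair_elem 1 (FR_proj lq u) (FR_scalar lq z \<otimes>\<^bsub>FR lq\<^esub> FR_proj lq v) - pair_elem z (FR_proj lq u) (FR_proj lq v) \<in> tens_rels lq"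
    unfolding tens_rels_def Un_iff mem_Collect_eq by (rule disjI1, rule disjI2, insert c, blast)
  moreover have "pair_elem z (FR_proj lq u) (FR_proj lq v) \<in> carrier (pair_ring lq)" by (rule pair_carrier; rule c)
  ultimately show ?thesis unfolding tw_def FR_proj_hom_simps FR_scalar_def[symmetric]
    using tens_val_rel2 by metis
qed

end

lemma tw_zero_left:
  assumes v: "homogeneous \<gamma> \<beta> v" shows "tw lq 0 v = 0"
  using tw_add_left[OF homogeneous_zero v homogeneous_zero, of lq] by simp

lemma tw_zero_right:
  assumes u: "homogeneous \<alpha> \<gamma> u" shows "tw lq u 0 = 0"
  using tw_add_right[OF u homogeneous_zero homogeneous_zero, of lq] by simp

lemma tw_sum_left:
  assumes "\<And>i. i \<in> A \<Longrightarrow> homogeneous \<alpha> \<gamma> (F i)" "homogeneous \<gamma> \<beta> v"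
  shows "tw lq (sum F A) v = (\<Sum>i\<in>A. tw lq (F i) v)"
  using assms
proof (induction A rule: infinite_finite_induct)
  case (insert x A)
  then have "tw lq (F x + sum F A) v = tw lq (F x) v + tw lq (sum F A) v"
    by (intro tw_add_left homogeneous_sum) auto
  then show ?case using insert by simp
qed (auto simp: tw_zero_left)

lemma tw_sum_right:
  assumes "\<And>i. i \<in> A \<Longrightarrow> homogeneous \<gamma> \<beta> (F i)" "homogeneous \<alpha> \<gamma> u"
  shows "tw lq u (sum F A) = (\<Sum>i\<in>A. tw lq u (F i))"
  using assms
proof (induction A rule: infinite_finite_induct)
  case (insert x A)
  then have "tw lq u (F x + sum F A) = tw lq u (F x) + tw lq u (sum F A)"
    by (intro tw_add_right homogeneous_sum) auto
  then show ?case using insert by simp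
qed (auto simp: tw_zero_right)

lemma tw_cong: "FR_proj lq u = FR_proj lq u' \<Longrightarrow> FR_proj lq v = FR_proj lq v' \<Longrightarrow> tw lq u v = tw lq u' v'"
  by (simp add: tw_def)

lemma tw_mult_word:
  assumes "word_deg a = (\<alpha>, \<gamma>)" "word_deg b = (\<gamma>, \<beta>)" "word_deg c = (\<alpha>', \<gamma>')" "word_deg d = (\<gamma>', \<beta>')"
  shows "tw lq (word a) (word b) * tw lq (word c) (word d) = tw lq (word (a @ c)) (word (b @ d))"
  using tw_mult[of \<alpha> \<gamma> "word a" \<beta> "word b" \<alpha>' \<gamma>' "word c" \<beta>' "word d" lq] assms
  by (simp add: homogeneous_word word_mult)

text \<open>Terms of the RLL-relation with vanishing coefficient may have the wrong degree, so they have to be dropped before bilinearity of the tensor product applies.\<close>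

definition nz_word :: "'n mero \<Rightarrow> 'n gen list \<Rightarrow> 'n::{finite,linorder} free_alg" where
  "nz_word f w = (if f = 0 then 0 else word w)"

lemma fr_word_append: "fr_val lq (word (v @ w)) = fr_val lq (word v) * fr_val lq (word w)"
  by (simp flip: word_mult add: fr_val_mult)

lemma FR_proj_nz_word:
  assumes "lq \<noteq> 0"
  shows "FR_proj lq (nz_word f (Lam f # w)) = FR_proj lq (word (Lam f # w))"
    and "FR_proj lq (nz_word f (Mu f # w)) = FR_proj lq (word (Mu f # w))"
proof -
  interpret F: dyn_ring lq "fr_l lq" "fr_r lq" "fr_t lq :: 'a \<Rightarrow> 'a \<Rightarrow> _" by (rule fr_dyn_ring[OF assms])
  show "FR_proj lq (nz_word f (Lam f # w)) = FR_proj lq (word (Lam f # w))"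
    unfolding fr_val_inject[symmetric]
    using fr_word_append[of lq "[Lam f]" w] by (auto simp: nz_word_def fr_val_zero)
  show "FR_proj lq (nz_word f (Mu f # w)) = FR_proj lq (word (Mu f # w))"
    unfolding fr_val_inject[symmetric]
    using fr_word_append[of lq "[Mu f]" w] by (auto simp: nz_word_def fr_val_zero)
qed

lemma FR_RLL_nz:
  assumes "lq \<noteq> 0"
  shows "FR_proj lq (\<Sum>x\<in>UNIV. \<Sum>y\<in>UNIV. nz_word (R_entry lq x y a c) [Lam (R_entry lq x y a c), Tgen x b, Tgen y d]) =
         FR_proj lq (\<Sum>x\<in>UNIV. \<Sum>y\<in>UNIV. nz_word (R_entry lq b d x y) [Mu (R_entry lq b d x y), Tgen c y, Tgen a x])"
proof -
  interpret F: dyn_ring lq "fr_l lq" "fr_r lq" "fr_t lq :: 'a \<Rightarrow> 'a \<Rightarrow> _" by (rule fr_dyn_ring[OF assms])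
  have nz: "fr_val lq (nz_word f (Lam f # w)) = fr_val lq (word (Lam f # w))" "fr_val lq (nz_word f (Mu f # w)) = fr_val lq (word (Mu f # w))" for f w
    unfolding fr_val_inject by (rule FR_proj_nz_word[OF assms])+
  show ?thesis
    unfolding fr_val_inject[symmetric] fr_val_sum nz using F.RLL by (simp add: fr_val_Cons mult.assoc)
qed

lemma R_entry_degree: "R_entry lq x y a c \<noteq> 0 \<Longrightarrow> omega x + omega y = omega a + (omega c :: (complex, 'n::{finite,linorder}) vec)"
  using R_entry_eq_0(1)[of x y a c] by (cases "(x, y) \<in> {(a, c), (c, a)}") (auto simp: add.commute)

section \<open>Generators of the tensor product and their RLL-relations\<close>

abbreviation "tensor_l lq f \<equiv> tw lq (word [Lam f]) (word [])"
abbreviation "tensor_r lq f \<equiv> tw lq (word []) (word [Mu f])"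
definition "tensor_t lq i j = (\<Sum>k\<in>UNIV. tw lq (word [Tgen i k]) (word [Tgen k j]))"

lemma FR_proj_Lam_one:
  fixes w :: "'n::{finite,linorder} gen list"
  shows "FR_proj lq (word (Lam 1 # w)) = FR_proj lq (word w)"
proof -
  have "FR_proj lq (Poly_Mapping.single [] 1) = mu_l lq (const_mero 1 :: 'n mero)"
    by (rule FR_proj_scalar)
  then have "FR_proj lq (word [Lam (1 :: 'n mero)]) = FR_proj lq (word [])"
    by (simp add: word_def mu_l_def)
  then show ?thesis
    unfolding fr_val_inject[symmetric] using fr_word_append[of lq "[Lam 1]" w] fr_word_append[of lq "[]" w] by simp
qed

lemma tw_sum2_left:
  assumes "\<And>x y. homogeneous \<alpha> \<gamma> (F x y)" "homogeneous \<gamma> \<beta> v"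
  shows "tw lq (\<Sum>x\<in>A. \<Sum>y\<in>B. F x y) v = (\<Sum>x\<in>A. \<Sum>y\<in>B. tw lq (F x y) v)"
  by (simp add: tw_sum_left[where \<alpha> = \<alpha>, OF _ assms(2)] assms(1) homogeneous_sum)

lemma tw_sum2_right:
  assumes "\<And>x y. homogeneous \<gamma> \<beta> (F x y)" "homogeneous \<alpha> \<gamma> u"
  shows "tw lq u (\<Sum>x\<in>A. \<Sum>y\<in>B. F x y) = (\<Sum>x\<in>A. \<Sum>y\<in>B. tw lq u (F x y))"
  by (simp add: tw_sum_right[where \<beta> = \<beta>, OF _ assms(2)] assms(1) homogeneous_sum)

lemmas degree_simps = word_deg_simps homogeneous_word zero_prod_def

lemma tensor_l_t_t:
  "tensor_l lq f * tensor_t lq x b * tensor_t lq y d =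
     (\<Sum>k\<in>UNIV. \<Sum>m\<in>UNIV. tw lq (word [Lam f, Tgen x k, Tgen y m]) (word [Tgen k b, Tgen m d]))"
proof -
  have "tensor_l lq f * tw lq (word [Tgen x k]) (word [Tgen k b]) * tw lq (word [Tgen y m]) (word [Tgen m d]) =
    tw lq (word [Lam f, Tgen x k, Tgen y m]) (word [Tgen k b, Tgen m d])" for k m
    by (simp add: tw_mult_word degree_simps)
  then show ?thesis unfolding tensor_t_def sum_distrib_left[of "tensor_l lq f"] sum_product by simp
qed

lemma tensor_r_t_t:
  "tensor_r lq f * tensor_t lq c m * tensor_t lq a k =
     (\<Sum>x\<in>UNIV. \<Sum>y\<in>UNIV. tw lq (word [Tgen c y, Tgen a x]) (word [Mu f, Tgen y m, Tgen x k]))"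
proof -
  have "tensor_r lq f * tw lq (word [Tgen c y]) (word [Tgen y m]) * tw lq (word [Tgen a x]) (word [Tgen x k]) =
    tw lq (word [Tgen c y, Tgen a x]) (word [Mu f, Tgen y m, Tgen x k])" for x y
    by (simp add: tw_mult_word degree_simps)
  then show ?thesis unfolding tensor_t_def sum_distrib_left[of "tensor_r lq f"] sum_product by (subst sum.swap) simp
qed

text \<open>For RLL, the relation in the left factor turns R(\<lambda>) into R(\<mu>) acting on that
  factor. Balancing reads this as R(\<lambda>) on the right factor, and the relation there turns it
  into R(\<mu>) on the right.\<close>

lemma tensor_dyn_ring:
  assumes lq: "lq \<noteq> 0"
  shows "dyn_ring lq (tensor_l lq) (tensor_r lq) (tensor_t lq :: 'n \<Rightarrow> 'n::{finite,linorder} \<Rightarrow> _)"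
proof
  interpret F: dyn_ring lq "fr_l lq" "fr_r lq" "fr_t lq :: 'n \<Rightarrow> 'n \<Rightarrow> _" by (rule fr_dyn_ring[OF lq])
  fix f g :: "'n mero" and i j a b c d :: 'n and z
  show "lq \<noteq> 0" by (rule lq)
  have "FR_proj lq (word [Lam (f + g)]) = FR_proj lq (word [Lam f] + word [Lam g])"
    unfolding fr_val_inject[symmetric] by (simp add: F.ring_l_add fr_val_add)
  then have "tensor_l lq (f + g) = tw lq (word [Lam f] + word [Lam g]) (word [])"
    by (rule tw_cong) simp
  also have "\<dots> = tensor_l lq f + tensor_l lq g"
    by (rule tw_add_left[where \<alpha> = 0 and \<gamma> = 0 and \<beta> = 0]) (simp_all add: degree_simps)
  finally show "tensor_l lq (f + g) = tensor_l lq f + tensor_l lq g" .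
  have "FR_proj lq (word [Mu (f + g)]) = FR_proj lq (word [Mu f] + word [Mu g])"
    unfolding fr_val_inject[symmetric] by (simp add: F.ring_r_add fr_val_add)
  then have "tensor_r lq (f + g) = tw lq (word []) (word [Mu f] + word [Mu g])"
    by (rule tw_cong[OF refl])
  also have "\<dots> = tensor_r lq f + tensor_r lq g"
    by (rule tw_add_right[where \<alpha> = 0 and \<gamma> = 0 and \<beta> = 0]) (simp_all add: degree_simps)
  finally show "tensor_r lq (f + g) = tensor_r lq f + tensor_r lq g" .
  have eq: "FR_proj lq (word [Lam (f * g)]) = FR_proj lq (word [Lam f, Lam g])"
    unfolding fr_val_inject[symmetric] by (simp add: F.ring_l_mult fr_val_Cons)
  show "tensor_l lq (f * g) = tensor_l lq f * tensor_l lq g"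
    by (simp add: tw_mult_word degree_simps tw_cong[OF eq refl])
  have eq: "FR_proj lq (word [Mu (f * g)]) = FR_proj lq (word [Mu f, Mu g])"
    unfolding fr_val_inject[symmetric] by (simp add: F.ring_r_mult fr_val_Cons)
  show "tensor_r lq (f * g) = tensor_r lq f * tensor_r lq g"
    by (simp add: tw_mult_word degree_simps tw_cong[OF refl eq])
  show "tensor_l lq f * tensor_r lq g = tensor_r lq g * tensor_l lq f"
    by (simp add: tw_mult_word degree_simps)
  have scalar: "FR_proj lq (word [Lam (const_mero z :: 'n mero)]) = FR_proj lq (Poly_Mapping.single [] z \<otimes>\<^bsub>free_ring\<^esub> word [])"
    by (simp add: FR_proj_scalar mu_l_def word_def free_ring_mult_single)
  moreover have "FR_proj lq (word [Mu (const_mero z :: 'n mero)]) = FR_proj lq (word [Lam (const_mero z)])"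
    using F.ring_const[of z] by (simp add: fr_val_inject)
  ultimately have "tensor_l lq (const_mero z :: 'n mero) = tw lq (Poly_Mapping.single [] z \<otimes>\<^bsub>free_ring\<^esub> word []) (word [])"
    "tensor_r lq (const_mero z :: 'n mero) = tw lq (word []) (Poly_Mapping.single [] z \<otimes>\<^bsub>free_ring\<^esub> word [])"
    by (simp_all add: tw_def)
  then show "tensor_l lq (const_mero z :: 'n mero) = tensor_r lq (const_mero z)"
    using tw_scalar[where \<alpha> = 0 and \<gamma> = 0 and \<beta> = 0 and u = "word []" and v = "word []" and lq = lq and z = z]
    by (simp add: degree_simps)
  show "tensor_l lq 1 * tensor_t lq i j = tensor_t lq i j"
    unfolding tensor_t_def sum_distrib_left
    by (intro sum.cong refl) (simp add: tw_mult_word degree_simps tw_cong[OF FR_proj_Lam_one refl])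
  have eq: "FR_proj lq (word [Lam f, Tgen i k]) = FR_proj lq (word [Tgen i k, Lam (shift (omega i) f)])" for k
    unfolding fr_val_inject[symmetric] by (simp add: F.ring_l_t fr_val_Cons)
  show "tensor_l lq f * tensor_t lq i j = tensor_t lq i j * tensor_l lq (shift (omega i) f)"
    unfolding tensor_t_def sum_distrib_left sum_distrib_right
    by (intro sum.cong refl) (simp add: tw_mult_word degree_simps tw_cong[OF eq refl])
  have eq: "FR_proj lq (word [Mu f, Tgen k j]) = FR_proj lq (word [Tgen k j, Mu (shift (omega j) f)])" for k
    unfolding fr_val_inject[symmetric] by (simp add: F.ring_r_t fr_val_Cons)
  show "tensor_r lq f * tensor_t lq i j = tensor_t lq i j * tensor_r lq (shift (omega j) f)"
    unfolding tensor_t_def sum_distrib_left sum_distrib_right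
    by (intro sum.cong refl) (simp add: tw_mult_word degree_simps tw_cong[OF refl eq])
  have hom1: "homogeneous (omega a + omega c) (omega k + omega m) (nz_word (R_entry lq x y a c) [Lam (R_entry lq x y a c), Tgen x k, Tgen y m])"
    for a c k m x y :: 'n
    using R_entry_degree[of lq x y a c] by (auto simp: nz_word_def homogeneous_zero degree_simps)
  have hom2: "homogeneous (omega c + omega a) (omega k + omega m) (nz_word (R_entry lq k m x y) [Mu (R_entry lq k m x y), Tgen c y, Tgen a x])"
    for a c k m x y :: 'n
    using R_entry_degree[of lq x y k m] R_entry_degree[of lq k m x y] by (auto simp: nz_word_def homogeneous_zero degree_simps add.commute)
  have hom: "homogeneous (omega a + omega b) (omega c + omega d) (word [Tgen a c, Tgen b d])" for a b c d :: 'n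
    by (simp add: degree_simps)
  show "(\<Sum>x\<in>UNIV. \<Sum>y\<in>UNIV. tensor_l lq (R_entry lq x y a c) * tensor_t lq x b * tensor_t lq y d) =
              (\<Sum>x\<in>UNIV. \<Sum>y\<in>UNIV. tensor_r lq (R_entry lq b d x y) * tensor_t lq c y * tensor_t lq a x)"
  proof -
    have "(\<Sum>x\<in>UNIV. \<Sum>y\<in>UNIV. tensor_l lq (R_entry lq x y a c) * tensor_t lq x b * tensor_t lq y d) =
      (\<Sum>x\<in>UNIV. \<Sum>y\<in>UNIV. \<Sum>k\<in>UNIV. \<Sum>m\<in>UNIV. tw lq (nz_word (R_entry lq x y a c) [Lam (R_entry lq x y a c), Tgen x k, Tgen y m]) (word [Tgen k b, Tgen m d]))"
      unfolding tensor_l_t_t tw_cong[OF FR_proj_nz_word(1)[OF lq] refl] ..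
    also have "\<dots> = (\<Sum>k\<in>UNIV. \<Sum>m\<in>UNIV. \<Sum>x\<in>UNIV. \<Sum>y\<in>UNIV. tw lq (nz_word (R_entry lq x y a c) [Lam (R_entry lq x y a c), Tgen x k, Tgen y m]) (word [Tgen k b, Tgen m d]))"
      by (rule sum_swap_pairs)
    also have "\<dots> = (\<Sum>k\<in>UNIV. \<Sum>m\<in>UNIV. \<Sum>x\<in>UNIV. \<Sum>y\<in>UNIV. tw lq (nz_word (R_entry lq k m x y) [Mu (R_entry lq k m x y), Tgen c y, Tgen a x]) (word [Tgen k b, Tgen m d]))"
    proof (rule sum.cong[OF refl], rule sum.cong[OF refl])
      fix k m
      have "tw lq (\<Sum>x\<in>UNIV. \<Sum>y\<in>UNIV. nz_word (R_entry lq x y a c) [Lam (R_entry lq x y a c), Tgen x k, Tgen y m]) (word [Tgen k b, Tgen m d]) =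
        tw lq (\<Sum>x\<in>UNIV. \<Sum>y\<in>UNIV. nz_word (R_entry lq k m x y) [Mu (R_entry lq k m x y), Tgen c y, Tgen a x]) (word [Tgen k b, Tgen m d])"
        by (rule tw_cong[OF FR_RLL_nz[OF lq] refl])
      then show "(\<Sum>x\<in>UNIV. \<Sum>y\<in>UNIV. tw lq (nz_word (R_entry lq x y a c) [Lam (R_entry lq x y a c), Tgen x k, Tgen y m]) (word [Tgen k b, Tgen m d])) =
        (\<Sum>x\<in>UNIV. \<Sum>y\<in>UNIV. tw lq (nz_word (R_entry lq k m x y) [Mu (R_entry lq k m x y), Tgen c y, Tgen a x]) (word [Tgen k b, Tgen m d]))"
        by (simp only: tw_sum2_left[OF hom1 hom] tw_sum2_left[OF hom2 hom])
    qed
    also have "\<dots> = (\<Sum>k\<in>UNIV. \<Sum>m\<in>UNIV. \<Sum>x\<in>UNIV. \<Sum>y\<in>UNIV. tw lq (word [Tgen c y, Tgen a x]) (nz_word (R_entry lq k m x y) [Lam (R_entry lq k m x y), Tgen k b, Tgen m d]))"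
    proof (intro sum.cong refl)
      fix k m x y
      show "tw lq (nz_word (R_entry lq k m x y) [Mu (R_entry lq k m x y), Tgen c y, Tgen a x]) (word [Tgen k b, Tgen m d]) =
         tw lq (word [Tgen c y, Tgen a x]) (nz_word (R_entry lq k m x y) [Lam (R_entry lq k m x y), Tgen k b, Tgen m d])"
      proof (cases "R_entry lq k m x y = 0")
        case True
        then show ?thesis by (simp add: nz_word_def tw_zero_left[OF hom] tw_zero_right[OF hom])
      next
        case False
        \<comment> \<open>A nonzero entry preserves the total weight, so the two inner degrees agree
          and balancing is legitimate.\<close>
        from R_entry_degree[OF this] have "omega k + omega m = omega y + omega x" by (simp add: add.commute)
        then have "homogeneous (omega y + omega x) (omega b + omega d) (word [Tgen k b, Tgen m d])" using hom[of k m b d] by simp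
        from tw_balanced[OF hom this] show ?thesis using False by (simp add: nz_word_def word_mult)
      qed
    qed
    also have "\<dots> = (\<Sum>x\<in>UNIV. \<Sum>y\<in>UNIV. \<Sum>k\<in>UNIV. \<Sum>m\<in>UNIV. tw lq (word [Tgen c y, Tgen a x]) (nz_word (R_entry lq k m x y) [Lam (R_entry lq k m x y), Tgen k b, Tgen m d]))"
      by (rule sum_swap_pairs)
    also have "\<dots> = (\<Sum>x\<in>UNIV. \<Sum>y\<in>UNIV. \<Sum>k\<in>UNIV. \<Sum>m\<in>UNIV. tw lq (word [Tgen c y, Tgen a x]) (nz_word (R_entry lq b d k m) [Mu (R_entry lq b d k m), Tgen y m, Tgen x k]))"
    proof (rule sum.cong[OF refl], rule sum.cong[OF refl])
      fix x y
      have h: "homogeneous (omega c + omega a) (omega x + omega y) (word [Tgen c y, Tgen a x])"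
        by (simp add: degree_simps add.commute)
      have h2: "homogeneous (omega x + omega y) (omega b + omega d) (nz_word (R_entry lq b d k m) [Mu (R_entry lq b d k m), Tgen y m, Tgen x k])" for k m
        using hom2[of y x b d k m] by (simp add: add.commute)
      have "tw lq (word [Tgen c y, Tgen a x]) (\<Sum>k\<in>UNIV. \<Sum>m\<in>UNIV. nz_word (R_entry lq k m x y) [Lam (R_entry lq k m x y), Tgen k b, Tgen m d]) =
        tw lq (word [Tgen c y, Tgen a x]) (\<Sum>k\<in>UNIV. \<Sum>m\<in>UNIV. nz_word (R_entry lq b d k m) [Mu (R_entry lq b d k m), Tgen y m, Tgen x k])"
        by (rule tw_cong[OF refl FR_RLL_nz[OF lq]])
      then show "(\<Sum>k\<in>UNIV. \<Sum>m\<in>UNIV. tw lq (word [Tgen c y, Tgen a x]) (nz_word (R_entry lq k m x y) [Lam (R_entry lq k m x y), Tgen k b, Tgen m d])) =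
        (\<Sum>k\<in>UNIV. \<Sum>m\<in>UNIV. tw lq (word [Tgen c y, Tgen a x]) (nz_word (R_entry lq b d k m) [Mu (R_entry lq b d k m), Tgen y m, Tgen x k]))"
        by (simp only: tw_sum2_right[OF hom1 h] tw_sum2_right[OF h2 h])
    qed
    also have "\<dots> = (\<Sum>k\<in>UNIV. \<Sum>m\<in>UNIV. \<Sum>x\<in>UNIV. \<Sum>y\<in>UNIV. tw lq (word [Tgen c y, Tgen a x]) (nz_word (R_entry lq b d k m) [Mu (R_entry lq b d k m), Tgen y m, Tgen x k]))"
      by (rule sum_swap_pairs)
    also have "\<dots> = (\<Sum>k\<in>UNIV. \<Sum>m\<in>UNIV. tensor_r lq (R_entry lq b d k m) * tensor_t lq c m * tensor_t lq a k)"
      unfolding tensor_r_t_t tw_cong[OF refl FR_proj_nz_word(2)[OF lq]] ..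
    finally show ?thesis .
  qed
qed

section \<open>The comultiplication of the determinant\<close>

lemma word_deg_map2:
  "length cs = length ds \<Longrightarrow> word_deg (map2 Tgen cs ds) = (\<Sum>c\<leftarrow>cs. omega c, \<Sum>d\<leftarrow>ds. omega d)"
  by (induction cs ds rule: list_induct2) (auto simp: word_deg_simps)

lemma sum_omega_arrangement:
  "cs \<in> arrangements (UNIV :: 'n set) k \<Longrightarrow> (\<Sum>c\<leftarrow>cs. omega c :: (complex, 'n::finite) vec) = (\<chi> i. 1)"
  using sum_list_distinct_conv_sum_set[of cs "omega :: 'n \<Rightarrow> _"] by (simp add: arrangements_def vec_eq_iff)

lemma homogeneous_alt_free:
  "homogeneous (\<chi> i. 1) (\<Sum>d\<leftarrow>ds. omega d) (alt_free lq ds)"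
  unfolding alt_free_def
proof (rule homogeneous_sum)
  fix cs assume cs: "cs \<in> arrangements (UNIV :: 'a set) (length ds)"
  then have "length cs = length ds" by (simp add: arrangements_def)
  then show "homogeneous (\<chi> i. 1) (\<Sum>d\<leftarrow>ds. omega d) (word (Lam (word_coef lq cs) # map2 Tgen cs ds))"
    by (simp add: homogeneous_word word_deg_simps word_deg_map2 sum_omega_arrangement[OF cs] flip: zero_prod_def)
qed

lemma FR_proj_alt_free:
  fixes ms :: "'n::{finite,linorder} list"
  assumes lq: "lq \<noteq> 0" and ms: "length ms = CARD('n)"
  shows "FR_proj lq (alt_free lq ms) =
    FR_proj lq (if distinct ms then word [Mu (word_coef lq ms)] \<otimes>\<^bsub>free_ring\<^esub> alt_free lq (sorted_list_of_set UNIV) else 0)"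
proof -
  interpret F: dyn_ring lq "fr_l lq" "fr_r lq" "fr_t lq :: 'n \<Rightarrow> 'n \<Rightarrow> _" by (rule fr_dyn_ring[OF lq])
  have alt: "fr_val lq (alt_free lq ds) = F.alt_sum ds (fr_l lq 1)" for ds
    using fr_val_eq_free_val[OF lq, of "alt_free lq ds"] by (simp only: F.free_val_alt_free)
  show ?thesis
  proof (cases "distinct ms")
    case True
    have "set ms = UNIV" using True ms by (metis card_subset_eq distinct_card finite subset_UNIV)
    then have "sort ms = sorted_list_of_set UNIV" using True by (metis sorted_list_of_set_sort_remdups distinct_remdups_id)
    moreover have "ms \<noteq> []" using ms by auto
    ultimately show ?thesis
      using F.alt_sum_distinct[OF F.one_one True] True by (simp add: fr_val_inject[symmetric] alt fr_val_mult)
  next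
    case False
    then show ?thesis using F.alt_sum_not_distinct[OF F.one_one False] by (simp add: fr_val_inject[symmetric] alt fr_val_zero)
  qed
qed

lemma FR_proj_Nil: "FR_proj lq (word []) = \<one>\<^bsub>FR lq\<^esub>"
  using FR_proj_one by (simp add: word_def)

lemma tens_one: "tens lq \<one>\<^bsub>FR lq\<^esub> (\<one>\<^bsub>FR lq\<^esub> :: 'n::{finite,linorder} fr) = \<one>\<^bsub>FR_tensor lq\<^esub>"
proof -
  have "pair_elem 1 \<one>\<^bsub>FR lq\<^esub> (\<one>\<^bsub>FR lq\<^esub> :: 'n fr) = \<one>\<^bsub>pair_ring lq\<^esub>"
    by (simp add: monoid_algebra_def tens_pairs_def)
  then show ?thesis unfolding tens_def tens_proj_def[symmetric] by (simp only: ring_hom_one[OF tens_proj_hom])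
qed

lemma comult_qdet:
  assumes lq: "lq \<noteq> 0"
  shows "comult lq (qdet lq :: 'n::{finite,linorder} fr) = tens lq (qdet lq) (qdet lq)"
proof -
  let ?S = "FR_tensor lq :: (('n fr \<times> 'n fr) \<Rightarrow>\<^sub>0 complex) set ring"
  let ?gl = "\<lambda>f :: 'n mero. tens lq (mu_l lq f) \<one>\<^bsub>FR lq\<^esub>"
  let ?gr = "\<lambda>f :: 'n mero. tens lq \<one>\<^bsub>FR lq\<^esub> (mu_r lq f)"
  let ?gt = "\<lambda>i j :: 'n. \<Oplus>\<^bsub>FR_tensor lq\<^esub>k\<in>UNIV. tens lq (t_gen lq i k) (t_gen lq k j)"
  interpret S: Ring.ring ?S by (rule FR_tensor_ring)
  have t: "t_gen lq i j \<in> FR_comp lq (omega i) (omega j)" for i j :: 'n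
    unfolding t_gen_def by (rule homogeneous_FR_comp) (simp add: degree_simps)
  have closed: "?gl f \<in> carrier ?S" "?gr f \<in> carrier ?S" "?gt i j \<in> carrier ?S" for f i j
    using tens_closed FR_comp_degree_zero FR_comp_one t by (blast intro: S.finsum_closed)+
  have ring_embed: "(\<lambda>f. ring_embed ?S (?gl f)) = tensor_l lq" "(\<lambda>f. ring_embed ?S (?gr f)) = tensor_r lq" "(\<lambda>i j. ring_embed ?S (?gt i j)) = tensor_t lq"
    using t by (auto simp: fun_eq_iff tw_eq_ring_embed FR_proj_Nil mu_l_def mu_r_def tensor_t_def t_gen_def[symmetric]
       intro!: ring_embed_finsum[OF FR_tensor_ring] tens_closed)
  interpret D: dyn_ring lq "tensor_l lq" "tensor_r lq" "tensor_t lq :: 'n \<Rightarrow> 'n \<Rightarrow> _" by (rule tensor_dyn_ring[OF lq])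
  have dyn: "dyn_ring lq (\<lambda>f. ring_embed ?S (?gl f)) (\<lambda>f. ring_embed ?S (?gr f)) (\<lambda>i j. ring_embed ?S (?gt i j))"
    unfolding ring_embed by (rule tensor_dyn_ring[OF lq])
  have "?gl 1 = \<one>\<^bsub>?S\<^esub>" by (simp add: mu_l_one tens_one)
  from FR_hom_unique_exists[OF FR_tensor_ring dyn closed this]
  have "\<exists>!\<Delta>. \<Delta> \<in> ring_hom (FR lq) ?S \<and> \<Delta> \<in> extensional (carrier (FR lq)) \<and>
     (\<forall>i j. \<Delta> (t_gen lq i j) = ?gt i j) \<and> (\<forall>f. \<Delta> (mu_l lq f) = ?gl f) \<and> (\<forall>f. \<Delta> (mu_r lq f) = ?gr f)" .
  from theI'[OF this] have \<Delta>: "comult lq \<in> ring_hom (FR lq) ?S" "\<And>f. comult lq (mu_l lq f) = ?gl f"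
     "\<And>f. comult lq (mu_r lq f) = ?gr f" "\<And>i j. comult lq (t_gen lq i j) = ?gt i j"
    unfolding comult_def[symmetric] by blast+
  let ?s = "sorted_list_of_set (UNIV :: 'n set)"
  let ?n = "CARD('n)"
  \<comment> \<open>The inner indices of the factors of the tensor generators form an unrestricted
    word \<open>ms\<close>; repetitions are removed only later, by the column rule in the left
    factor.\<close>
  have word_act: "D.word_act cs ds (tensor_l lq 1) = (\<Sum>ms\<in>words (length ds). tw lq (word (map2 Tgen cs ms)) (word (map2 Tgen ms ds)))"
    if "length cs = length ds" for cs ds
    using that
  proof (induction cs ds rule: list_induct2)
    case Nil
    then show ?case by (simp add: words_def tw_def FR_proj_Lam_one)
  next
    case (Cons c cs d ds)
    have tw: "tw lq (word [Tgen c k]) (word [Tgen k d]) * tw lq (word (map2 Tgen cs ms)) (word (map2 Tgen ms ds)) =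
       tw lq (word (map2 Tgen (c # cs) (k # ms))) (word (map2 Tgen (k # ms) (d # ds)))" if "ms \<in> words (length ds)" for k ms
      using that Cons.hyps by (subst tw_mult_word) (auto simp: words_def word_deg_map2 word_deg_simps)
    have "D.word_act (c # cs) (d # ds) (tensor_l lq 1) = tensor_t lq c d * D.word_act cs ds (tensor_l lq 1)" by simp
    then show ?case
      unfolding Cons.IH tensor_t_def[of lq c d] sum_product length_Cons sum_words_Suc by (simp only: tw cong: sum.cong)
  qed
  have s: "?s \<in> arrangements UNIV ?n" by (simp add: arrangements_def)
  have "ring_embed ?S (comult lq (qdet lq)) = D.alt_sum ?s (tensor_l lq 1)"
    unfolding qdet_eq_alt_free[OF lq] FR_hom_eval[OF FR_tensor_ring dyn \<Delta>] ring_embed by (rule D.free_val_alt_free)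
  also have "\<dots> = (\<Sum>cs\<in>arrangements UNIV ?n. \<Sum>ms\<in>words ?n. tw lq (word (Lam (word_coef lq cs) # map2 Tgen cs ms)) (word (map2 Tgen ms ?s)))"
  proof -
    have "tensor_l lq (word_coef lq cs) * tw lq (word (map2 Tgen cs ms)) (word (map2 Tgen ms ?s)) =
      tw lq (word (Lam (word_coef lq cs) # map2 Tgen cs ms)) (word (map2 Tgen ms ?s))"
      if "cs \<in> arrangements UNIV ?n" "ms \<in> words ?n" for cs ms
      using that by (subst tw_mult_word) (auto simp: words_def arrangements_def word_deg_map2 word_deg_simps zero_prod_def)
    then show ?thesis
      by (simp add: D.alt_sum_def word_act arrangements_def sum_distrib_left)
  qed
  also have "\<dots> = (\<Sum>ms\<in>words ?n. tw lq (alt_free lq ms) (word (map2 Tgen ms ?s)))"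
  proof (subst sum.swap, rule sum.cong[OF refl])
    fix ms :: "'n list" assume ms: "ms \<in> words ?n"
    have "homogeneous (\<chi> i. 1) (\<Sum>m\<leftarrow>ms. omega m) (word (Lam (word_coef lq cs) # map2 Tgen cs ms))"
      if "cs \<in> arrangements UNIV ?n" for cs
      using that ms sum_omega_arrangement[OF that] by (simp add: words_def arrangements_def homogeneous_word word_deg_simps word_deg_map2 flip: zero_prod_def)
    moreover have "homogeneous (\<Sum>m\<leftarrow>ms. omega m) (\<Sum>m\<leftarrow>?s. omega m) (word (map2 Tgen ms ?s))"
      using ms by (simp add: words_def homogeneous_word word_deg_map2)
    ultimately have "tw lq (\<Sum>cs\<in>arrangements UNIV ?n. word (Lam (word_coef lq cs) # map2 Tgen cs ms)) (word (map2 Tgen ms ?s)) =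
      (\<Sum>cs\<in>arrangements UNIV ?n. tw lq (word (Lam (word_coef lq cs) # map2 Tgen cs ms)) (word (map2 Tgen ms ?s)))"
      by (rule tw_sum_left)
    then show "(\<Sum>cs\<in>arrangements UNIV ?n. tw lq (word (Lam (word_coef lq cs) # map2 Tgen cs ms)) (word (map2 Tgen ms ?s))) =
      tw lq (alt_free lq ms) (word (map2 Tgen ms ?s))"
      using ms by (simp add: alt_free_def words_def)
  qed
  also have "\<dots> = (\<Sum>ms\<in>arrangements UNIV ?n. tw lq (alt_free lq ?s) (word (Lam (word_coef lq ms) # map2 Tgen ms ?s)))"
  proof (rule sum.mono_neutral_cong_right)
    show "arrangements UNIV ?n \<subseteq> (words ?n :: 'n list set)" by (auto simp: arrangements_def words_def)
    show "\<forall>ms\<in>words ?n - arrangements UNIV ?n. tw lq (alt_free lq ms) (word (map2 Tgen ms ?s)) = 0"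
    proof
      fix ms :: "'n list" assume ms: "ms \<in> words ?n - arrangements UNIV ?n"
      then have "length ms = ?n" "\<not> distinct ms" using D.words_distinct by (auto simp: words_def)
      then have "FR_proj lq (alt_free lq ms) = FR_proj lq 0" using FR_proj_alt_free[OF lq, of ms] by simp
      then have "tw lq (alt_free lq ms) (word (map2 Tgen ms ?s)) = tw lq 0 (word (map2 Tgen ms ?s))" by (rule tw_cong) simp
      also have "\<dots> = 0"
        by (rule tw_zero_left) (use \<open>length ms = ?n\<close> in \<open>simp add: homogeneous_word word_deg_map2\<close>)
      finally show "tw lq (alt_free lq ms) (word (map2 Tgen ms ?s)) = 0" .
    qed
    fix ms :: "'n list" assume ms: "ms \<in> arrangements UNIV ?n"
    then have m: "length ms = ?n" "distinct ms" by (auto simp: arrangements_def)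
    \<comment> \<open>For an arrangement \<open>ms\<close> the inner degree is (1,...,1), the degree
      of the determinant itself, so the coefficient may cross the tensor sign.\<close>
    have h: "homogeneous (\<chi> i. 1) (\<chi> i. 1) (alt_free lq ?s)" "homogeneous (\<chi> i. 1) (\<chi> i. 1) (word (map2 Tgen ms ?s))"
      using homogeneous_alt_free[of ?s lq] sum_omega_arrangement[OF s] sum_omega_arrangement[OF ms] m by (simp_all add: homogeneous_word word_deg_map2)
    have "tw lq (alt_free lq ms) (word (map2 Tgen ms ?s)) = tw lq (word [Mu (word_coef lq ms)] \<otimes>\<^bsub>free_ring\<^esub> alt_free lq ?s) (word (map2 Tgen ms ?s))"
      by (rule tw_cong) (simp_all add: FR_proj_alt_free[OF lq m(1)] m(2))
    also have "\<dots> = tw lq (alt_free lq ?s) (word (Lam (word_coef lq ms) # map2 Tgen ms ?s))"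
      by (subst tw_balanced[OF h]) (simp add: word_mult)
    finally show "tw lq (alt_free lq ms) (word (map2 Tgen ms ?s)) = tw lq (alt_free lq ?s) (word (Lam (word_coef lq ms) # map2 Tgen ms ?s))" .
  qed simp_all
  also have "\<dots> = tw lq (alt_free lq ?s) (\<Sum>ms\<in>arrangements UNIV ?n. word (Lam (word_coef lq ms) # map2 Tgen ms ?s))"
  proof (rule tw_sum_right[symmetric])
    show "homogeneous (\<chi> i. 1) (\<Sum>m\<leftarrow>?s. omega m) (alt_free lq ?s)" by (rule homogeneous_alt_free)
    fix ms :: "'n list" assume ms: "ms \<in> arrangements UNIV ?n"
    then show "homogeneous (\<Sum>m\<leftarrow>?s. omega m) (\<chi> i. 1) (word (Lam (word_coef lq ms) # map2 Tgen ms ?s))"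
      using sum_omega_arrangement[OF s] sum_omega_arrangement[OF ms]
      by (simp add: homogeneous_word word_deg_simps word_deg_map2 arrangements_def flip: zero_prod_def)
  qed
  also have "\<dots> = ring_embed ?S (tens lq (qdet lq) (qdet lq))"
    by (simp add: tw_eq_ring_embed qdet_eq_alt_free[OF lq] alt_free_def)
  finally have "ring_embed ?S (comult lq (qdet lq)) = ring_embed ?S (tens lq (qdet lq) (qdet lq))" .
  moreover have "tens lq (qdet lq) (qdet lq) \<in> carrier ?S"
    using homogeneous_FR_comp[OF homogeneous_alt_free[of ?s lq]]
    unfolding qdet_eq_alt_free[OF lq] sum_omega_arrangement[OF s] by (intro tens_closed)
  moreover have "comult lq (qdet lq) \<in> carrier ?S"
    by (rule ring_hom_closed[OF \<Delta>(1)]) (simp add: qdet_def)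
  ultimately show ?thesis using ring_embed_inject[OF FR_tensor_ring] by blast
qed

theorem lemma5p1:
  fixes q lq :: complex
  assumes "exp lq = q" and "\<And>k::nat. k > 0 \<Longrightarrow> q ^ k \<noteq> 1"
  shows "(\<forall>I J :: ('n::{finite,linorder}) set.
            qdet lq \<otimes>\<^bsub>FR lq\<^esub> qminor lq I J = qminor lq I J \<otimes>\<^bsub>FR lq\<^esub> qdet lq)
       \<and> (\<forall>i j :: 'n.
            qdet lq \<otimes>\<^bsub>FR lq\<^esub> t_gen lq i j = t_gen lq i j \<otimes>\<^bsub>FR lq\<^esub> qdet lq)
       \<and> comult lq (qdet lq :: 'n fr) = tens lq (qdet lq) (qdet lq)
       \<and> counit lq (qdet lq :: 'n fr) = shift (- (\<chi> i. 1))"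
proof -
  \<comment> \<open>\<open>lq = 0\<close> would give q = 1, which is excluded by the case k =
    1.\<close>
  have lq: "lq \<noteq> 0" using assms(1) assms(2)[of 1] by auto
  show ?thesis
    using qdet_commutes[OF lq] comult_qdet[OF lq] counit_qdet[OF lq] by blast
qed

end
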